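(* Let $(X,\mu)$, $f$, $L$, $Y$, $\varphi$, $R$, $R_n$, $\mathcal{B}$ be as in the context. Assume: (i) $R_n:\mathcal{B}\to\mathcal{B}$ are bounded linear operators with $\sum_{n=1}^\infty\|R_n\|<\infty$; (ii) the eigenvalue $1$ is simple and isolated in the spectrum of $R:\mathcal{B}\to\mathcal{B}$. Suppose that $\mu(\varphi>n)=\ell(n)n^{-\beta}$, where $\ell$ is slowly varying and $\beta\in[0,1]$. Let $m(n)=\ell(n)$ for $\beta\in[0,1)$ and $m(n)=\sum_{j=1}^n\ell(j)j^{-1}$ for $\beta=1$; let $D_\beta=\Gamma(1-\beta)\Gamma(1+\beta)$ for $\beta\in(0,1)$ and $D_0=D_1=1$. Then for all $v\in\mathcal{B}$, $$\lim_{n\to\infty}D_\beta\, m(n)\,n^{-\beta}\sum_{j=1}^nL^jv=\int_Yv\,d\mu,$$ uniformly on $Y$.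
   Context: $(X,\mu)$ is a $\sigma$-finite infinite measure space and $f:X\to X$ is a conservative measure preserving map, with transfer operator $L:L^1(X)\to L^1(X)$, $\int_XLv\,w\,d\mu=\int_Xv\,w\circ f\,d\mu$ for $w\in L^\infty(X)$. $Y\subset X$ is measurable with $\mu(Y)=1$; $\varphi:Y\to\mathbb{Z}^+$, $\varphi(y)=\inf\{n\ge1:f^ny\in Y\}$, is the first return time (finite a.e.), and $\int_Y\varphi\,d\mu=\infty$. $F=f^\varphi:Y\to Y$ is the first return map, with transfer operator $R:L^1(Y)\to L^1(Y)$, $\int_YRv\,w\,d\mu=\int_Yv\,w\circ F\,d\mu$ for $w\in L^\infty(Y)$. For $n\ge1$, $R_nv=R(1_{\{\varphi=n\}}v)$, so $R=\sum_nR_n$. $\mathcal{B}\subset L^\infty(Y)$ is a Banach space of functions containing the constants, with norm satisfying $|v|_\infty\le\|v\|$; functions in $\mathcal{B}$ are extended by $0$ to $X$. Uniform convergence on $Y$ is modulo null sets (in $L^\infty(Y)$). *)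

theory Defs
  imports "HOL-Probability.Probability" "HOL-Library.Extended_Nat"
begin

section \<open>Complex Banach spaces and spectra\<close>

class complex_banach = banach +
  fixes scaleC :: "complex \<Rightarrow> 'a \<Rightarrow> 'a"  (infixr "*\<^sub>C" 75)
  assumes scaleC_add_right: "a *\<^sub>C (x + y) = a *\<^sub>C x + a *\<^sub>C y"
    and scaleC_add_left: "(a + b) *\<^sub>C x = a *\<^sub>C x + b *\<^sub>C x"
    and scaleC_scaleC: "a *\<^sub>C (b *\<^sub>C x) = (a * b) *\<^sub>C x"
    and scaleR_scaleC: "r *\<^sub>R x = complex_of_real r *\<^sub>C x"
    and norm_scaleC: "norm (a *\<^sub>C x) = cmod a * norm x"

lemma scaleC_one: "1 *\<^sub>C (x :: 'b::complex_banach) = x"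
  using scaleR_scaleC[of 1 x] by simp

lemma vector_space_scaleC:
  "vector_space (scaleC :: complex \<Rightarrow> 'b \<Rightarrow> 'b::complex_banach)"
  by unfold_locales (simp_all add: scaleC_add_right scaleC_add_left scaleC_scaleC scaleC_one)

lift_definition scalar_op :: "complex \<Rightarrow> ('b::complex_banach \<Rightarrow>\<^sub>L 'b)" is scaleC
proof -
  fix c :: complex
  show "bounded_linear (scaleC c :: 'b \<Rightarrow> 'b)"
    by (rule bounded_linear_intro[where K = "cmod c"])
       (simp_all add: scaleC_add_right scaleR_scaleC scaleC_scaleC norm_scaleC mult.commute)
qed

definition inverse_ops :: "('b::real_normed_vector \<Rightarrow>\<^sub>L 'b) \<Rightarrow> ('b \<Rightarrow>\<^sub>L 'b) \<Rightarrow> bool" where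
  "inverse_ops A S \<longleftrightarrow> A o\<^sub>L S = id_blinfun \<and> S o\<^sub>L A = id_blinfun"

text \<open>Bounded operators are only real-linear by their type. The following notions are the
  usual ones when \<open>T\<close> is complex-linear; the inverse of a complex-linear operator is
  automatically complex-linear.\<close>

definition op_spectrum :: "('b::complex_banach \<Rightarrow>\<^sub>L 'b) \<Rightarrow> complex set" where
  "op_spectrum T = {z. \<not> (\<exists>S. inverse_ops (scalar_op z - T) S)}"

definition op_resolvent :: "('b::complex_banach \<Rightarrow>\<^sub>L 'b) \<Rightarrow> complex \<Rightarrow> ('b \<Rightarrow>\<^sub>L 'b)" where
  "op_resolvent T z = (THE S. inverse_ops (scalar_op z - T) S)"

text \<open>The Riesz integral \<open>(2 \<pi> i)\<^sup>-\<^sup>1 \<integral> (\<xi> - T)\<^sup>-\<^sup>1 d\<xi>\<close> over the circle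
  \<open>\<xi> = z + r exp (i t)\<close>, for which \<open>d\<xi> = i r exp (i t) dt\<close>.\<close>

definition riesz_integral ::
    "('b::complex_banach \<Rightarrow>\<^sub>L 'b) \<Rightarrow> complex \<Rightarrow> real \<Rightarrow> ('b \<Rightarrow>\<^sub>L 'b)" where
  "riesz_integral T z r = (1 / (2 * pi)) *\<^sub>R
     integral {0..2 * pi}
       (\<lambda>t. scalar_op (complex_of_real r * cis t) o\<^sub>L op_resolvent T (z + complex_of_real r * cis t))"

text \<open>The radius is any one separating the isolated point \<open>z\<close> from the rest of the spectrum;
  the result does not depend on it.\<close>

definition spectral_projection ::
    "('b::complex_banach \<Rightarrow>\<^sub>L 'b) \<Rightarrow> complex \<Rightarrow> ('b \<Rightarrow>\<^sub>L 'b)" where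
  "spectral_projection T z =
     riesz_integral T z (SOME r. r > 0 \<and> cball z r \<inter> op_spectrum T = {z})"

definition eigenvalue :: "('b::complex_banach \<Rightarrow>\<^sub>L 'b) \<Rightarrow> complex \<Rightarrow> bool" where
  "eigenvalue T z \<longleftrightarrow> (\<exists>x. x \<noteq> 0 \<and> blinfun_apply T x = z *\<^sub>C x)"

text \<open>Simplicity refers to the algebraic multiplicity, the rank of the spectral projection.\<close>

definition simple_isolated_eigenvalue ::
    "('b::complex_banach \<Rightarrow>\<^sub>L 'b) \<Rightarrow> complex \<Rightarrow> bool" where
  "simple_isolated_eigenvalue T z \<longleftrightarrow>
     eigenvalue T z \<and> z isolated_in op_spectrum T \<and>
     vector_space.dim (scaleC :: complex \<Rightarrow> 'b \<Rightarrow> 'b)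
       (range (blinfun_apply (spectral_projection T z))) = 1"

section \<open>Measure preserving maps and transfer operators\<close>

definition measure_preserving_map :: "'a measure \<Rightarrow> ('a \<Rightarrow> 'a) \<Rightarrow> bool" where
  "measure_preserving_map M f \<longleftrightarrow> f \<in> measurable M M \<and> distr M M f = M"

text \<open>Conservativity: every wandering set is null.\<close>

definition conservative :: "'a measure \<Rightarrow> ('a \<Rightarrow> 'a) \<Rightarrow> bool" where
  "conservative M f \<longleftrightarrow>
     (\<forall>W \<in> sets M. disjoint_family (\<lambda>n. (f ^^ n) -` W \<inter> space M) \<longrightarrow> emeasure M W = 0)"

definition Linf_norm :: "'a measure \<Rightarrow> ('a \<Rightarrow> complex) \<Rightarrow> ereal" where
  "Linf_norm M v = esssup M (\<lambda>x. ereal (cmod (v x)))"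

definition Linf :: "'a measure \<Rightarrow> ('a \<Rightarrow> complex) set" where
  "Linf M = {v \<in> borel_measurable M. Linf_norm M v < \<infinity>}"

text \<open>\<open>L\<^sup>1\<close> is modelled by integrable functions rather than by classes modulo null sets.
  The duality determines \<open>P v\<close> almost everywhere by the almost everywhere class of \<open>v\<close>, and
  it implies linearity modulo null sets.\<close>

definition transfer_operator ::
    "'a measure \<Rightarrow> ('a \<Rightarrow> 'a) \<Rightarrow> (('a \<Rightarrow> complex) \<Rightarrow> ('a \<Rightarrow> complex)) \<Rightarrow> bool" where
  "transfer_operator M T P \<longleftrightarrow>
     (\<forall>v. integrable M v \<longrightarrow>
        integrable M (P v) \<and>
        (\<forall>w \<in> Linf M. (\<integral>x. P v x * w x \<partial>M) = (\<integral>x. v x * w (T x) \<partial>M)))"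

definition return_time :: "('a \<Rightarrow> 'a) \<Rightarrow> 'a set \<Rightarrow> 'a \<Rightarrow> enat" where
  "return_time f Y y = (INF n \<in> {n. n \<ge> 1 \<and> (f ^^ n) y \<in> Y}. enat n)"

text \<open>On the null set of points of \<open>Y\<close> that never return, the map is set to the identity, so
  that it is a measurable self-map of \<open>Y\<close>.\<close>

definition return_map :: "('a \<Rightarrow> 'a) \<Rightarrow> 'a set \<Rightarrow> 'a \<Rightarrow> 'a" where
  "return_map f Y y = (case return_time f Y y of enat n \<Rightarrow> (f ^^ n) y | \<infinity> \<Rightarrow> y)"

definition extend_by_zero :: "'a set \<Rightarrow> ('a \<Rightarrow> complex) \<Rightarrow> ('a \<Rightarrow> complex)" where
  "extend_by_zero Y v x = (if x \<in> Y then v x else 0)"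

text \<open>A Banach space of functions in \<open>L\<^sup>\<infinity>\<close>, that is, a complex linear subspace with a
  complete norm of its own: the type \<open>'b\<close> carries the Banach space structure and \<open>\<iota>\<close> sends
  an element to a representative of its class modulo null sets. The second last clause
  says that the inclusion is injective, the last one that constants belong to the space.\<close>

definition Linf_function_space ::
    "'a measure \<Rightarrow> ('b::complex_banach \<Rightarrow> 'a \<Rightarrow> complex) \<Rightarrow> bool" where
  "Linf_function_space M \<iota> \<longleftrightarrow>
     (\<forall>v. \<iota> v \<in> Linf M) \<and>
     (\<forall>u v. AE x in M. \<iota> (u + v) x = \<iota> u x + \<iota> v x) \<and>
     (\<forall>c v. AE x in M. \<iota> (c *\<^sub>C v) x = c * \<iota> v x) \<and>
     (\<forall>v. (AE x in M. \<iota> v x = 0) \<longrightarrow> v = 0) \<and>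
     (\<forall>c. \<exists>v. AE x in M. \<iota> v x = c)"

text \<open>The operator \<open>P\<close> on functions maps the space to itself, where it acts as \<open>T\<close>.\<close>

definition induces_operator ::
    "'a measure \<Rightarrow> ('b::complex_banach \<Rightarrow> 'a \<Rightarrow> complex) \<Rightarrow>
     (('a \<Rightarrow> complex) \<Rightarrow> ('a \<Rightarrow> complex)) \<Rightarrow> ('b \<Rightarrow>\<^sub>L 'b) \<Rightarrow> bool" where
  "induces_operator M \<iota> P T \<longleftrightarrow>
     (\<forall>v. AE x in M. \<iota> (blinfun_apply T v) x = P (\<iota> v) x)"

definition level_operator ::
    "('a \<Rightarrow> enat) \<Rightarrow> (('a \<Rightarrow> complex) \<Rightarrow> ('a \<Rightarrow> complex)) \<Rightarrow> nat \<Rightarrow>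
     (('a \<Rightarrow> complex) \<Rightarrow> ('a \<Rightarrow> complex))" where
  "level_operator \<phi> R n v = R (\<lambda>y. indicator {y. \<phi> y = enat n} y * v y)"

section \<open>Slow variation and normalising constants\<close>

text \<open>Only the behaviour near infinity matters for slow variation.\<close>

definition slowly_varying :: "(real \<Rightarrow> real) \<Rightarrow> bool" where
  "slowly_varying l \<longleftrightarrow>
     (\<exists>a. l \<in> borel_measurable (restrict_space borel {a..}) \<and> (\<forall>x\<ge>a. l x > 0)) \<and>
     (\<forall>c>0. ((\<lambda>x. l (c * x) / l x) \<longlongrightarrow> 1) at_top)"

definition m_seq :: "real \<Rightarrow> (real \<Rightarrow> real) \<Rightarrow> nat \<Rightarrow> real" where
  "m_seq \<beta> l n = (if \<beta> = 1 then \<Sum>j = 1..n. l (real j) / real j else l (real n))"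

definition D_const :: "real \<Rightarrow> real" where
  "D_const \<beta> = (if 0 < \<beta> \<and> \<beta> < 1 then Gamma (1 - \<beta>) * Gamma (1 + \<beta>) else 1)"

end

(* Write T_n = 1_Y L^n 1_Y. Decomposing an orbit at its first return to Y gives the renewal
   equation T_n = sum_k T_(n-k) R_k, so that T(u) = sum_n e^(-un) T_n inverts 1 - R(u), where
   R(u) = sum_k e^(-uk) R_k. The first return map preserves the measure on Y, hence the spectral
   projection of R at 1 is v |-> (int v) 1; with the reduced resolvent of R, perturbing 1 - R into
   1 - R(u) yields a(u) T(u) v -> int v for a(u) = int (1 - e^(-u phi)) = (1 - e^(-u)) sum_j
   e^(-uj) mu(phi > j). Regular variation of C(n) = sum_(j<n) mu(phi > j) gives the asymptotics
   of a(s/n), and Karamata's polynomial approximation, applied uniformly in the parameter, passes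
   from Laplace transforms to partial sums; positivity enters through |T_n v| <= ||v|| T_n 1.

   Everything is tested against averages over sets A of positive measure: the average of T_n v
   over A is a scalar functional of v, and convergence in L^infinity(Y) is convergence of these
   averages uniformly in A. *)

theory Submission
  imports Defs "HOL-Real_Asymp.Real_Asymp"
begin

text \<open>Nothing relates the speed at which R(u) tends to R to the size of a(u): the norm of R -
  R(u) is only known to tend to 0, so division by a(u) could ruin a plain perturbation estimate. The
  way out is that the integral meets R - R(u) at the right scale, since |\<integral> R_n v| \<le>
  \<mu>(\<phi> = n) ||v|| sums to |\<integral> (R - R(u)) v| \<le> a(u) ||v||. The singular
  direction is thus known to relative precision, and the reduced resolvent handles the rest, so the
  perturbed eigenvalue is never followed. The partial sums C(n), rather than the tails, carry the
  regular variation because their index 1 - \<beta> makes sense on all of [0,1], including \<beta> =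
  1 where m(n) changes form. As for the constants, \<Gamma>(2-\<beta>) is a moment of the
  exponential law and comes from the Laplace transform of the tails, while 1/\<Gamma>(1+\<beta>) is
  the integral of Karamata's weight. The identity (1-\<beta>) \<Gamma>(1-\<beta>) =
  \<Gamma>(2-\<beta>) converts C(n)/n into D m(n) n^(-\<beta>).\<close>

section \<open>Regular variation\<close>

text \<open>A weighted Stolz-Cesaro argument: once \<open>a j\<close> is within
  \<open>e / 2 * b j\<close> of \<open>L * b j\<close>, only finitely many earlier terms are
  uncontrolled, and their total \<open>K\<close> is negligible against the diverging sum of
  \<open>b\<close>.\<close>

lemma sum_ratio_tendsto:
  fixes a b :: "nat \<Rightarrow> real"
  assumes b: "\<And>j. 0 < b j" and lim: "(\<lambda>n. a n / b n) \<longlonglongrightarrow> L"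
    and div: "filterlim (\<lambda>n. \<Sum>j<n. b j) at_top sequentially"
  shows "(\<lambda>n. (\<Sum>j<n. a j) / (\<Sum>j<n. b j)) \<longlonglongrightarrow> L"
proof (rule LIMSEQ_I)
  fix e :: real assume e: "0 < e"
  obtain N where N: "\<And>n. n \<ge> N \<Longrightarrow> \<bar>a n / b n - L\<bar> < e / 2"
    using LIMSEQ_D[OF lim, of "e/2"] e by auto
  have N': "\<bar>a n - L * b n\<bar> \<le> e / 2 * b n" if "n \<ge> N" for n
  proof -
    have "\<bar>a n - L * b n\<bar> = \<bar>a n / b n - L\<bar> * b n"
    proof -
      have "a n - L * b n = (a n / b n - L) * b n" using b[of n] by (simp add: field_simps)
      then show ?thesis using b[of n] by (simp add: abs_mult)
    qed
    then show ?thesis using N[OF that] b[of n] by (simp add: mult_right_mono)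
  qed
  define K where "K = (\<Sum>j<N. \<bar>a j - L * b j\<bar>)"
  have "\<forall>\<^sub>F n in sequentially. (\<Sum>j<n. b j) > max 0 (2 * K / e)"
    using div unfolding filterlim_at_top_dense by blast
  then obtain N2 where N2: "\<And>n. n \<ge> N2 \<Longrightarrow> (\<Sum>j<n. b j) > max 0 (2 * K / e)"
    by (auto simp: eventually_sequentially)
  show "\<exists>no. \<forall>n\<ge>no. norm ((\<Sum>j<n. a j) / (\<Sum>j<n. b j) - L) < e"
  proof (intro exI allI impI)
    fix n assume n: "n \<ge> max N N2"
    let ?B = "\<Sum>j<n. b j"
    have B: "?B > 0" "?B > 2 * K / e" using N2[of n] n by auto
    have "\<bar>(\<Sum>j<n. a j) - L * ?B\<bar> = \<bar>\<Sum>j<n. a j - L * b j\<bar>"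
      by (simp add: sum_subtractf sum_distrib_left)
    also have "\<dots> \<le> (\<Sum>j<n. \<bar>a j - L * b j\<bar>)" by (rule sum_abs)
    also have "\<dots> = K + (\<Sum>j=N..<n. \<bar>a j - L * b j\<bar>)"
      unfolding K_def using n by (simp add: sum.atLeastLessThan_concat lessThan_atLeast0)
    also have "(\<Sum>j=N..<n. \<bar>a j - L * b j\<bar>) \<le> (\<Sum>j=N..<n. e / 2 * b j)"
      by (rule sum_mono) (use N' in auto)
    also have "\<dots> \<le> (\<Sum>j<n. e / 2 * b j)"
      by (rule sum_mono2) (use b e in \<open>auto intro: less_imp_le\<close>)
    also have "\<dots> = e / 2 * ?B" by (simp add: sum_distrib_left)
    also have "K + e / 2 * ?B < e * ?B" using B e by (simp add: field_simps)
    finally have *: "\<bar>(\<Sum>j<n. a j) - L * ?B\<bar> < e * ?B" by simp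
    have "\<bar>(\<Sum>j<n. a j) / ?B - L\<bar> = \<bar>(\<Sum>j<n. a j) - L * ?B\<bar> / ?B"
    proof -
      have "(\<Sum>j<n. a j) / ?B - L = ((\<Sum>j<n. a j) - L * ?B) / ?B" using B(1) by (simp add: field_simps)
      then show ?thesis using B(1) by (simp add: abs_divide)
    qed
    then show "norm ((\<Sum>j<n. a j) / ?B - L) < e"
      using * B(1) by (simp add: divide_less_eq)
  qed
qed

lemma nat_fraction_between:
  fixes x y :: real
  assumes "0 < x" "x < y"
  obtains p q :: nat where "p > 0" "q > 0" "x < real p / real q" "real p / real q < y"
proof -
  obtain r where r: "r \<in> \<rat>" "x < r" "r < y" using Rats_dense_in_real[OF assms(2)] by auto
  obtain m n :: nat where mn: "n \<noteq> 0" "\<bar>r\<bar> = real m / real n"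
    using Rats_abs_nat_div_natE[OF r(1)] by metis
  have "r = real m / real n" using mn r assms by simp
  moreover from this have "m > 0" using r assms mn by (cases m) auto
  ultimately show thesis using that[of m n] r mn by auto
qed

text \<open>The sequence stands for \<mu>(\<phi> > n). Regular variation is asked for along integer
  dilations only; monotonicity of the partial sums extends it to real dilations.\<close>

locale regularly_varying_tail =
  fixes c :: "nat \<Rightarrow> real" and \<beta> :: real
  assumes c_decseq: "decseq c" and c_pos: "\<And>n. 0 < c n" and c_0: "c 0 = 1"
    and c_dilate: "\<And>k. k \<ge> 1 \<Longrightarrow> (\<lambda>n. c (k * n) / c n) \<longlonglongrightarrow> real k powr (- \<beta>)"
    and c_not_summable: "\<not> summable c"
    and \<beta>_bounds: "0 \<le> \<beta>" "\<beta> \<le> 1"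
begin

definition C :: "nat \<Rightarrow> real" where "C n = (\<Sum>j<n. c j)"

lemma c_le_1: "c n \<le> 1"
  using decseqD[OF c_decseq, of 0 n] c_0 by simp

lemma C_mono: "m \<le> n \<Longrightarrow> C m \<le> C n"
  unfolding C_def by (rule sum_mono2) (use c_pos in \<open>auto intro: less_imp_le\<close>)

lemma C_ge_1: "n \<ge> 1 \<Longrightarrow> C n \<ge> 1"
  using C_mono[of 1 n] c_0 by (simp add: C_def)

lemma C_nonneg: "0 \<le> C n"
  unfolding C_def by (rule sum_nonneg) (use c_pos in \<open>auto intro: less_imp_le\<close>)

lemma C_at_top: "filterlim C at_top sequentially"
proof -
  have "\<not> bdd_above (range C)"
  proof
    assume "bdd_above (range C)"
    then obtain K where "\<And>n. C n \<le> K" by (auto simp: bdd_above_def)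
    then have "summable c"
      using c_pos by (intro summableI_nonneg_bounded[of c K]) (auto simp: C_def intro: less_imp_le)
    then show False using c_not_summable by simp
  qed
  then have "\<exists>n. C n \<ge> Z" for Z
    by (metis bdd_aboveI2 linorder_not_le order_less_imp_le)
  then show ?thesis unfolding filterlim_at_top eventually_sequentially
    by (meson C_mono order_trans)
qed

lemma C_blocks: "C (k * n) = (\<Sum>m<n. \<Sum>i=m*k..<m*k+k. c i)"
  unfolding C_def by (simp add: sum.nat_group mult.commute)

text \<open>Since \<open>c\<close> decreases, each of the \<open>k\<close> blocks of length
  \<open>n\<close> has a sum no larger than that of the first.\<close>

lemma C_mult_le: "C (k * n) \<le> real k * C n"
proof -
  have "C (k * n) = (\<Sum>m<k. \<Sum>i=m*n..<m*n+n. c i)"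
    using C_blocks[of n k] by (simp add: mult.commute)
  also have "\<dots> \<le> (\<Sum>m<k. C n)"
  proof (rule sum_mono)
    fix m
    have "(\<Sum>i=m*n..<m*n+n. c i) = (\<Sum>i<n. c (m * n + i))"
      using sum.shift_bounds_nat_ivl[of c 0 "m*n" n] by (simp add: lessThan_atLeast0 add.commute)
    also have "\<dots> \<le> C n" unfolding C_def
      by (rule sum_mono) (simp add: decseqD[OF c_decseq])
    finally show "(\<Sum>i=m*n..<m*n+n. c i) \<le> C n" .
  qed
  finally show ?thesis by simp
qed

text \<open>Cut \<open>{..<k * n}\<close> into \<open>n\<close> blocks of length \<open>k\<close>
  and compare each with \<open>c\<close> at its left end and at the start of the next block. This
  traps \<open>C (k * n)\<close> between \<open>k * S n - k\<close> and \<open>k * S n\<close>,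
  where \<open>S\<close> sums \<open>c\<close> along multiples of \<open>k\<close>. The ratio
  \<open>S n / C n\<close> inherits the limit of \<open>c (k * n) / c n\<close>, and the loss
  \<open>k\<close> vanishes because \<open>C\<close> diverges.\<close>

lemma C_dilate:
  assumes k: "k \<ge> 1"
  shows "(\<lambda>n. C (k * n) / C n) \<longlonglongrightarrow> real k powr (1 - \<beta>)"
proof -
  define S where "S n = (\<Sum>m<n. c (k * m))" for n
  have S: "(\<lambda>n. S n / C n) \<longlonglongrightarrow> real k powr (- \<beta>)"
    unfolding S_def C_def
    using C_at_top by (intro sum_ratio_tendsto c_pos c_dilate[OF k]) (simp add: C_def[abs_def])
  have upper: "C (k * n) \<le> real k * S n" for n
  proof -
    have "C (k * n) \<le> (\<Sum>m<n. \<Sum>i=m*k..<m*k+k. c (k * m))"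
      unfolding C_blocks by (intro sum_mono decseqD[OF c_decseq]) (auto simp: mult.commute)
    then show ?thesis by (simp add: S_def sum_distrib_left)
  qed
  have lower: "real k * S n - real k \<le> C (k * n)" for n
  proof -
    have "S n - 1 \<le> S (Suc n) - c 0" using c_0 c_pos[of "k*n"] by (simp add: S_def)
    also have "\<dots> = (\<Sum>m<n. c (k * Suc m))"
      unfolding S_def by (subst sum.lessThan_Suc_shift) simp
    finally have "real k * (S n - 1) \<le> (\<Sum>m<n. \<Sum>i=m*k..<m*k+k. c (k * Suc m))"
      using k by (simp add: sum_distrib_left[symmetric])
    also have "\<dots> \<le> C (k * n)"
      unfolding C_blocks by (intro sum_mono decseqD[OF c_decseq]) (auto simp: mult.commute)
    finally show ?thesis by (simp add: algebra_simps)
  qed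
  have lim: "(\<lambda>n. real k * (S n / C n)) \<longlonglongrightarrow> real k powr (1 - \<beta>)"
    using tendsto_mult_left[OF S, of "real k"] k
    by (simp add: powr_diff powr_minus field_simps)
  have inv: "(\<lambda>n. real k / C n) \<longlonglongrightarrow> 0"
    by (rule real_tendsto_divide_at_top[OF tendsto_const C_at_top])
  show ?thesis
  proof (rule tendsto_sandwich)
    show "\<forall>\<^sub>F n in sequentially. real k * (S n / C n) - real k / C n \<le> C (k * n) / C n"
      using lower C_nonneg by (auto intro!: always_eventually divide_right_mono simp: diff_divide_distrib[symmetric])
    show "\<forall>\<^sub>F n in sequentially. C (k * n) / C n \<le> real k * (S n / C n)"
      using upper C_nonneg by (auto intro!: always_eventually divide_right_mono)
  qed (use lim tendsto_diff[OF lim inv] in auto)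
qed

text \<open>With \<open>m = n div q\<close>, the ratio factors into \<open>C (p * m) / C m\<close>,
  the inverse of \<open>C (q * m) / C m\<close>, and \<open>C (q * m) / C n\<close>. The last factor
  tends to 1, because \<open>n\<close> and \<open>q * m\<close> differ by less than \<open>q\<close>
  and every \<open>c i\<close> is at most 1 while \<open>C\<close> diverges.\<close>

lemma C_rational_dilate:
  assumes p: "p > 0" and q: "q > 0"
  shows "(\<lambda>n. C (p * (n div q)) / C n) \<longlonglongrightarrow> (real p / real q) powr (1 - \<beta>)"
proof -
  have fl: "filterlim (\<lambda>n. n div q) sequentially sequentially"
    unfolding filterlim_at_top eventually_sequentially
    by (intro allI exI[of _ "_ * q"] impI) (use q in \<open>simp add: less_eq_div_iff_mult_less_eq\<close>)
  have 1: "(\<lambda>n. C (q * (n div q)) / C n) \<longlonglongrightarrow> 1"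
  proof (rule tendsto_sandwich)
    have le: "C n \<le> C (q * (n div q)) + real q" for n
    proof -
      have "n \<le> q * (n div q) + q"
        by (metis add_le_cancel_left less_imp_le mod_less_divisor mult_div_mod_eq q)
      then have "C n \<le> C (q * (n div q) + q)" by (rule C_mono)
      also have "\<dots> = C (q * (n div q)) + (\<Sum>i=q * (n div q)..<q * (n div q) + q. c i)"
        unfolding C_def lessThan_atLeast0 by (subst sum.atLeastLessThan_concat) auto
      also have "(\<Sum>i=q * (n div q)..<q * (n div q) + q. c i) \<le> (\<Sum>i=q * (n div q)..<q * (n div q) + q. 1)"
        by (intro sum_mono c_le_1)
      finally show ?thesis by simp
    qed
    show "\<forall>\<^sub>F n in sequentially. 1 - real q / C n \<le> C (q * (n div q)) / C n"
    proof (rule eventually_sequentiallyI[of 1])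
      fix n :: nat assume "1 \<le> n"
      then have "C n > 0" using C_ge_1[of n] by simp
      then show "1 - real q / C n \<le> C (q * (n div q)) / C n"
        using le[of n] divide_right_mono[of "C n - real q" "C (q * (n div q))" "C n"]
        by (simp add: diff_divide_distrib)
    qed
    show "\<forall>\<^sub>F n in sequentially. C (q * (n div q)) / C n \<le> 1"
    proof (rule eventually_sequentiallyI[of 1])
      fix n :: nat assume "1 \<le> n"
      then have "C n > 0" using C_ge_1[of n] by simp
      moreover have "C (q * (n div q)) \<le> C n" by (rule C_mono) simp
      ultimately show "C (q * (n div q)) / C n \<le> 1" by simp
    qed
    have "(\<lambda>n. real q / C n) \<longlonglongrightarrow> 0"
      by (rule real_tendsto_divide_at_top[OF tendsto_const C_at_top])
    from tendsto_diff[OF tendsto_const this, of 1] show "(\<lambda>n. 1 - real q / C n) \<longlonglongrightarrow> 1" by simp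
  qed simp
  have "(\<lambda>m. (C (p * m) / C m) / (C (q * m) / C m)) \<longlonglongrightarrow> real p powr (1 - \<beta>) / real q powr (1 - \<beta>)"
    using p q by (intro tendsto_divide C_dilate) auto
  from filterlim_compose[OF this fl]
  have "(\<lambda>n. (C (p * (n div q)) / C (n div q)) / (C (q * (n div q)) / C (n div q)) * (C (q * (n div q)) / C n))
      \<longlonglongrightarrow> (real p / real q) powr (1 - \<beta>) * 1"
    unfolding powr_divide by (rule tendsto_mult[OF _ 1])
  then have "(\<lambda>n. (C (p * (n div q)) / C (n div q)) / (C (q * (n div q)) / C (n div q)) * (C (q * (n div q)) / C n))
      \<longlonglongrightarrow> (real p / real q) powr (1 - \<beta>)"
    by (simp only: mult_1_right)
  then show ?thesis
  proof (rule Lim_transform_eventually)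
    show "\<forall>\<^sub>F n in sequentially. C (p * (n div q)) / C (n div q) / (C (q * (n div q)) / C (n div q)) * (C (q * (n div q)) / C n)
       = C (p * (n div q)) / C n"
    proof (rule eventually_sequentiallyI[of q])
      fix n assume "q \<le> n"
      then have m: "n div q \<ge> 1" using q by (simp add: div_greater_zero_iff Suc_leI)
      then have "C (n div q) \<ge> 1" "C (q * (n div q)) \<ge> 1"
        using q by (auto intro!: C_ge_1)
      then show "C (p * (n div q)) / C (n div q) / (C (q * (n div q)) / C (n div q)) * (C (q * (n div q)) / C n)
       = C (p * (n div q)) / C n" by simp
    qed
  qed
qed

text \<open>Monotonicity of \<open>C\<close> squeezes \<open>N n\<close> between rational dilations
  with \<open>p / q\<close> just below and just above \<open>x\<close>; continuity of the power
  closes the gap. The sequence \<open>N\<close> is arbitrary so that both floors and ceilings are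
  covered.\<close>

lemma C_real_dilate:
  assumes N: "(\<lambda>n. real (N n) / real n) \<longlonglongrightarrow> x" and x: "x > 0"
  shows "(\<lambda>n. C (N n) / C n) \<longlonglongrightarrow> x powr (1 - \<beta>)"
proof (rule order_tendstoI)
  have cont: "isCont (\<lambda>t. t powr (1 - \<beta>)) x" using x by (intro continuous_intros) auto
  fix y assume "y < x powr (1 - \<beta>)"
  then have "\<forall>\<^sub>F t in at x. y < t powr (1 - \<beta>)"
    using cont by (auto simp: isCont_def order_tendstoD)
  then obtain d where d: "d > 0" "\<And>t. t \<noteq> x \<Longrightarrow> dist t x < d \<Longrightarrow> y < t powr (1 - \<beta>)"
    by (auto simp: eventually_at)
  obtain p q :: nat where pq: "p > 0" "q > 0" "max (x - d) (x/2) < real p / real q" "real p / real q < x"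
    using nat_fraction_between[of "max (x - d) (x/2)" x] x d by (auto simp: less_max_iff_disj)
  have "y < (real p / real q) powr (1 - \<beta>)" using pq d by (intro d(2)) (auto simp: dist_real_def)
  then have "\<forall>\<^sub>F n in sequentially. y < C (p * (n div q)) / C n"
    using C_rational_dilate[OF pq(1,2)] by (auto simp: order_tendstoD)
  moreover have "\<forall>\<^sub>F n in sequentially. real p / real q < real (N n) / real n"
    using N pq by (auto simp: order_tendstoD)
  ultimately show "\<forall>\<^sub>F n in sequentially. y < C (N n) / C n"
    using eventually_ge_at_top[of 1]
  proof eventually_elim
    case (elim n)
    have "real (p * (n div q)) \<le> real p * (real n / real q)"
      using of_nat_div_le_of_nat[of n q, where 'a = real]
      by (simp add: mult_left_mono del: times_divide_eq_right)
    also have "\<dots> \<le> real (N n)" using elim(2,3) pq by (simp add: field_simps)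
    finally have "C (p * (n div q)) \<le> C (N n)" by (intro C_mono) linarith
    then have "C (p * (n div q)) / C n \<le> C (N n) / C n" using C_nonneg by (rule divide_right_mono)
    then show ?case using elim(1) by simp
  qed
next
  have cont: "isCont (\<lambda>t. t powr (1 - \<beta>)) x" using x by (intro continuous_intros) auto
  fix y assume "y > x powr (1 - \<beta>)"
  then have "\<forall>\<^sub>F t in at x. y > t powr (1 - \<beta>)"
    using cont by (auto simp: isCont_def order_tendstoD)
  then obtain d where d: "d > 0" "\<And>t. t \<noteq> x \<Longrightarrow> dist t x < d \<Longrightarrow> y > t powr (1 - \<beta>)"
    by (auto simp: eventually_at)
  obtain p q :: nat where pq: "p > 0" "q > 0" "x < real p / real q" "real p / real q < x + d"
    using nat_fraction_between[of x "x + d"] x d by auto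
  have "y > (real p / real q) powr (1 - \<beta>)" using pq d by (intro d(2)) (auto simp: dist_real_def)
  then have "\<forall>\<^sub>F n in sequentially. C (p * (n div q)) / C n < y"
    using C_rational_dilate[OF pq(1,2)] by (auto simp: order_tendstoD)
  \<comment> \<open>The margin \<open>p / n\<close> pays for rounding: \<open>p * (n div q)\<close>
    may fall short of \<open>p * n / q\<close> by up to \<open>p\<close>.\<close>
  moreover have "\<forall>\<^sub>F n in sequentially. real (N n) / real n < real p / real q - real p / real n"
  proof -
    have "(\<lambda>n. real (N n) / real n + real p / real n) \<longlonglongrightarrow> x + 0"
      by (intro tendsto_add N lim_const_over_n)
    then have "\<forall>\<^sub>F n in sequentially. real (N n) / real n + real p / real n < real p / real q"
      using pq by (intro order_tendstoD) auto
    then show ?thesis by eventually_elim simp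
  qed
  ultimately show "\<forall>\<^sub>F n in sequentially. C (N n) / C n < y"
    using eventually_ge_at_top[of 1]
  proof eventually_elim
    case (elim n)
    have "real (N n) / real n * real n \<le> (real p / real q - real p / real n) * real n"
      using elim(2) by (intro mult_right_mono) auto
    then have "real (N n) \<le> real p * (real n / real q - 1)" using elim(3) by (simp add: algebra_simps)
    also have "\<dots> \<le> real p * real (n div q)"
    proof (rule mult_left_mono)
      have "n \<le> q * (n div q) + q"
        by (metis add_le_cancel_left less_imp_le mod_less_divisor mult_div_mod_eq pq(2))
      then have "real n \<le> real q * real (n div q) + real q"
        by (metis of_nat_add of_nat_le_iff of_nat_mult)
      then show "real n / real q - 1 \<le> real (n div q)" using pq(2) by (simp add: field_simps)
    qed simp
    finally have "real (N n) \<le> real (p * (n div q))" by simp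
    then have "N n \<le> p * (n div q)" by (simp only: of_nat_le_iff)
    then have "C (N n) \<le> C (p * (n div q))" by (rule C_mono)
    then have "C (N n) / C n \<le> C (p * (n div q)) / C n" using C_nonneg by (rule divide_right_mono)
    then show ?case using elim(1) by simp
  qed
qed
end

lemma floor_ratio_tendsto:
  fixes x :: real
  assumes "x \<ge> 0"
  shows "(\<lambda>n. real (nat \<lfloor>x * real n\<rfloor>) / real n) \<longlonglongrightarrow> x"
proof (rule tendsto_sandwich)
  show "\<forall>\<^sub>F n in sequentially. x - 1 / real n \<le> real (nat \<lfloor>x * real n\<rfloor>) / real n"
  proof (rule eventually_sequentiallyI[of 1])
    fix n :: nat assume n: "1 \<le> n"
    have "x * real n - 1 \<le> real (nat \<lfloor>x * real n\<rfloor>)" using assms by linarith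
    then have "(x * real n - 1) / real n \<le> real (nat \<lfloor>x * real n\<rfloor>) / real n" by (rule divide_right_mono) simp
    then show "x - 1 / real n \<le> real (nat \<lfloor>x * real n\<rfloor>) / real n" using n by (simp add: diff_divide_distrib)
  qed
  show "\<forall>\<^sub>F n in sequentially. real (nat \<lfloor>x * real n\<rfloor>) / real n \<le> x"
  proof (rule eventually_sequentiallyI[of 1])
    fix n :: nat assume n: "1 \<le> n"
    have "real (nat \<lfloor>x * real n\<rfloor>) \<le> x * real n" using assms by (simp add: mult_nonneg_nonneg)
    then show "real (nat \<lfloor>x * real n\<rfloor>) / real n \<le> x" using n by (simp add: field_simps)
  qed
  show "(\<lambda>n. x - 1 / real n) \<longlonglongrightarrow> x"
    using tendsto_diff[OF tendsto_const lim_1_over_n, of x] by simp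
qed simp

lemma ceiling_ratio_tendsto:
  fixes x :: real
  assumes "x \<ge> 0"
  shows "(\<lambda>n. real (nat \<lceil>x * real n\<rceil>) / real n) \<longlonglongrightarrow> x"
proof (rule tendsto_sandwich)
  show "\<forall>\<^sub>F n in sequentially. x \<le> real (nat \<lceil>x * real n\<rceil>) / real n"
  proof (rule eventually_sequentiallyI[of 1])
    fix n :: nat assume n: "1 \<le> n"
    have "x * real n \<le> real (nat \<lceil>x * real n\<rceil>)" by linarith
    then show "x \<le> real (nat \<lceil>x * real n\<rceil>) / real n" using n by (simp add: field_simps)
  qed
  show "\<forall>\<^sub>F n in sequentially. real (nat \<lceil>x * real n\<rceil>) / real n \<le> x + 1 / real n"
  proof (rule eventually_sequentiallyI[of 1])
    fix n :: nat assume n: "1 \<le> n"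
    have "x * real n \<ge> 0" using assms by simp
    then have "real (nat \<lceil>x * real n\<rceil>) \<le> x * real n + 1" by linarith
    then show "real (nat \<lceil>x * real n\<rceil>) / real n \<le> x + 1 / real n" using n by (simp add: field_simps)
  qed
  show "(\<lambda>n. x + 1 / real n) \<longlonglongrightarrow> x"
    using tendsto_add[OF tendsto_const lim_1_over_n, of x] by simp
qed simp

section \<open>Monotone density and the Laplace transform of the tail\<close>

context regularly_varying_tail
begin

text \<open>As \<open>c\<close> decreases, the increment of \<open>C\<close> from \<open>n\<close>
  to a later \<open>N\<close> is at most \<open>(N - n) * c n\<close>, so secants to the right of
  \<open>n\<close> bound the density from below; secants to the left bound it from above in
  \<open>density_upper\<close>. At \<open>n = 0\<close> the left side is
  \<open>- 1 / (t - 1)\<close>, as division by 0 gives 0.\<close>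

lemma density_lower:
  assumes "1 < t"
  shows "(C (nat \<lfloor>t * real n\<rfloor>) / C n - 1) / (t - 1) \<le> real n * c n / C n"
proof (cases "n = 0")
  case False
  let ?N = "nat \<lfloor>t * real n\<rfloor>"
  have C: "C n > 0" using C_ge_1[of n] False by simp
  have "real n \<le> t * real n" using assms by (simp add: mult_le_cancel_right1)
  then have N: "n \<le> ?N" "real ?N \<le> t * real n" by linarith+
  have "C ?N - C n = (\<Sum>j=n..<?N. c j)"
    unfolding C_def lessThan_atLeast0 using N(1) sum.atLeastLessThan_concat[of 0 n ?N c] by simp
  also have "\<dots> \<le> (\<Sum>j=n..<?N. c n)" by (rule sum_mono) (simp add: decseqD[OF c_decseq])
  also have "\<dots> = (real ?N - real n) * c n" using N(1) by (simp add: of_nat_diff)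
  also have "\<dots> \<le> (t * real n - real n) * c n" using N c_pos[of n] by (intro mult_right_mono) auto
  finally have "C ?N - C n \<le> (t - 1) * (real n * c n)" by (simp add: algebra_simps)
  then have "(C ?N - C n) / (t - 1) \<le> real n * c n" using assms by (simp add: field_simps)
  from divide_right_mono[OF this, of "C n"] show ?thesis using C by (simp add: field_simps)
qed (use assms in \<open>simp add: C_def\<close>)

lemma density_upper:
  assumes "0 < t" "t < 1" "n \<ge> 1"
  shows "real n * c n / C n \<le> (C (nat \<lfloor>t * real n\<rfloor>) / C n - 1) / (t - 1)"
proof -
  let ?N = "nat \<lfloor>t * real n\<rfloor>"
  have C: "C n > 0" using C_ge_1[of n] assms by simp
  have "t * real n \<le> real n" using assms by (simp add: mult_le_cancel_right2)
  moreover have "0 \<le> t * real n" using assms by simp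
  ultimately have N: "?N \<le> n" "real ?N \<le> t * real n" by linarith+
  have "C n - C ?N = (\<Sum>j=?N..<n. c j)"
    unfolding C_def lessThan_atLeast0 using N(1) sum.atLeastLessThan_concat[of 0 ?N n c] by simp
  moreover have "\<dots> \<ge> (\<Sum>j=?N..<n. c n)" by (rule sum_mono) (simp add: decseqD[OF c_decseq])
  moreover have "(\<Sum>j=?N..<n. c n) = (real n - real ?N) * c n" using N(1) by (simp add: of_nat_diff)
  moreover have "\<dots> \<ge> (real n - t * real n) * c n" using N c_pos[of n] by (intro mult_right_mono) auto
  ultimately have "C n - C ?N \<ge> (1 - t) * (real n * c n)" by (simp add: algebra_simps)
  then have "real n * c n \<le> (C ?N - C n) / (t - 1)" using assms by (simp add: field_simps)
  from divide_right_mono[OF this, of "C n"] show ?thesis using C by (simp add: field_simps)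
qed

text \<open>For fixed \<open>t\<close> the secant bounds have limit
  \<open>(t powr (1 - \<beta>) - 1) / (t - 1)\<close>; letting \<open>t\<close> tend to 1
  afterwards, from either side, produces the derivative 1 - \<beta>. For \<beta> = 1 this only says
  that \<open>n * c n\<close> is negligible against \<open>C n\<close>, which is why that case is
  normalised by a sum.\<close>

lemma monotone_density: "(\<lambda>n. real n * c n / C n) \<longlonglongrightarrow> 1 - \<beta>"
proof (rule order_tendstoI)
  let ?q = "\<lambda>t. (t powr (1 - \<beta>) - 1) / (t - 1)"
  have "((\<lambda>t. t powr (1 - \<beta>)) has_real_derivative 1 - \<beta>) (at 1)"
    using has_real_derivative_powr[of 1 "1 - \<beta>"] by simp
  then have q: "(?q \<longlongrightarrow> 1 - \<beta>) (at 1)" by (simp add: has_field_derivative_iff)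
  have lim: "(\<lambda>n. (C (nat \<lfloor>t * real n\<rfloor>) / C n - 1) / (t - 1)) \<longlonglongrightarrow> ?q t" if "0 < t" "t \<noteq> 1" for t
    using that by (intro tendsto_divide tendsto_diff C_real_dilate floor_ratio_tendsto tendsto_const) auto
  {
    fix y assume "y < 1 - \<beta>"
    then have "\<forall>\<^sub>F t in at 1. y < ?q t" using q by (auto simp: order_tendstoD)
    then have "\<forall>\<^sub>F t in at_right 1. y < ?q t" by (simp add: eventually_at_split)
    then obtain b where "b > 1" "\<And>t. 1 < t \<Longrightarrow> t < b \<Longrightarrow> y < ?q t"
      by (auto simp: eventually_at_right_field)
    then obtain t where t: "1 < t" "y < ?q t" using dense by blast
    have "\<forall>\<^sub>F n in sequentially. y < (C (nat \<lfloor>t * real n\<rfloor>) / C n - 1) / (t - 1)"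
      using t by (intro order_tendstoD(1)[OF lim]) auto
    then show "\<forall>\<^sub>F n in sequentially. y < real n * c n / C n"
      by eventually_elim (rule less_le_trans[OF _ density_lower[OF t(1)]])
  next
    fix y assume "y > 1 - \<beta>"
    then have "\<forall>\<^sub>F t in at 1. y > ?q t" using q by (auto simp: order_tendstoD)
    then have "\<forall>\<^sub>F t in at_left 1. y > ?q t" by (simp add: eventually_at_split)
    then obtain b where b: "b < 1" "\<And>t. b < t \<Longrightarrow> t < 1 \<Longrightarrow> y > ?q t"
      by (auto simp: eventually_at_left_field)
    obtain t where t': "max b 0 < t" "t < 1" using dense[of "max b 0" 1] b(1) by auto
    then have t: "0 < t" "t < 1" "y > ?q t" using b(2) by auto
    have "\<forall>\<^sub>F n in sequentially. (C (nat \<lfloor>t * real n\<rfloor>) / C n - 1) / (t - 1) < y"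
      using t by (intro order_tendstoD(2)[OF lim]) auto
    then show "\<forall>\<^sub>F n in sequentially. real n * c n / C n < y"
      using eventually_ge_at_top[of 1]
      by eventually_elim (rule le_less_trans[OF density_upper[OF t(1,2)]])
  }
qed

text \<open>A bound linear in \<open>N / n\<close> and uniform in \<open>n\<close>: with
  \<open>N\<close> about \<open>x * n / s\<close> it dominates the integrands of
  \<open>laplace_tendsto\<close>.\<close>

lemma C_real_le: "n \<ge> 1 \<Longrightarrow> C N \<le> (real N / real n + 1) * C n"
proof -
  assume n: "n \<ge> 1"
  have "N \<le> (N div n + 1) * n" using n by (metis add_le_cancel_left distrib_right div_mult_mod_eq mod_less_divisor less_imp_le mult_1 One_nat_def Suc_le_eq)
  then have "C N \<le> C ((N div n + 1) * n)" by (rule C_mono)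
  also have "\<dots> \<le> real (N div n + 1) * C n" by (rule C_mult_le)
  also have "\<dots> \<le> (real N / real n + 1) * C n"
    using of_nat_div_le_of_nat[of N n, where 'a = real] C_nonneg by (intro mult_right_mono) auto
  finally show ?thesis .
qed

text \<open>For a standard exponential variable X, \<open>exp (- s * j)\<close> is the probability
  of X > s j. Exchanging sum and expectation leaves the sum of \<open>c j\<close> over j < X / s,
  which is \<open>C\<close> at the ceiling of X / s. The Abelian theorem thereby becomes a matter of
  dominated convergence.\<close>

lemma laplace_sums:
  assumes s: "0 < s"
  shows "(\<lambda>j. exp (- s * real j) * c j) sums
    (\<integral>x. C (nat \<lceil>x / s\<rceil>) \<partial>density lborel (exponential_density 1))"
proof -
  let ?D = "density lborel (exponential_density 1)"
  interpret D: prob_space ?D by (rule prob_space_exponential_density) simp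
  define f where "f j x = c j * indicator {s * real j<..} x" for j x
  have meas: "measure ?D {a<..} = exp (- a)" if "0 \<le> a" for a
  proof -
    have "distributed ?D lborel (\<lambda>x. x) (exponential_density 1)"
      using distr_id2[of lborel ?D] by (auto simp: distributed_def)
    from D.exponential_distributedD_gt[OF this that] show ?thesis
      by (simp add: greaterThan_def)
  qed
  have int: "integrable ?D (f j)" for j
    unfolding f_def by (intro integrable_mult_right D.integrable_const_bound[of _ 1]) (auto simp: indicator_def)
  have val: "(\<integral>x. norm (f j x) \<partial>?D) = exp (- s * real j) * c j"
       "(\<integral>x. f j x \<partial>?D) = exp (- s * real j) * c j" for j
    using meas[of "s * real j"] s c_pos[of j] by (auto simp: f_def abs_mult)
  have fs: "f j x = (if j < nat \<lceil>x / s\<rceil> then c j else 0)" for j x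
  proof -
    have "s * real j < x \<longleftrightarrow> real j < x / s" using s by (simp add: field_simps)
    also have "\<dots> \<longleftrightarrow> j < nat \<lceil>x / s\<rceil>" by linarith
    finally show ?thesis by (simp add: f_def)
  qed
  have S: "(\<lambda>j. f j x) sums C (nat \<lceil>x / s\<rceil>)" for x
    unfolding fs C_def using sums_If_finite_set[of "{..<nat \<lceil>x / s\<rceil>}" c] by simp
  have "summable (\<lambda>j. exp (- s * real j) * c j)"
  proof (rule summable_comparison_test')
    show "summable (\<lambda>j. exp (- s) ^ j)" using s by (intro summable_geometric) simp
    show "norm (exp (- s * real j) * c j) \<le> exp (- s) ^ j" if "j \<ge> 0" for j
      using c_pos[of j] c_le_1[of j] by (simp add: abs_mult exp_of_nat_mult[symmetric] mult.commute mult_left_le_one_le)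
  qed
  then have "(\<lambda>j. \<integral>x. f j x \<partial>?D) sums (\<integral>x. (\<Sum>j. f j x) \<partial>?D)"
  proof (intro sums_integral int)
    show "AE x in ?D. summable (\<lambda>j. norm (f j x))"
    proof (rule AE_I2)
      fix x
      have "summable (\<lambda>j. f j x)" using S by (rule sums_summable)
      moreover have "norm (f j x) = f j x" for j using c_pos[of j] by (simp add: f_def)
      ultimately show "summable (\<lambda>j. norm (f j x))" by simp
    qed
  qed (simp only: val)
  moreover have "(\<lambda>x. \<Sum>j. f j x) = (\<lambda>x. C (nat \<lceil>x / s\<rceil>))"
    using S[THEN sums_unique] by (simp add: fun_eq_iff)
  ultimately show ?thesis by (simp only: val)
qed

text \<open>In the representation by an exponential variable the integrand converges to
  \<open>(x / s) powr (1 - \<beta>)\<close> and is dominated by \<open>x / s + 2\<close>; the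
  constant is the moment of order 1 - \<beta> of the exponential law.\<close>

lemma laplace_tendsto:
  assumes s: "0 < s"
  shows "(\<lambda>n. (\<Sum>j. exp (- s / real n * real j) * c j) / C n) \<longlonglongrightarrow> Gamma (2 - \<beta>) * s powr (\<beta> - 1)"
proof -
  let ?D = "density lborel (exponential_density 1)"
  interpret D: prob_space ?D by (rule prob_space_exponential_density) simp
  have pos: "AE x in ?D. 0 < x"
  proof -
    have "AE x in lborel. x \<noteq> (0::real)" by (rule AE_lborel_singleton)
    then show ?thesis by (subst AE_density) (auto simp: exponential_density_def elim: eventually_mono)
  qed
  have gam: "has_bochner_integral ?D (\<lambda>x. x powr (r - 1)) (Gamma r)" if "r > 0" for r
  proof (rule has_bochner_integral_nn_integral)
    have "(\<integral>\<^sup>+x. ennreal (x powr (r - 1)) \<partial>?D) = (\<integral>\<^sup>+x. ennreal (indicator {0..} x * x powr (r - 1) / exp x) \<partial>lborel)"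
      by (subst nn_integral_density)
         (auto intro!: nn_integral_cong simp: exponential_density_def ennreal_mult'[symmetric] indicator_def exp_minus field_simps)
    also have "\<dots> = ennreal (Gamma r)" using that by (simp add: Gamma_conv_nn_integral_real)
    finally show "(\<integral>\<^sup>+x. ennreal (x powr (r - 1)) \<partial>?D) = ennreal (Gamma r)" .
  qed (use that in \<open>auto intro: Gamma_real_pos less_imp_le\<close>)
  have "integrable ?D (\<lambda>x. x powr (2 - 1))" using gam[of 2] by (simp add: has_bochner_integral_iff)
  then have ix: "integrable ?D (\<lambda>x. x)"
    by (subst integrable_cong_AE[where g="\<lambda>x. x powr (2 - 1)"]) (use pos in \<open>auto elim: eventually_mono\<close>)
  define g where "g n x = C (nat \<lceil>x / (s / real n)\<rceil>) / C n" for n :: nat and x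
  have "(\<lambda>n. \<integral>x. g n x \<partial>?D) \<longlonglongrightarrow> (\<integral>x. (x / s) powr (1 - \<beta>) \<partial>?D)"
  proof (rule integral_dominated_convergence)
    have m: "(\<lambda>x. C (nat \<lceil>x / (s / real n)\<rceil>)) \<in> borel_measurable borel" for n
      by measurable
    show "g n \<in> borel_measurable ?D" for n using m[of n] by (simp add: g_def[abs_def])
    show "integrable ?D (\<lambda>x. \<bar>x\<bar> / s + 2)"
      using ix by (intro Bochner_Integration.integrable_add integrable_divide_zero integrable_abs) auto
    show "AE x in ?D. (\<lambda>n. g n x) \<longlonglongrightarrow> (x / s) powr (1 - \<beta>)"
      using pos
    proof eventually_elim
      case (elim x)
      have "(\<lambda>n. real (nat \<lceil>x / s * real n\<rceil>) / real n) \<longlonglongrightarrow> x / s"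
        using elim s by (intro ceiling_ratio_tendsto) auto
      from C_real_dilate[OF this] show ?case using elim s by (simp add: g_def field_simps)
    qed
    show "AE x in ?D. norm (g n x) \<le> \<bar>x\<bar> / s + 2" for n
      using pos
    proof eventually_elim
      case (elim x)
      show ?case
      proof (cases "n = 0")
        case True
        then show ?thesis using s elim by (simp add: g_def C_def)
      next
        case False
        have "x * real n / s \<ge> 0" using elim s by simp
        then have "real (nat \<lceil>x * real n / s\<rceil>) \<le> x * real n / s + 1" by linarith
        then have "real (nat \<lceil>x * real n / s\<rceil>) / real n \<le> (x * real n / s + 1) / real n"
          by (rule divide_right_mono) simp
        also have "\<dots> = x / s + 1 / real n" using False by (simp add: add_divide_distrib)
        also have "1 / real n \<le> 1" using False by simp
        finally have "real (nat \<lceil>x * real n / s\<rceil>) / real n \<le> x / s + 1" by simp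
        then have "(real (nat \<lceil>x * real n / s\<rceil>) / real n + 1) * C n \<le> (x / s + 2) * C n"
          using C_nonneg by (intro mult_right_mono) auto
        then have "C (nat \<lceil>x * real n / s\<rceil>) \<le> (x / s + 2) * C n"
          using False by (intro order_trans[OF C_real_le[of n]]) auto
        moreover have "C n > 0" using C_ge_1[of n] False by simp
        ultimately have "C (nat \<lceil>x * real n / s\<rceil>) / C n \<le> x / s + 2" by (simp only: pos_divide_le_eq)
        then show ?thesis using elim C_nonneg by (simp add: g_def)
      qed
    qed
  qed auto
  moreover have "(\<integral>x. (x / s) powr (1 - \<beta>) \<partial>?D) = Gamma (2 - \<beta>) * s powr (\<beta> - 1)"
  proof -
    have "(\<integral>x. (x / s) powr (1 - \<beta>) \<partial>?D) = (\<integral>x. x powr (1 - \<beta>) * s powr (\<beta> - 1) \<partial>?D)"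
    proof (rule integral_cong_AE)
      show "AE x in ?D. (x / s) powr (1 - \<beta>) = x powr (1 - \<beta>) * s powr (\<beta> - 1)"
        using pos
      proof eventually_elim
        case (elim x)
        have "s powr (\<beta> - 1) = inverse (s powr (1 - \<beta>))" using powr_minus[of s "1 - \<beta>"] by simp
        then show ?case using powr_divide[of x s "1 - \<beta>"] by (simp add: divide_inverse)
      qed
    qed auto
    also have "\<dots> = (\<integral>x. x powr ((2 - \<beta>) - 1) \<partial>?D) * s powr (\<beta> - 1)" by simp
    also have "(\<integral>x. x powr ((2 - \<beta>) - 1) \<partial>?D) = Gamma (2 - \<beta>)"
      using \<beta>_bounds by (intro has_bochner_integral_integral_eq gam) simp
    finally show ?thesis .
  qed
  ultimately have "(\<lambda>n. \<integral>x. g n x \<partial>?D) \<longlonglongrightarrow> Gamma (2 - \<beta>) * s powr (\<beta> - 1)" by simp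
  then show ?thesis
  proof (rule Lim_transform_eventually)
    show "\<forall>\<^sub>F n in sequentially. (\<integral>x. g n x \<partial>?D) = (\<Sum>j. exp (- s / real n * real j) * c j) / C n"
    proof (rule eventually_sequentiallyI[of 1])
      fix n :: nat assume "1 \<le> n"
      then have "s / real n > 0" using s by simp
      from sums_unique[OF laplace_sums[OF this]] show "(\<integral>x. g n x \<partial>?D) = (\<Sum>j. exp (- s / real n * real j) * c j) / C n"
        by (simp add: g_def)
    qed
  qed
qed

end

section \<open>Karamata's Tauberian theorem\<close>

lemma real_polynomial_approximation:
  fixes f :: "real \<Rightarrow> real"
  assumes "continuous_on {0..1} f" "0 < e"
  obtains a d where "\<And>x. x \<in> {0..1} \<Longrightarrow> \<bar>f x - (\<Sum>i\<le>d. a i * x ^ i)\<bar> < e"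
proof -
  obtain g where g: "real_polynomial_function g" "\<And>x. x \<in> {0..1} \<Longrightarrow> \<bar>f x - g x\<bar> < e"
    using Stone_Weierstrass_real_polynomial_function[OF _ assms] by auto
  then obtain a d where "g = (\<lambda>x. \<Sum>i\<le>d. a i * x ^ i)"
    by (auto simp: real_polynomial_function_iff_sum)
  then show thesis using that g(2) by blast
qed

text \<open>In the variable \<open>t = exp (- x)\<close> the function to be approximated is \<open>1 / t\<close> on \<open>[1/e, 1]\<close>;
  after multiplication by \<open>t\<close> it becomes the indicator of \<open>x \<le> 1\<close>, and the polynomials lose their
  constant terms.\<close>

lemma karamata_polynomials:
  fixes N :: "real measure"
  assumes fin: "finite_measure N" and sets: "sets N = sets borel"
    and nonneg: "AE x in N. 0 \<le> x" and null: "AE x in N. x \<noteq> 1" and e: "0 < e"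
  obtains a d1 b d2 where
    "\<And>x. 0 \<le> x \<Longrightarrow> \<bar>indicator {..1} x * exp x - (\<Sum>i\<le>d1. a i * exp (- x) ^ i)\<bar> \<le> (\<Sum>i\<le>d2. b i * exp (- x) ^ i)"
    "(\<integral>x. (\<Sum>i\<le>d2. b i * exp (- x) ^ i) \<partial>N) < e"
proof -
  interpret N: finite_measure N by fact
  have [measurable_cong]: "sets N = sets borel" by fact
  define t0 :: real where "t0 = exp (- 1)"
  have t0: "0 < t0" by (simp add: t0_def)
  \<comment> \<open>A continuous surrogate for the jump at \<open>t0 = exp (- 1)\<close>: a ramp of
    width \<open>1 / n\<close> to the right of \<open>t0\<close>, with \<open>max t t0\<close> as
    denominator to stay regular at 0. The tent \<open>g1\<close> dominates the error; it keeps the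
    height \<open>1 / t0\<close> at \<open>t0\<close>, so its integral tends to 0 because
    \<open>N\<close> does not charge \<open>x = 1\<close>.\<close>
  define h1 where "h1 n t = min 1 (max 0 ((t - t0) * real n)) / max t t0" for n :: nat and t
  define g1 where "g1 n t = max 0 (1 - \<bar>t - t0\<bar> * real n) / t0" for n :: nat and t
  have g1: "\<bar>(if t0 \<le> t then 1 / t else 0) - h1 n t\<bar> \<le> g1 n t" for n t
  proof (cases "t0 \<le> t")
    case True
    have "\<bar>1 / t - h1 n t\<bar> = max 0 (1 - \<bar>t - t0\<bar> * real n) / t"
      using True t0 by (auto simp: h1_def min_def max_def diff_divide_distrib[symmetric])
    also have "\<dots> \<le> g1 n t" unfolding g1_def using True t0 by (intro divide_left_mono) auto
    finally show ?thesis using True by simp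
  next
    case False
    then have "h1 n t = 0" by (simp add: h1_def mult_nonpos_nonneg)
    then show ?thesis using False t0 by (simp add: g1_def)
  qed
  have g1_bounds: "0 \<le> g1 n t" "g1 n t \<le> 1 / t0" for n t
    using t0 by (auto simp: g1_def intro!: divide_right_mono)
  have "(\<lambda>n. \<integral>x. g1 n (exp (- x)) \<partial>N) \<longlonglongrightarrow> (\<integral>x. 0 \<partial>N)"
  proof (rule integral_dominated_convergence)
    show "integrable N (\<lambda>x. 1 / t0)" by simp
    show "AE x in N. (\<lambda>n. g1 n (exp (- x))) \<longlonglongrightarrow> 0"
      using null
    proof eventually_elim
      case (elim x)
      then have "\<bar>exp (- x) - t0\<bar> > 0" by (simp add: t0_def)
      then have "filterlim (\<lambda>n. \<bar>exp (- x) - t0\<bar> * real n) at_top sequentially"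
        by (intro filterlim_tendsto_pos_mult_at_top[OF tendsto_const _ filterlim_real_sequentially])
      then have "\<forall>\<^sub>F n in sequentially. 1 \<le> \<bar>exp (- x) - t0\<bar> * real n"
        by (auto simp: filterlim_at_top)
      then have "\<forall>\<^sub>F n in sequentially. g1 n (exp (- x)) = 0"
        by eventually_elim (simp add: g1_def)
      then show ?case by (rule tendsto_eventually)
    qed
    show "AE x in N. norm (g1 n (exp (- x))) \<le> 1 / t0" for n
      using g1_bounds by auto
  qed (auto simp: g1_def)
  then have "\<forall>\<^sub>F n in sequentially. (\<integral>x. g1 n (exp (- x)) \<partial>N) < e / 2"
    using e by (intro order_tendstoD(2)) auto
  then obtain n where n: "(\<integral>x. g1 n (exp (- x)) \<partial>N) < e / 2" by (auto simp: eventually_sequentially)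
  define m where "m = measure N (space N)"
  define \<eta> where "\<eta> = e / (6 * (m + 1))"
  have m: "m \<ge> 0" by (simp add: m_def)
  have \<eta>: "\<eta> > 0" "3 * \<eta> * m \<le> e / 2"
    using e m by (auto simp: \<eta>_def field_simps)
  have "continuous_on {0..1} (h1 n)"
    unfolding h1_def using t0 by (intro continuous_intros) (auto simp: max_def)
  then obtain a d1 where a: "\<And>t. t \<in> {0..1} \<Longrightarrow> \<bar>h1 n t - (\<Sum>i\<le>d1. a i * t ^ i)\<bar> < \<eta>"
    using \<eta> by (blast intro: real_polynomial_approximation)
  \<comment> \<open>The lift by \<open>2 * \<eta>\<close> absorbs the error of the first polynomial
    and that of the second, so that the latter still dominates. It exceeds \<open>g1\<close> by at
    most \<open>3 * \<eta>\<close>, whence the factor 6 in \<eta>.\<close>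
  have "continuous_on {0..1} (\<lambda>t. g1 n t + 2 * \<eta>)"
    unfolding g1_def using t0 by (intro continuous_intros) auto
  then obtain b d2 where b: "\<And>t. t \<in> {0..1} \<Longrightarrow> \<bar>g1 n t + 2 * \<eta> - (\<Sum>i\<le>d2. b i * t ^ i)\<bar> < \<eta>"
    using \<eta> by (blast intro: real_polynomial_approximation)
  show thesis
  proof
    fix x :: real assume x: "0 \<le> x"
    then have t: "exp (- x) \<in> {0..1}" by simp
    have "indicator {..1} x * exp x = (if t0 \<le> exp (- x) then 1 / exp (- x) else 0)"
      by (simp add: t0_def exp_minus field_simps)
    then show "\<bar>indicator {..1} x * exp x - (\<Sum>i\<le>d1. a i * exp (- x) ^ i)\<bar> \<le> (\<Sum>i\<le>d2. b i * exp (- x) ^ i)"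
      using g1[of "exp (- x)" n] a[OF t] b[OF t] by linarith
  next
    have int: "integrable N (\<lambda>x. exp (- x) ^ i)" for i
      using nonneg by (intro N.integrable_const_bound[of _ 1]) (auto elim!: eventually_mono intro!: power_le_one)
    have int2: "integrable N (\<lambda>x. g1 n (exp (- x)))"
    proof (rule N.integrable_const_bound)
      show "AE x in N. norm (g1 n (exp (- x))) \<le> 1 / t0" using g1_bounds by auto
    qed (simp add: g1_def)
    have "(\<integral>x. (\<Sum>i\<le>d2. b i * exp (- x) ^ i) \<partial>N) \<le> (\<integral>x. g1 n (exp (- x)) + 3 * \<eta> \<partial>N)"
    proof (rule integral_mono_AE)
      show "AE x in N. (\<Sum>i\<le>d2. b i * exp (- x) ^ i) \<le> g1 n (exp (- x)) + 3 * \<eta>"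
        using nonneg
      proof eventually_elim
        case (elim x)
        then have t: "exp (- x) \<in> {0..1}" by simp
        show ?case using b[OF t] by linarith
      qed
    qed (use int int2 in auto)
    also have "\<dots> = (\<integral>x. g1 n (exp (- x)) \<partial>N) + 3 * \<eta> * m"
      using int2 by (simp add: m_def)
    also have "\<dots> < e" using n \<eta> by simp
    finally show "(\<integral>x. (\<Sum>i\<le>d2. b i * exp (- x) ^ i) \<partial>N) < e" .
  qed
qed

lemma summable_exp_bounded:
  fixes t :: "nat \<Rightarrow> 'a::banach"
  assumes "\<And>j. norm (t j) \<le> K" "u > 0"
  shows "summable (\<lambda>j. exp (- (u * real j)) *\<^sub>R t j)"
proof (rule summable_comparison_test')
  show "summable (\<lambda>j. exp (- u) ^ j * K)" using assms(2) by (intro summable_mult2 summable_geometric) simp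
  show "norm (exp (- (u * real j)) *\<^sub>R t j) \<le> exp (- u) ^ j * K" if "j \<ge> 0" for j
    using assms(1)[of j] by (simp add: exp_of_nat_mult[symmetric] mult.commute)
qed

lemma uniform_limit_sum:
  fixes f :: "'i \<Rightarrow> 'n \<Rightarrow> 'x \<Rightarrow> 'a::real_normed_vector"
  assumes "\<And>i. i \<in> I \<Longrightarrow> uniform_limit X (f i) (g i) F"
  shows "uniform_limit X (\<lambda>n x. \<Sum>i\<in>I. f i n x) (\<lambda>x. \<Sum>i\<in>I. g i x) F"
  using assms
  by (induction I rule: infinite_finite_induct) (auto intro!: uniform_limit_add uniform_limit_const)

lemma norm_triangle_three:
  fixes a b c d :: "'a::real_normed_vector"
  shows "norm (a - d) \<le> norm (a - b) + norm (b - c) + norm (c - d)"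
  using norm_triangle_ineq[of "a - b" "b - c"] norm_triangle_ineq[of "a - c" "c - d"] by simp

text \<open>The two polynomials depend on \<open>N\<close> and the tolerance alone, so only finitely
  many of the assumed limits are used and uniformity in \<theta> survives. The complex terms
  \<open>t\<close> have no sign to exploit; the error of replacing the cut-off by a polynomial is
  bounded termwise by \<open>K * (q j * s \<theta> j)\<close>, and the limits for the nonnegative
  \<open>s\<close> make the sum of these bounds small.\<close>

lemma uniform_karamata_tauberian:
  fixes t :: "'i \<Rightarrow> nat \<Rightarrow> complex" and s :: "'i \<Rightarrow> nat \<Rightarrow> real" and N :: "real measure"
  assumes fin: "finite_measure N" and sets: "sets N = sets borel"
    and nonneg: "AE x in N. 0 \<le> x" and null: "AE x in N. x \<noteq> 1"
    and K: "0 \<le> K" and \<gamma>: "0 \<le> \<gamma>" and B: "\<And>n. 0 \<le> B n"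
    and s: "\<And>\<theta> j. \<theta> \<in> \<Theta> \<Longrightarrow> 0 \<le> s \<theta> j \<and> s \<theta> j \<le> 1"
    and ts: "\<And>\<theta> j. \<theta> \<in> \<Theta> \<Longrightarrow> norm (t \<theta> j) \<le> K * s \<theta> j"
    and lim_t: "\<And>k. uniform_limit \<Theta> (\<lambda>n \<theta>. B n *\<^sub>R (\<Sum>j. exp (- (real (Suc k) / real n * real j)) *\<^sub>R t \<theta> j))
        (\<lambda>\<theta>. (\<integral>x. exp (- x) ^ k \<partial>N) *\<^sub>R z) sequentially"
    and lim_s: "\<And>k. uniform_limit \<Theta> (\<lambda>n \<theta>. B n *\<^sub>R (\<Sum>j. exp (- (real (Suc k) / real n * real j)) *\<^sub>R s \<theta> j))
        (\<lambda>\<theta>. (\<integral>x. exp (- x) ^ k \<partial>N) *\<^sub>R \<gamma>) sequentially"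
  shows "uniform_limit \<Theta> (\<lambda>n \<theta>. B n *\<^sub>R (\<Sum>j\<le>n. t \<theta> j))
           (\<lambda>\<theta>. (\<integral>x. indicator {..1} x * exp x \<partial>N) *\<^sub>R z) sequentially"
proof (rule uniform_limitI)
  fix e :: real assume e: "0 < e"
  interpret N: finite_measure N by fact
  have [measurable_cong]: "sets N = sets borel" by fact
  \<comment> \<open>Collects the errors in units of \<delta>: \<open>K * (\<gamma> + 1)\<close> from
    the majorant \<open>W\<close>, 1 from the convergence of \<open>U\<close>, and
    \<open>norm z\<close> from replacing \<open>H\<close> by the moments of the polynomial.\<close>
  define Q where "Q = K * (\<gamma> + 1) + 1 + norm z"
  define \<delta> where "\<delta> = e / (Q + 1)"
  have Q: "Q \<ge> 0" using K \<gamma> by (simp add: Q_def)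
  have "\<delta> > 0" "\<delta> * (Q + 1) = e" using e Q by (auto simp: \<delta>_def)
  then have \<delta>: "\<delta> > 0" "\<delta> * Q < e" by (simp_all add: distrib_left)
  obtain a d1 b d2 where
    ab: "\<And>x. 0 \<le> x \<Longrightarrow> \<bar>indicator {..1} x * exp x - (\<Sum>i\<le>d1. a i * exp (- x) ^ i)\<bar> \<le> (\<Sum>i\<le>d2. b i * exp (- x) ^ i)"
    and b: "(\<integral>x. (\<Sum>i\<le>d2. b i * exp (- x) ^ i) \<partial>N) < \<delta>"
    by (rule karamata_polynomials[OF fin sets nonneg null \<delta>(1)]) (rule that)
  have int: "integrable N (\<lambda>x. exp (- x) ^ i)" for i
    using nonneg by (intro N.integrable_const_bound[of _ 1]) (auto elim!: eventually_mono intro!: power_le_one)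
  define I where "I i = (\<integral>x. exp (- x) ^ i \<partial>N)" for i
  define H where "H = (\<integral>x. indicator {..1} x * exp x \<partial>N)"
  have b': "(\<Sum>i\<le>d2. b i * I i) < \<delta>" using b int by (simp add: I_def)
  have aH: "\<bar>H - (\<Sum>i\<le>d1. a i * I i)\<bar> \<le> \<delta>"
  proof -
    have ih: "integrable N (\<lambda>x. indicator {..1} x * exp x)"
      by (intro N.integrable_const_bound[of _ "exp 1"]) (auto simp: indicator_def)
    have "H - (\<Sum>i\<le>d1. a i * I i) = (\<integral>x. indicator {..1} x * exp x - (\<Sum>i\<le>d1. a i * exp (- x) ^ i) \<partial>N)"
      using int ih by (simp add: H_def I_def)
    also have "\<bar>\<dots>\<bar> \<le> (\<integral>x. \<bar>indicator {..1} x * exp x - (\<Sum>i\<le>d1. a i * exp (- x) ^ i)\<bar> \<partial>N)"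
      by (rule integral_abs_bound)
    also have "\<dots> \<le> (\<integral>x. (\<Sum>i\<le>d2. b i * exp (- x) ^ i) \<partial>N)"
      using ab nonneg int ih by (intro integral_mono_AE) (auto elim!: eventually_mono)
    finally show ?thesis using b by simp
  qed
  \<comment> \<open>\<open>U\<close> and \<open>W\<close> are \<open>B n\<close> times the series of
    \<open>t\<close> and \<open>s\<close> weighted by \<open>p\<close> and \<open>q\<close> below:
    fixed finite combinations of the assumed limits.\<close>
  define U where "U n \<theta> = (\<Sum>i\<le>d1. a i *\<^sub>R B n *\<^sub>R (\<Sum>j. exp (- (real (Suc i) / real n * real j)) *\<^sub>R t \<theta> j))" for n \<theta>
  define W where "W n \<theta> = (\<Sum>i\<le>d2. b i *\<^sub>R B n *\<^sub>R (\<Sum>j. exp (- (real (Suc i) / real n * real j)) *\<^sub>R s \<theta> j))" for n \<theta>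
  have "uniform_limit \<Theta> U (\<lambda>\<theta>. \<Sum>i\<le>d1. a i *\<^sub>R I i *\<^sub>R z) sequentially"
    unfolding U_def[abs_def] I_def
    by (intro uniform_limit_sum lim_t bounded_linear.uniform_limit[OF bounded_linear_scaleR_right])
  then have "\<forall>\<^sub>F n in sequentially. \<forall>\<theta>\<in>\<Theta>. dist (U n \<theta>) (\<Sum>i\<le>d1. a i *\<^sub>R I i *\<^sub>R z) < \<delta>"
    using \<delta> by (auto dest: uniform_limitD)
  moreover have "uniform_limit \<Theta> W (\<lambda>\<theta>. \<Sum>i\<le>d2. b i *\<^sub>R I i *\<^sub>R \<gamma>) sequentially"
    unfolding W_def[abs_def] I_def
    by (intro uniform_limit_sum lim_s bounded_linear.uniform_limit[OF bounded_linear_scaleR_right])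
  then have "\<forall>\<^sub>F n in sequentially. \<forall>\<theta>\<in>\<Theta>. dist (W n \<theta>) (\<Sum>i\<le>d2. b i *\<^sub>R I i *\<^sub>R \<gamma>) < \<delta>"
    using \<delta> by (auto dest: uniform_limitD)
  ultimately show "\<forall>\<^sub>F n in sequentially. \<forall>\<theta>\<in>\<Theta>. dist (B n *\<^sub>R (\<Sum>j\<le>n. t \<theta> j)) (H *\<^sub>R z) < e" unfolding H_def[symmetric]
    using eventually_ge_at_top[of 1]
  proof eventually_elim
    case (elim n)
    show ?case
    proof
      fix \<theta> assume \<theta>: "\<theta> \<in> \<Theta>"
      have n: "n > 0" using elim by simp
      have tK: "norm (t \<theta> j) \<le> K" for j
        using ts[OF \<theta>, of j] s[OF \<theta>, of j] K by (meson mult_left_le order_trans)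
      have st: "summable (\<lambda>j. exp (- (real (Suc i) / real n * real j)) *\<^sub>R t \<theta> j)" for i
        by (rule summable_exp_bounded[OF tK]) (use n in simp)
      have ss: "summable (\<lambda>j. exp (- (real (Suc i) / real n * real j)) *\<^sub>R s \<theta> j)" for i
        by (rule summable_exp_bounded[of _ 1]) (use n s[OF \<theta>] in auto)
      define p where "p j = (\<Sum>i\<le>d1. a i * exp (- (real (Suc i) / real n * real j)))" for j
      define q where "q j = (\<Sum>i\<le>d2. b i * exp (- (real (Suc i) / real n * real j)))" for j
      \<comment> \<open>The factor \<open>exp (- x)\<close> at \<open>x = j / n\<close> turns
        \<open>indicator {..1} x * exp x\<close> into the cut-off \<open>j \<le> n\<close>, and
        raises each power \<open>i\<close> of \<open>exp (- x)\<close> to \<open>Suc i\<close>;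
        hence the points \<open>Suc k / n\<close> in the assumed limits.\<close>
      have pq: "\<bar>(if j \<le> n then 1 else 0) - p j\<bar> \<le> q j" for j
      proof -
        let ?x = "real j / real n"
        have e1: "exp (- (real (Suc i) / real n * real j)) = exp (- ?x) * exp (- ?x) ^ i" for i
        proof -
          have "real (Suc i) / real n * real j = real (Suc i) * ?x" by simp
          then have "exp (- (real (Suc i) / real n * real j)) = exp (real (Suc i) * (- ?x))" by simp
          also have "\<dots> = exp (- ?x) ^ Suc i" by (rule exp_of_nat_mult)
          finally show ?thesis by simp
        qed
        have "(if j \<le> n then 1 else 0) = exp (- ?x) * (indicator {..1} ?x * exp ?x)"
          using n by (simp add: indicator_def exp_minus)
        moreover have "p j = exp (- ?x) * (\<Sum>i\<le>d1. a i * exp (- ?x) ^ i)"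
          by (simp only: p_def e1) (simp add: sum_distrib_left mult_ac)
        ultimately have "\<bar>(if j \<le> n then 1 else 0) - p j\<bar> = exp (- ?x) * \<bar>indicator {..1} ?x * exp ?x - (\<Sum>i\<le>d1. a i * exp (- ?x) ^ i)\<bar>"
          by (simp only: right_diff_distrib[symmetric] abs_mult abs_exp_cancel)
        also have "\<dots> \<le> exp (- ?x) * (\<Sum>i\<le>d2. b i * exp (- ?x) ^ i)"
          by (intro mult_left_mono ab) auto
        also have "\<dots> = q j"
          by (simp only: q_def e1) (simp add: sum_distrib_left mult_ac)
        finally show ?thesis .
      qed
      have pS: "(\<lambda>j. p j *\<^sub>R t \<theta> j) sums (\<Sum>i\<le>d1. a i *\<^sub>R (\<Sum>j. exp (- (real (Suc i) / real n * real j)) *\<^sub>R t \<theta> j))"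
        using sums_sum[of "{..d1}" "\<lambda>i j. a i *\<^sub>R exp (- (real (Suc i) / real n * real j)) *\<^sub>R t \<theta> j"] sums_scaleR_right[OF summable_sums[OF st]]
        by (simp add: p_def scaleR_sum_left)
      have qS: "(\<lambda>j. q j * s \<theta> j) sums (\<Sum>i\<le>d2. b i *\<^sub>R (\<Sum>j. exp (- (real (Suc i) / real n * real j)) *\<^sub>R s \<theta> j))"
        using sums_sum[of "{..d2}" "\<lambda>i j. b i *\<^sub>R exp (- (real (Suc i) / real n * real j)) *\<^sub>R s \<theta> j"] sums_scaleR_right[OF summable_sums[OF ss]]
        by (simp add: q_def sum_distrib_right mult.assoc)
      have iS: "(\<lambda>j. (if j \<le> n then t \<theta> j else 0)) sums (\<Sum>j\<le>n. t \<theta> j)"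
        using sums_If_finite_set[of "{..n}" "t \<theta>"] by simp
      have dS: "(\<lambda>j. (if j \<le> n then t \<theta> j else 0) - p j *\<^sub>R t \<theta> j) sums
         ((\<Sum>j\<le>n. t \<theta> j) - (\<Sum>i\<le>d1. a i *\<^sub>R (\<Sum>j. exp (- (real (Suc i) / real n * real j)) *\<^sub>R t \<theta> j)))"
        by (rule sums_diff[OF iS pS])
      have le: "norm ((if j \<le> n then t \<theta> j else 0) - p j *\<^sub>R t \<theta> j) \<le> K * (q j * s \<theta> j)" for j
      proof -
        have "(if j \<le> n then t \<theta> j else 0) - p j *\<^sub>R t \<theta> j = ((if j \<le> n then 1 else 0) - p j) *\<^sub>R t \<theta> j"
          by (simp add: scaleR_diff_left)
        then have "norm ((if j \<le> n then t \<theta> j else 0) - p j *\<^sub>R t \<theta> j) = \<bar>(if j \<le> n then 1 else 0) - p j\<bar> * norm (t \<theta> j)"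
          by simp
        also have "\<dots> \<le> q j * (K * s \<theta> j)"
          using pq[of j] ts[OF \<theta>, of j] by (intro mult_mono) auto
        finally show ?thesis by (simp add: mult_ac)
      qed
      have "norm ((\<Sum>j\<le>n. t \<theta> j) - (\<Sum>i\<le>d1. a i *\<^sub>R (\<Sum>j. exp (- (real (Suc i) / real n * real j)) *\<^sub>R t \<theta> j)))
         \<le> K * (\<Sum>i\<le>d2. b i *\<^sub>R (\<Sum>j. exp (- (real (Suc i) / real n * real j)) *\<^sub>R s \<theta> j))"
        unfolding sums_unique[OF dS] sums_unique[OF sums_mult[OF qS, of K]]
        by (rule norm_suminf_le[OF le sums_summable[OF sums_mult[OF qS]]])
      then have "B n * norm ((\<Sum>j\<le>n. t \<theta> j) - (\<Sum>i\<le>d1. a i *\<^sub>R (\<Sum>j. exp (- (real (Suc i) / real n * real j)) *\<^sub>R t \<theta> j)))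
         \<le> B n * (K * (\<Sum>i\<le>d2. b i *\<^sub>R (\<Sum>j. exp (- (real (Suc i) / real n * real j)) *\<^sub>R s \<theta> j)))"
        by (intro mult_left_mono B)
      also have "\<dots> = K * W n \<theta>" by (simp add: W_def sum_distrib_left mult_ac)
      also have "B n * norm ((\<Sum>j\<le>n. t \<theta> j) - (\<Sum>i\<le>d1. a i *\<^sub>R (\<Sum>j. exp (- (real (Suc i) / real n * real j)) *\<^sub>R t \<theta> j)))
         = norm (B n *\<^sub>R (\<Sum>j\<le>n. t \<theta> j) - U n \<theta>)"
      proof -
        have "U n \<theta> = B n *\<^sub>R (\<Sum>i\<le>d1. a i *\<^sub>R (\<Sum>j. exp (- (real (Suc i) / real n * real j)) *\<^sub>R t \<theta> j))"
          by (simp add: U_def scaleR_sum_right mult_ac)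
        then show ?thesis using B[of n] by (simp flip: scaleR_diff_right)
      qed
      finally have 1: "norm (B n *\<^sub>R (\<Sum>j\<le>n. t \<theta> j) - U n \<theta>) \<le> K * W n \<theta>" .
      have "W n \<theta> < (\<Sum>i\<le>d2. b i *\<^sub>R I i *\<^sub>R \<gamma>) + \<delta>"
        using elim(2) \<theta> by (force simp: dist_real_def)
      also have "(\<Sum>i\<le>d2. b i *\<^sub>R I i *\<^sub>R \<gamma>) = (\<Sum>i\<le>d2. b i * I i) * \<gamma>"
        by (simp add: sum_distrib_right mult.assoc)
      also have "\<dots> \<le> \<delta> * \<gamma>" using b' \<gamma> by (intro mult_right_mono) auto
      finally have "K * W n \<theta> \<le> K * (\<delta> * \<gamma> + \<delta>)" using K by (intro mult_left_mono) auto
      moreover have "norm (U n \<theta> - (\<Sum>i\<le>d1. a i * I i) *\<^sub>R z) < \<delta>"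
        using elim(1) \<theta> by (simp add: dist_norm scaleR_sum_left)
      moreover have "norm ((\<Sum>i\<le>d1. a i * I i) *\<^sub>R z - H *\<^sub>R z) \<le> \<delta> * norm z"
        using aH by (simp flip: scaleR_diff_left) (metis abs_minus_commute mult_right_mono norm_ge_zero)
      moreover have "norm (B n *\<^sub>R (\<Sum>j\<le>n. t \<theta> j) - H *\<^sub>R z) \<le>
          norm (B n *\<^sub>R (\<Sum>j\<le>n. t \<theta> j) - U n \<theta>) + norm (U n \<theta> - (\<Sum>i\<le>d1. a i * I i) *\<^sub>R z) + norm ((\<Sum>i\<le>d1. a i * I i) *\<^sub>R z - H *\<^sub>R z)"
        by (rule norm_triangle_three)
      ultimately have "norm (B n *\<^sub>R (\<Sum>j\<le>n. t \<theta> j) - H *\<^sub>R z) < K * (\<delta> * \<gamma> + \<delta>) + \<delta> + \<delta> * norm z"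
        using 1 by linarith
      also have "\<dots> = \<delta> * Q" by (simp add: Q_def algebra_simps)
      finally show "dist (B n *\<^sub>R (\<Sum>j\<le>n. t \<theta> j)) (H *\<^sub>R z) < e" using \<delta> by (simp add: dist_norm)
    qed
  qed
qed

section \<open>Moments of the gamma weights\<close>

lemma nn_integral_powr_exp:
  fixes b s :: real
  assumes "0 < b" "0 < s"
  shows "(\<integral>\<^sup>+x. ennreal (indicator {0..} x * x powr (b - 1) * exp (- (s * x))) \<partial>lborel) = ennreal (Gamma b * s powr (- b))"
proof -
  have "ennreal (Gamma b) = (\<integral>\<^sup>+t. ennreal (indicator {0..} t * t powr (b - 1) / exp t) \<partial>lborel)"
    by (rule Gamma_conv_nn_integral_real[OF assms(1)])
  also have "\<dots> = ennreal \<bar>s\<bar> * (\<integral>\<^sup>+x. ennreal (indicator {0..} (0 + s * x) * (0 + s * x) powr (b - 1) / exp (0 + s * x)) \<partial>lborel)"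
    using assms by (intro nn_integral_real_affine) auto
  also have "\<dots> = ennreal s * (\<integral>\<^sup>+x. ennreal (s powr (b - 1)) * ennreal (indicator {0..} x * x powr (b - 1) * exp (- (s * x))) \<partial>lborel)"
    using assms
    by (intro arg_cong2[where f = "(*)"] nn_integral_cong)
       (auto simp: indicator_def powr_mult exp_minus field_simps zero_le_mult_iff ennreal_mult'[symmetric])
  also have "\<dots> = ennreal (s powr b) * (\<integral>\<^sup>+x. ennreal (indicator {0..} x * x powr (b - 1) * exp (- (s * x))) \<partial>lborel)"
  proof (subst nn_integral_cmult)
    have "s * s powr (b - 1) = s powr b" using assms by (simp add: powr_mult_base)
    then show "ennreal s * (ennreal (s powr (b - 1)) * (\<integral>\<^sup>+x. ennreal (indicator {0..} x * x powr (b - 1) * exp (- (s * x))) \<partial>lborel)) =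
      ennreal (s powr b) * (\<integral>\<^sup>+x. ennreal (indicator {0..} x * x powr (b - 1) * exp (- (s * x))) \<partial>lborel)"
      using assms by (simp add: mult.assoc[symmetric] ennreal_mult[symmetric])
  qed simp
  finally have "ennreal (s powr (- b)) * ennreal (Gamma b) =
      ennreal (s powr (- b)) * (ennreal (s powr b) * (\<integral>\<^sup>+x. ennreal (indicator {0..} x * x powr (b - 1) * exp (- (s * x))) \<partial>lborel))"
    by simp
  also have "\<dots> = (\<integral>\<^sup>+x. ennreal (indicator {0..} x * x powr (b - 1) * exp (- (s * x))) \<partial>lborel)"
    using assms by (simp add: mult.assoc[symmetric] ennreal_mult[symmetric] powr_add[symmetric])
  finally show ?thesis using assms by (simp add: ennreal_mult[symmetric] mult.commute)
qed

text \<open>The measure \<open>x\<^sup>\<beta>\<^sup>-\<^sup>1 e\<^sup>-\<^sup>x dx / \<Gamma>(\<beta>)\<close>, degenerating to the point mass at \<open>0\<close> for \<open>\<beta> = 0\<close>.\<close>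

lemma gamma_weight:
  fixes b :: real
  assumes "0 \<le> b"
  obtains N :: "real measure" where "finite_measure N" "sets N = sets borel"
    "AE x in N. 0 \<le> x" "AE x in N. x \<noteq> 1"
    "\<And>k. (\<integral>x. exp (- x) ^ k \<partial>N) = real (Suc k) powr (- b)"
    "(\<integral>x. indicator {..1} x * exp x \<partial>N) = 1 / Gamma (1 + b)"
proof (cases "b = 0")
  case True
  \<comment> \<open>All the required moments are 1 for exponent 0, as is \<open>1 / Gamma 1\<close>;
    this characterises the unit mass at 0.\<close>
  define N where "N = return (borel :: real measure) 0"
  have "prob_space N" by (auto simp: N_def intro: prob_space_return)
  then have "finite_measure N" by (simp add: prob_space_def)
  moreover have "AE x in N. P x" if "P 0" "{x. P x} \<in> sets borel" for P
    unfolding N_def by (subst AE_return) (use that in \<open>auto simp: pred_def\<close>)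
  moreover have "(\<integral>x. g x \<partial>N) = g 0" if "g \<in> borel_measurable borel" for g :: "real \<Rightarrow> real"
    unfolding N_def by (rule integral_return) (use that in auto)
  ultimately show thesis using True by (intro that[of N]) (auto simp: N_def)
next
  case False
  then have b: "b > 0" using assms by simp
  have G: "Gamma b > 0" using b by (rule Gamma_real_pos)
  define g where "g x = indicator {0..} x * x powr (b - 1) * exp (- x) / Gamma b" for x :: real
  define N where "N = density lborel (\<lambda>x. ennreal (g x))"
  have g[measurable]: "g \<in> borel_measurable borel" unfolding g_def[abs_def] by measurable
  have g0: "0 \<le> g x" for x using G by (simp add: g_def)
  have pow: "has_bochner_integral N (\<lambda>x. exp (- x) ^ k) (real (Suc k) powr (- b))" for k
  proof (rule has_bochner_integral_nn_integral)
    have "(\<integral>\<^sup>+x. ennreal (exp (- x) ^ k) \<partial>N) = (\<integral>\<^sup>+x. ennreal (1 / Gamma b) * ennreal (indicator {0..} x * x powr (b - 1) * exp (- (real (Suc k) * x))) \<partial>lborel)"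
      unfolding N_def
    proof (subst nn_integral_density)
      show "(\<integral>\<^sup>+x. ennreal (g x) * ennreal (exp (- x) ^ k) \<partial>lborel) = (\<integral>\<^sup>+x. ennreal (1 / Gamma b) * ennreal (indicator {0..} x * x powr (b - 1) * exp (- (real (Suc k) * x))) \<partial>lborel)"
      proof (rule nn_integral_cong)
        fix x :: real
        have "exp (- x) * exp (- x) ^ k = exp (- (real (Suc k) * x))"
          using exp_of_nat_mult[of "Suc k" "- x"] by (simp only: power_Suc mult_minus_right)
        then have "g x * exp (- x) ^ k = (1 / Gamma b) * (indicator {0..} x * x powr (b - 1) * exp (- (real (Suc k) * x)))"
          by (simp add: g_def mult.assoc del: of_nat_Suc)
        then show "ennreal (g x) * ennreal (exp (- x) ^ k) = ennreal (1 / Gamma b) * ennreal (indicator {0..} x * x powr (b - 1) * exp (- (real (Suc k) * x)))"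
          using G g0[of x] by (simp add: ennreal_mult[symmetric] del: of_nat_Suc)
      qed
    qed auto
    also have "\<dots> = ennreal (1 / Gamma b) * ennreal (Gamma b * real (Suc k) powr (- b))"
      using b by (subst nn_integral_cmult) (simp_all add: nn_integral_powr_exp del: of_nat_Suc)
    also have "\<dots> = ennreal (real (Suc k) powr (- b))"
      using G by (simp add: ennreal_mult[symmetric] del: of_nat_Suc)
    finally show "(\<integral>\<^sup>+x. ennreal (exp (- x) ^ k) \<partial>N) = ennreal (real (Suc k) powr (- b))" .
  qed (auto simp: N_def)
  have "has_bochner_integral N (\<lambda>x. indicator {..1} x * exp x) (1 / Gamma (1 + b))"
  proof (rule has_bochner_integral_nn_integral)
    have "(\<integral>\<^sup>+x. ennreal (indicator {..1} x * exp x) \<partial>N) = (\<integral>\<^sup>+x. ennreal (1 / Gamma b) * ennreal (indicator {0..1} x * x powr (b - 1)) \<partial>lborel)"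
      unfolding N_def
    proof (subst nn_integral_density)
      show "(\<integral>\<^sup>+x. ennreal (g x) * ennreal (indicator {..1} x * exp x) \<partial>lborel) = (\<integral>\<^sup>+x. ennreal (1 / Gamma b) * ennreal (indicator {0..1} x * x powr (b - 1)) \<partial>lborel)"
      proof (rule nn_integral_cong)
        fix x :: real
        \<comment> \<open>The factor \<open>exp x\<close> cancels the exponential in the density;
          what remains is the integral of \<open>x powr (b - 1)\<close> over [0,1], equal to
          \<open>1 / b\<close>, and \<open>b * Gamma b = Gamma (1 + b)\<close>.\<close>
        have "g x * (indicator {..1} x * exp x) = (1 / Gamma b) * (indicator {0..1} x * x powr (b - 1))"
          by (auto simp: g_def indicator_def exp_minus)
        then show "ennreal (g x) * ennreal (indicator {..1} x * exp x) = ennreal (1 / Gamma b) * ennreal (indicator {0..1} x * x powr (b - 1))"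
          using G g0[of x] by (simp add: ennreal_mult[symmetric])
      qed
    qed auto
    also have "\<dots> = ennreal (1 / Gamma b) * ennreal (1 / b)"
    proof -
      have "((\<lambda>x. x powr (b - 1)) has_integral (1 powr (b - 1 + 1) / (b - 1 + 1))) {0..1}"
        using b by (intro has_integral_powr_from_0) auto
      then have "(\<integral>\<^sup>+x. ennreal (indicator {0..1} x * x powr (b - 1)) \<partial>lborel) = ennreal (1 / b)"
        by (subst nn_integral_has_integral_lebesgue) auto
      then show ?thesis by (subst nn_integral_cmult) simp_all
    qed
    also have "\<dots> = ennreal (1 / Gamma (1 + b))"
      using G b Gamma_plus1[of b] by (simp add: ennreal_mult[symmetric] add.commute nonpos_Ints_def)
    finally show "(\<integral>\<^sup>+x. ennreal (indicator {..1} x * exp x) \<partial>N) = ennreal (1 / Gamma (1 + b))" .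
  qed (use b in \<open>auto simp: N_def intro!: less_imp_le Gamma_real_pos\<close>)
  moreover have "finite_measure N"
  proof
    have "(\<integral>\<^sup>+x. ennreal 1 \<partial>N) = ennreal (\<integral>x. 1 \<partial>N)"
      using pow[of 0] by (intro nn_integral_eq_integral) (auto simp: has_bochner_integral_iff)
    then have "emeasure N (space N) = ennreal (\<integral>x. 1 \<partial>N)" by simp
    then show "emeasure N (space N) \<noteq> \<infinity>" by simp
  qed
  moreover have "AE x in N. 0 \<le> x"
    unfolding N_def by (subst AE_density) (auto simp: g_def indicator_def)
  moreover have "AE x in N. x \<noteq> 1"
    unfolding N_def using AE_lborel_singleton[of "1::real"] by (subst AE_density) auto
  ultimately show thesis using pow
    by (intro that[of N]) (auto simp: N_def intro: has_bochner_integral_integral_eq)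
qed

section \<open>Asymptotics of the normalising sequences\<close>

context regularly_varying_tail
begin

text \<open>Cesaro means of a null sequence. This removes the term j = 0 that the Tauberian theorem
  includes in its partial sums.\<close>

lemma C_over_n_tendsto_0:
  assumes "c \<longlonglongrightarrow> 0"
  shows "(\<lambda>n. C n / real n) \<longlonglongrightarrow> 0"
  using sum_ratio_tendsto[of "\<lambda>_. 1" c 0] assms filterlim_real_sequentially by (simp add: C_def)

text \<open>For \<beta> < 1 the numerator is \<open>D_const \<beta> * c n\<close>, so this is
  monotone density together with (1-\<beta>) \<Gamma>(1-\<beta>) = \<Gamma>(2-\<beta>). For \<beta>
  = 1 the sum defining \<open>m_seq\<close> runs over 1..n and equals \<open>C n + c n - 1\<close>
  because \<open>c 0 = 1\<close>; the bounded correction is lost against \<open>C n\<close>, and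
  both gamma factors are 1.\<close>

lemma normalisation_tendsto:
  assumes l: "\<And>n. n \<ge> 1 \<Longrightarrow> c n = l (real n) * real n powr (- \<beta>)"
  shows "(\<lambda>n. D_const \<beta> * m_seq \<beta> l n * real n powr (- \<beta>) / (C n / real n)) \<longlonglongrightarrow> Gamma (2 - \<beta>) * Gamma (1 + \<beta>)"
proof (cases "\<beta> = 1")
  case True
  have c1: "(\<lambda>n. (c n - 1) / C n) \<longlonglongrightarrow> 0"
  proof (rule Lim_null_comparison)
    show "\<forall>\<^sub>F n in sequentially. norm ((c n - 1) / C n) \<le> 1 / C n"
    proof (intro always_eventually allI)
      fix n
      have "\<bar>c n - 1\<bar> \<le> 1" using c_le_1[of n] c_pos[of n] by simp
      then show "norm ((c n - 1) / C n) \<le> 1 / C n"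
        using divide_right_mono[of "\<bar>c n - 1\<bar>" 1 "C n"] C_nonneg[of n] by (simp add: abs_divide)
    qed
    show "(\<lambda>n. 1 / C n) \<longlonglongrightarrow> 0" by (rule real_tendsto_divide_at_top[OF tendsto_const C_at_top])
  qed
  have "(\<lambda>n. 1 + (c n - 1) / C n) \<longlonglongrightarrow> Gamma (2 - \<beta>) * Gamma (1 + \<beta>)"
    using tendsto_add[OF tendsto_const c1, of 1] Gamma_fact[of 0, where 'a = real] Gamma_fact[of 1, where 'a = real]
    by (simp add: True)
  then show ?thesis
  proof (rule Lim_transform_eventually)
    show "\<forall>\<^sub>F n in sequentially. 1 + (c n - 1) / C n = D_const \<beta> * m_seq \<beta> l n * real n powr (- \<beta>) / (C n / real n)"
    proof (rule eventually_sequentiallyI[of 1])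
      fix n :: nat assume n: "1 \<le> n"
      have Cn: "C n > 0" using C_ge_1[OF n] by simp
      have "m_seq \<beta> l n = (\<Sum>j=1..n. c j)"
        unfolding m_seq_def using True by (auto simp: l powr_minus_divide intro!: sum.cong)
      also have "\<dots> = C n + c n - 1"
      proof -
        have "(\<Sum>j\<in>{..<Suc n}. c j) = c 0 + (\<Sum>j=1..n. c j)"
          by (simp add: lessThan_Suc_atMost atMost_atLeast0 sum.atLeast_Suc_atMost)
        then show ?thesis by (simp add: C_def c_0)
      qed
      finally have m: "m_seq \<beta> l n = C n + c n - 1" .
      have "D_const \<beta> * m_seq \<beta> l n * real n powr (- \<beta>) / (C n / real n) = (C n + c n - 1) / C n"
        using n by (simp add: m[unfolded True] D_const_def True powr_minus_divide)
      also have "\<dots> = 1 + (c n - 1) / C n" using Cn by (simp add: field_simps)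
      finally show "1 + (c n - 1) / C n = D_const \<beta> * m_seq \<beta> l n * real n powr (- \<beta>) / (C n / real n)" ..
    qed
  qed
next
  case False
  then have b: "\<beta> < 1" using \<beta>_bounds by simp
  have "D_const \<beta> * (1 - \<beta>) = Gamma (2 - \<beta>) * Gamma (1 + \<beta>)"
  proof (cases "\<beta> = 0")
    case True
    then show ?thesis using Gamma_fact[of 0, where 'a = real] Gamma_fact[of 1, where 'a = real] by (simp add: D_const_def)
  next
    case False
    have "Gamma (1 - \<beta> + 1) = (1 - \<beta>) * Gamma (1 - \<beta>)"
      using b by (intro Gamma_plus1) (auto elim!: nonpos_Ints_cases)
    then show ?thesis using False b \<beta>_bounds by (simp add: D_const_def)
  qed
  then have "(\<lambda>n. D_const \<beta> * (real n * c n / C n)) \<longlonglongrightarrow> Gamma (2 - \<beta>) * Gamma (1 + \<beta>)"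
    using tendsto_mult[OF tendsto_const monotone_density, of "D_const \<beta>"] by simp
  then show ?thesis
  proof (rule Lim_transform_eventually)
    show "\<forall>\<^sub>F n in sequentially. D_const \<beta> * (real n * c n / C n) = D_const \<beta> * m_seq \<beta> l n * real n powr (- \<beta>) / (C n / real n)"
      by (rule eventually_sequentiallyI[of 1]) (use False in \<open>simp add: m_seq_def l\<close>)
  qed
qed

text \<open>The factor \<open>1 - exp (- (s / n))\<close> behaves like \<open>s / n\<close> and
  raises the exponent of \<open>s\<close> from \<beta> - 1 to \<beta>. By
  \<open>transform_p_sums\<close> the numerator is a(s/n), so a(s/n) is compared here with
  C(n)/n.\<close>

lemma transform_tendsto:
  assumes s: "0 < s"
  shows "(\<lambda>n. (1 - exp (- (s / real n))) * (\<Sum>j. exp (- s / real n * real j) * c j) / (C n / real n)) \<longlonglongrightarrow> Gamma (2 - \<beta>) * s powr \<beta>"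
proof -
  have "(\<lambda>n. real n * (1 - exp (- (s / real n)))) \<longlonglongrightarrow> s"
    by real_asymp
  from tendsto_mult[OF this laplace_tendsto[OF s]]
  have "(\<lambda>n. real n * (1 - exp (- (s / real n))) * ((\<Sum>j. exp (- s / real n * real j) * c j) / C n)) \<longlonglongrightarrow> s * (Gamma (2 - \<beta>) * s powr (\<beta> - 1))" .
  moreover have "s * s powr (\<beta> - 1) = s powr \<beta>" using s by (simp add: powr_mult_base)
  then have "s * (Gamma (2 - \<beta>) * s powr (\<beta> - 1)) = Gamma (2 - \<beta>) * s powr \<beta>"
    by (simp only: mult.left_commute[of s])
  ultimately have "(\<lambda>n. real n * (1 - exp (- (s / real n))) * ((\<Sum>j. exp (- s / real n * real j) * c j) / C n))
      \<longlonglongrightarrow> Gamma (2 - \<beta>) * s powr \<beta>"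
    by (simp only:)
  then show ?thesis by (simp add: mult_ac)
qed

end

section \<open>The reduced resolvent\<close>

lemma inverse_ops_unique: "inverse_ops A S \<Longrightarrow> inverse_ops A S' \<Longrightarrow> S = S'"
proof (rule blinfun_eqI)
  fix x assume "inverse_ops A S" "inverse_ops A S'"
  then have "S (A y) = y" "A (S' x) = x" for y
    unfolding inverse_ops_def by (metis blinfun_apply_blinfun_compose id_blinfun.rep_eq)+
  then show "S x = S' x" by metis
qed

text \<open>By the resolvent identity, \<open>V t - V s\<close> equals
  \<open>V t (A s - A t) V s\<close>. Once \<open>norm (A s - A t) * norm (V s) < 1/2\<close>, it
  also yields the a priori bound \<open>norm (V t) \<le> 2 * norm (V s)\<close>, after which the
  identity gives convergence.\<close>

lemma inverse_ops_continuous_on: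
  fixes A V :: "'c::topological_space \<Rightarrow> ('b::real_normed_vector \<Rightarrow>\<^sub>L 'b)"
  assumes A: "continuous_on D A" and V: "\<And>t. t \<in> D \<Longrightarrow> inverse_ops (A t) (V t)"
  shows "continuous_on D V"
  unfolding continuous_on_def
proof
  fix s assume s: "s \<in> D"
  define d where "d t = norm (A s - A t)" for t
  have "((\<lambda>t. A s - A t) \<longlongrightarrow> A s - A s) (at s within D)"
    using A s by (intro tendsto_intros) (auto simp: continuous_on_def)
  then have d: "(d \<longlongrightarrow> 0) (at s within D)"
    unfolding d_def[abs_def] by (auto intro: tendsto_norm_zero)
  have diff: "V t - V s = V t o\<^sub>L ((A s - A t) o\<^sub>L V s)" if "t \<in> D" for t
  proof (rule blinfun_eqI)
    fix x
    have 1: "V t (A t y) = y" and 2: "A s (V s y) = y" for y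
      using V[OF that] V[OF s] unfolding inverse_ops_def
      by (metis blinfun_apply_blinfun_compose id_blinfun.rep_eq)+
    show "(V t - V s) x = (V t o\<^sub>L ((A s - A t) o\<^sub>L V s)) x"
      by (simp add: blinfun.diff_left blinfun.diff_right 1 2)
  qed
  have bound: "norm (V t - V s) \<le> norm (V t) * (d t * norm (V s))" if "t \<in> D" for t
    unfolding diff[OF that] d_def
    by (rule order_trans[OF norm_blinfun_compose mult_left_mono[OF norm_blinfun_compose]]) simp
  have "((\<lambda>t. d t * norm (V s)) \<longlongrightarrow> 0 * norm (V s)) (at s within D)"
    by (intro tendsto_mult d tendsto_const)
  then have half: "\<forall>\<^sub>F t in at s within D. d t * norm (V s) < 1 / 2"
    by (intro order_tendstoD(2)) auto
  have inD: "\<forall>\<^sub>F t in at s within D. t \<in> D" by (simp add: eventually_at_filter)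
  have "((\<lambda>t. V t - V s) \<longlongrightarrow> 0) (at s within D)"
  proof (rule Lim_null_comparison)
    show "\<forall>\<^sub>F t in at s within D. norm (V t - V s) \<le> 2 * norm (V s) * (d t * norm (V s))"
      using half inD
    proof eventually_elim
      case (elim t)
      note t = elim(2,1)
      have "norm (V t) * (d t * norm (V s)) \<le> norm (V t) * (1 / 2)"
        using t by (intro mult_left_mono) auto
      moreover have "norm (V t) \<le> norm (V s) + norm (V t - V s)"
        by (metis norm_triangle_sub)
      ultimately have "norm (V t) \<le> 2 * norm (V s)" using bound[OF t(1)] by simp
      then have "norm (V t) * (d t * norm (V s)) \<le> 2 * norm (V s) * (d t * norm (V s))"
        by (intro mult_right_mono) (auto simp: d_def)
      then show "norm (V t - V s) \<le> 2 * norm (V s) * (d t * norm (V s))"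
        using bound[OF t(1)] by simp
    qed
    have "((\<lambda>t. 2 * norm (V s) * (d t * norm (V s))) \<longlongrightarrow> 2 * norm (V s) * (0 * norm (V s))) (at s within D)"
      by (intro tendsto_mult d tendsto_const)
    then show "((\<lambda>t. 2 * norm (V s) * (d t * norm (V s))) \<longlongrightarrow> 0) (at s within D)" by simp
  qed
  then show "(V \<longlongrightarrow> V s) (at s within D)" by (simp add: LIM_zero_iff)
qed

lemma scalar_op_apply [simp]: "blinfun_apply (scalar_op c) x = c *\<^sub>C x"
  by (simp add: scalar_op.rep_eq)

lemma bounded_linear_scalar_op: "bounded_linear (scalar_op :: complex \<Rightarrow> ('b::complex_banach \<Rightarrow>\<^sub>L 'b))"
proof (rule bounded_linear_intro[where K = 1])
  fix a b :: complex and r :: real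
  show "(scalar_op (a + b) :: 'b \<Rightarrow>\<^sub>L 'b) = scalar_op a + scalar_op b"
    by (rule blinfun_eqI) (simp add: blinfun.add_left scaleC_add_left)
  show "(scalar_op (r *\<^sub>R a) :: 'b \<Rightarrow>\<^sub>L 'b) = r *\<^sub>R scalar_op a"
    by (rule blinfun_eqI) (simp add: blinfun.scaleR_left scaleR_scaleC scaleC_scaleC scaleR_conv_of_real)
  show "norm (scalar_op a :: 'b \<Rightarrow>\<^sub>L 'b) \<le> norm a * 1"
    by (rule norm_blinfun_bound) (auto simp: norm_scaleC)
qed

text \<open>The operator \<open>S = (2 \<pi> i)\<^sup>-\<^sup>1 \<integral> (\<xi> - 1)\<^sup>-\<^sup>1 (\<xi> - T)\<^sup>-\<^sup>1 d\<xi>\<close> satisfies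
  \<open>(1 - T) S = 1 - P\<close> because \<open>(1 - T) (\<xi> - T)\<^sup>-\<^sup>1 = 1 - (\<xi> - 1) (\<xi> - T)\<^sup>-\<^sup>1\<close>; the invariant
  functional \<open>I\<close> identifies the rank one projection \<open>P\<close>.\<close>

lemma reduced_resolvent:
  fixes T :: "'b::complex_banach \<Rightarrow>\<^sub>L 'b" and I :: "'b \<Rightarrow> complex"
  assumes T_scaleC: "\<And>c v. T (c *\<^sub>C v) = c *\<^sub>C T v"
    and simple: "simple_isolated_eigenvalue T 1"
    and Te: "T e = e"
    and I_lin: "bounded_linear I" and I_scaleC: "\<And>c v. I (c *\<^sub>C v) = c * I v"
    and Ie: "I e = 1" and IT: "\<And>v. I (T v) = I v"
  obtains S :: "'b \<Rightarrow>\<^sub>L 'b" where "\<And>v. S v - T (S v) = v - I v *\<^sub>C e"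
proof -
  interpret I: bounded_linear I by fact
  \<comment> \<open>The very choice made inside \<open>spectral_projection\<close>, so that
    \<open>P_eq\<close> holds by unfolding; the isolation of 1 shows that the choice has the
    required property.\<close>
  define r where "r = (SOME r. r > 0 \<and> cball 1 r \<inter> op_spectrum T = {1})"
  have "1 isolated_in op_spectrum T" using simple by (simp add: simple_isolated_eigenvalue_def)
  then obtain U where U: "open U" "U \<inter> op_spectrum T = {1}" by (auto simp: isolated_in_def)
  then have "1 \<in> U" by auto
  then obtain r' where "r' > 0" "cball 1 r' \<subseteq> U" using U(1) by (auto simp: open_contains_cball)
  then have "r' > 0 \<and> cball 1 r' \<inter> op_spectrum T = {1}" using U(2) by auto
  then have "r > 0 \<and> cball 1 r \<inter> op_spectrum T = {1}" unfolding r_def by (rule someI)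
  then have r: "r > 0" "cball 1 r \<inter> op_spectrum T = {1}" by simp_all
  define w where "w t = complex_of_real r * cis t" for t
  have w: "cmod (w t) = r" "w t \<noteq> 0" for t
    using r(1) by (auto simp: w_def norm_mult)
  define V where "V t = op_resolvent T (1 + w t)" for t
  have V: "inverse_ops (scalar_op (1 + w t) - T) (V t)" for t
  proof -
    have "1 + w t \<in> cball 1 r" "1 + w t \<noteq> 1" using w[of t] by (auto simp: dist_norm)
    then have "1 + w t \<notin> op_spectrum T" using r(2) by blast
    then obtain S where S: "inverse_ops (scalar_op (1 + w t) - T) S" by (auto simp: op_spectrum_def)
    then show ?thesis unfolding V_def op_resolvent_def
      by (rule theI) (rule inverse_ops_unique[OF _ S])
  qed
  have V1: "V t v + w t *\<^sub>C V t v - T (V t v) = v" for t v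
  proof -
    have "((scalar_op (1 + w t) - T) o\<^sub>L V t) v = v" using V[of t] by (simp add: inverse_ops_def)
    then show ?thesis by (simp add: blinfun.diff_left scaleC_add_left scaleC_one)
  qed
  have V2: "V t ((1 + w t) *\<^sub>C v - T v) = v" for t v
  proof -
    have "(V t o\<^sub>L (scalar_op (1 + w t) - T)) v = v" using V[of t] by (simp add: inverse_ops_def)
    then show ?thesis by (simp add: blinfun.diff_left)
  qed
  have contw: "continuous_on {0..2*pi} w"
    unfolding w_def[abs_def] by (intro continuous_on_mult continuous_on_const continuous_on_cis continuous_on_id)
  have "continuous_on {0..2*pi} (\<lambda>t. scalar_op (1 + w t) - T)"
    by (intro continuous_on_diff continuous_on_const continuous_on_add contw
        bounded_linear.continuous_on[OF bounded_linear_scalar_op])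
  then have contV: "continuous_on {0..2*pi} V"
    using V by (rule inverse_ops_continuous_on)
  have contP: "continuous_on {0..2*pi} (\<lambda>t. scalar_op (w t) o\<^sub>L V t)"
    by (intro bounded_bilinear.continuous_on[OF bounded_bilinear_blinfun_compose] contV
        bounded_linear.continuous_on[OF bounded_linear_scalar_op] contw)
  define P where "P = spectral_projection T 1"
  have P_eq: "P = (1 / (2 * pi)) *\<^sub>R integral {0..2*pi} (\<lambda>t. scalar_op (w t) o\<^sub>L V t)"
    unfolding P_def spectral_projection_def r_def[symmetric] riesz_integral_def w_def V_def ..
  \<comment> \<open>On the circle \<xi> - 1 = w and d\<xi> = i w dt, so (\<xi> - 1)^(-1) d\<xi> is i
    dt and the integrand is the bare resolvent.\<close>
  define S where "S = (1 / (2 * pi)) *\<^sub>R integral {0..2*pi} V"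
  have eval: "bounded_linear (\<lambda>X :: 'b \<Rightarrow>\<^sub>L 'b. X v)" for v :: 'b
    by (rule blinfun.bounded_linear_left)
  have hP: "((\<lambda>t. w t *\<^sub>C V t v) has_integral (2 * pi) *\<^sub>R P v) {0..2*pi}" for v
    using has_integral_linear[OF integrable_integral[OF integrable_continuous_real[OF contP]] eval[of v]]
    by (simp add: P_eq o_def blinfun.scaleR_left)
  have hS: "((\<lambda>t. V t v) has_integral (2 * pi) *\<^sub>R S v) {0..2*pi}" for v
    using has_integral_linear[OF integrable_integral[OF integrable_continuous_real[OF contV]] eval[of v]]
    by (simp add: S_def o_def blinfun.scaleR_left)
  have const: "((\<lambda>t. v) has_integral (2 * pi) *\<^sub>R v) {0..2*pi}" for v :: "'d::banach"
    using has_integral_const_real[of v 0 "2*pi"] by simp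
  have SP: "S v - T (S v) = v - P v" for v
  proof -
    have "((\<lambda>t. V t v + w t *\<^sub>C V t v - T (V t v)) has_integral
        (2 * pi) *\<^sub>R S v + (2 * pi) *\<^sub>R P v - T ((2 * pi) *\<^sub>R S v)) {0..2*pi}"
      using has_integral_linear[OF hS[of v] blinfun.bounded_linear_right[of T]]
      by (intro has_integral_diff has_integral_add hS hP) (simp add: o_def)
    then have "(2 * pi) *\<^sub>R v = (2 * pi) *\<^sub>R S v + (2 * pi) *\<^sub>R P v - T ((2 * pi) *\<^sub>R S v)"
      unfolding V1 by (rule has_integral_unique[OF const])
    then have "(2 * pi) *\<^sub>R v = (2 * pi) *\<^sub>R (S v + P v - T (S v))"
      by (simp add: blinfun.scaleR_right scaleR_add_right scaleR_diff_right)
    then have "v = S v + P v - T (S v)" by simp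
    then show ?thesis by (simp add: algebra_simps)
  qed
  have Pe: "P e = e"
  proof -
    have "w t *\<^sub>C V t e = e" for t
    proof -
      have "(1 + w t) *\<^sub>C (inverse (w t) *\<^sub>C e) - T (inverse (w t) *\<^sub>C e) = e"
        using w[of t] by (simp add: T_scaleC Te scaleC_add_left scaleC_one scaleC_scaleC distrib_right)
      then have "V t e = inverse (w t) *\<^sub>C e" using V2[of t "inverse (w t) *\<^sub>C e"] by simp
      then show ?thesis using w[of t] by (simp add: scaleC_scaleC scaleC_one)
    qed
    then have "(2 * pi) *\<^sub>R P e = (2 * pi) *\<^sub>R e"
      using hP[of e] const[of e] has_integral_unique by (simp only:) blast
    then show ?thesis by simp
  qed
  \<comment> \<open>Applying \<open>I\<close> to \<open>V1\<close> cancels \<open>I (V t v)\<close>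
    against \<open>I (T (V t v))\<close>, so the integrand of \<open>P v\<close> has constant
    \<open>I\<close>-value.\<close>
  have IP: "I (P v) = I v" for v
  proof -
    have "I (w t *\<^sub>C V t v) = I v" for t
    proof -
      have "I (V t v + w t *\<^sub>C V t v - T (V t v)) = I v" by (simp only: V1)
      then show ?thesis by (simp add: I.add I.diff IT)
    qed
    then have "((\<lambda>t. I v) has_integral I ((2 * pi) *\<^sub>R P v)) {0..2*pi}"
      using has_integral_linear[OF hP[of v] I_lin] by (simp add: o_def)
    then have "I ((2 * pi) *\<^sub>R P v) = (2 * pi) *\<^sub>R I v"
      using const[of "I v"] by (rule has_integral_unique)
    then show ?thesis by (simp add: I.scaleR)
  qed
  interpret vs: vector_space "scaleC :: complex \<Rightarrow> 'b \<Rightarrow> 'b" by (rule vector_space_scaleC)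
  \<comment> \<open>The value 1 differs from the default 0 of \<open>dim\<close>, so a basis with
    one element can be extracted.\<close>
  have "vs.dim (range P) = 1" using simple by (simp add: simple_isolated_eigenvalue_def P_def)
  then obtain B where B: "vs.independent B" "vs.span B = vs.span (range P)" "card B = 1"
    by (metis vs.dim_def vs.dim_eq_card zero_neq_one)
  then obtain b where b: "B = {b}" by (auto simp: card_1_singleton_iff)
  have ran: "\<exists>c. P v = c *\<^sub>C b" for v
  proof -
    have "P v \<in> vs.span {b}" using B b by (metis rangeI vs.span_base)
    then show ?thesis by (auto simp: vs.span_singleton)
  qed
  \<comment> \<open>\<open>e\<close> is a nonzero element of the one-dimensional range because
    \<open>P e = e\<close> and \<open>I e = 1\<close>; the coefficient of \<open>P v\<close> is then
    read off from \<open>I (P v) = I v\<close>.\<close>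
  have "P v = I v *\<^sub>C e" for v
  proof -
    obtain c0 where c0: "e = c0 *\<^sub>C b" using ran[of e] Pe by auto
    have "c0 \<noteq> 0"
    proof
      assume "c0 = 0"
      then have "e = 0 *\<^sub>C e" using c0 scaleC_scaleC[of 0 0 b] by simp
      then show False using Ie I_scaleC[of 0 e] by simp
    qed
    obtain c where "P v = c *\<^sub>C b" using ran by blast
    then have Pv: "P v = (c / c0) *\<^sub>C e" using c0 \<open>c0 \<noteq> 0\<close> by (simp add: scaleC_scaleC)
    then have "I v = c / c0" using IP[of v] I_scaleC[of "c / c0" e] Ie by simp
    then show ?thesis using Pv by simp
  qed
  then show thesis using that[of S] SP by simp
qed

section \<open>The operator renewal equation\<close>

text \<open>\<open>Q k\<close> is R_(k+1), \<open>p k\<close> the measure of {\<phi> = k+1},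
  \<open>I\<close> the integral and \<open>e\<close> the constant 1. The bound on
  \<open>I (Q k v)\<close> by \<open>p k\<close> is what remains here of the positivity of
  R_(k+1).\<close>

locale operator_renewal =
  fixes Q :: "nat \<Rightarrow> ('b::complex_banach \<Rightarrow>\<^sub>L 'b)" and RB S :: "'b \<Rightarrow>\<^sub>L 'b"
    and I :: "'b \<Rightarrow> complex" and e :: 'b and p :: "nat \<Rightarrow> real"
  assumes summable_Q: "summable (\<lambda>k. norm (Q k))"
    and Q_sums: "\<And>v. (\<lambda>k. Q k v) sums RB v"
    and RB_e: "RB e = e"
    and S: "\<And>v. S v - RB (S v) = v - I v *\<^sub>C e"
    and I_add: "\<And>v w. I (v + w) = I v + I w" and I_scaleC: "\<And>c v. I (c *\<^sub>C v) = c * I v"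
    and I_le: "\<And>v. cmod (I v) \<le> norm v" and I_e: "I e = 1"
    and I_Q_le: "\<And>k v. cmod (I (Q k v)) \<le> p k * norm v"
    and I_Q_e: "\<And>k. I (Q k e) = complex_of_real (p k)"
    and p_nonneg: "\<And>k. 0 \<le> p k" and p_sums: "p sums 1"
begin

text \<open>A scalar shadow of the operators T_n; the instances will be averages of T_n v over a
  set. The bound by \<open>norm v\<close> contains no constant that depends on the sequence, which
  makes the estimates below uniform over all renewal sequences.\<close>

definition renewal_sequence :: "(nat \<Rightarrow> 'b \<Rightarrow> complex) \<Rightarrow> bool" where
  "renewal_sequence \<theta> \<longleftrightarrow>
     (\<forall>n v w. \<theta> n (v + w) = \<theta> n v + \<theta> n w) \<and> (\<forall>n c v. \<theta> n (c *\<^sub>C v) = c * \<theta> n v) \<and>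
     (\<forall>n v. cmod (\<theta> n v) \<le> norm v) \<and> \<theta> 0 e = 1 \<and>
     (\<forall>n v. \<theta> (Suc n) v = (\<Sum>k\<le>n. \<theta> (n - k) (Q k v)))"

lemma bounded_linear_functional:
  fixes J :: "'b \<Rightarrow> complex"
  assumes "\<And>v w. J (v + w) = J v + J w" "\<And>c v. J (c *\<^sub>C v) = c * J v" "\<And>v. cmod (J v) \<le> K * norm v"
  shows "bounded_linear J"
proof (rule bounded_linear_intro[where K = K])
  fix r :: real and v
  show "J (r *\<^sub>R v) = r *\<^sub>R J v" using assms(2)[of "of_real r" v] by (simp add: scaleR_scaleC scaleR_conv_of_real)
qed (use assms in \<open>auto simp: mult.commute\<close>)

lemma bounded_linear_I: "bounded_linear I"
  using I_add I_scaleC I_le by (intro bounded_linear_functional[where K = 1]) auto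

text \<open>This is R - R(u), so that 1 - R(u) is \<open>1 - RB + E u\<close>.\<close>

definition E :: "real \<Rightarrow> ('b \<Rightarrow>\<^sub>L 'b)" where
  "E u = (\<Sum>k. (1 - exp (- (u * real (Suc k)))) *\<^sub>R Q k)"

text \<open>The integral of 1 - e^(-u \<phi>), that is, what \<open>I\<close> sees of
  \<open>E u e\<close>.\<close>

definition a :: "real \<Rightarrow> real" where
  "a u = (\<Sum>k. (1 - exp (- (u * real (Suc k)))) * p k)"

definition laplace :: "(nat \<Rightarrow> 'b \<Rightarrow> complex) \<Rightarrow> real \<Rightarrow> 'b \<Rightarrow> complex" where
  "laplace \<theta> u v = (\<Sum>n. exp (- (u * real n)) *\<^sub>R \<theta> n v)"

lemma factor_bounds:
  assumes "0 \<le> u"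
  shows "0 \<le> 1 - exp (- (u * real k))" "1 - exp (- (u * real k)) \<le> 1"
  using assms by auto

lemma E_summable: "0 \<le> u \<Longrightarrow> summable (\<lambda>k. norm ((1 - exp (- (u * real (Suc k)))) *\<^sub>R Q k))"
  using factor_bounds[of u]
  by (intro summable_comparison_test'[OF summable_Q, of 0]) (auto intro!: mult_left_le_one_le simp del: of_nat_Suc)

lemma E_sums: "0 \<le> u \<Longrightarrow> (\<lambda>k. (1 - exp (- (u * real (Suc k)))) *\<^sub>R Q k v) sums E u v"
  using bounded_linear.sums[OF blinfun.bounded_linear_left summable_sums[OF summable_norm_cancel[OF E_summable]], of u v]
  by (simp add: E_def blinfun.scaleR_left)

lemma a_sums: "0 \<le> u \<Longrightarrow> (\<lambda>k. (1 - exp (- (u * real (Suc k)))) * p k) sums a u"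
  unfolding a_def using factor_bounds[of u] p_nonneg
  by (intro summable_sums summable_comparison_test'[OF sums_summable[OF p_sums], of 0])
     (auto intro!: mult_left_le_one_le simp: abs_mult simp del: of_nat_Suc)

lemma I_E_e: "0 \<le> u \<Longrightarrow> I (E u e) = complex_of_real (a u)"
  using bounded_linear.sums[OF bounded_linear_I E_sums[of u e]] sums_of_real[OF a_sums[of u], where 'a = complex]
  by (simp add: linear_scale[OF bounded_linear.linear[OF bounded_linear_I]] I_Q_e scaleR_conv_of_real sums_unique2)

text \<open>The termwise bound by \<open>p k\<close> sums to \<open>a u\<close>, in place of the
  norm of \<open>E u\<close>. Errors passing through \<open>I\<close> are therefore small relative
  to \<open>a u\<close>, which is what division by \<open>a u\<close> requires.\<close>

lemma I_E_le:
  assumes u: "0 \<le> u"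
  shows "cmod (I (E u v)) \<le> a u * norm v"
proof -
  have 1: "(\<lambda>k. I ((1 - exp (- (u * real (Suc k)))) *\<^sub>R Q k v)) sums I (E u v)"
    by (rule bounded_linear.sums[OF bounded_linear_I E_sums[OF u]])
  have 2: "(\<lambda>k. (1 - exp (- (u * real (Suc k)))) * p k * norm v) sums (a u * norm v)"
    by (rule sums_mult2[OF a_sums[OF u]])
  show ?thesis
    unfolding sums_unique[OF 1] sums_unique[OF 2]
  proof (rule norm_suminf_le[OF _ sums_summable[OF 2]])
    fix k
    have "cmod (I ((1 - exp (- (u * real (Suc k)))) *\<^sub>R Q k v)) = (1 - exp (- (u * real (Suc k)))) * cmod (I (Q k v))"
      using factor_bounds[OF u, of "Suc k"]
      by (simp add: linear_scale[OF bounded_linear.linear[OF bounded_linear_I]] del: of_nat_Suc)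
    also have "\<dots> \<le> (1 - exp (- (u * real (Suc k)))) * (p k * norm v)"
      by (intro mult_left_mono I_Q_le factor_bounds[OF u])
    finally show "cmod (I ((1 - exp (- (u * real (Suc k)))) *\<^sub>R Q k v)) \<le> (1 - exp (- (u * real (Suc k)))) * p k * norm v"
      by (simp add: mult.assoc)
  qed
qed

text \<open>Each coefficient tends to 0 with \<open>u\<close> and the norms of the
  \<open>Q k\<close> form a summable majorant, so Tannery's theorem applies; this is where
  summability of the operator norms controls the perturbation.\<close>

lemma E_tendsto_0: "(E \<longlongrightarrow> 0) (at_right 0)"
proof (rule Lim_null_comparison)
  let ?g = "\<lambda>u k. norm ((1 - exp (- (u * real (Suc k)))) *\<^sub>R Q k)"
  show "\<forall>\<^sub>F u in at_right 0. norm (E u) \<le> (\<Sum>k. ?g u k)"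
    using eventually_at_right_less[of "0::real"] unfolding E_def
    by eventually_elim (intro summable_norm E_summable, simp)
  have "((\<lambda>u. \<Sum>k. ?g u k) \<longlongrightarrow> (\<Sum>k. 0)) (at_right 0)"
  proof (rule tannerys_theorem[THEN conjunct2, THEN conjunct2])
    fix k
    have "((\<lambda>u. (1 - exp (- (u * real (Suc k)))) *\<^sub>R Q k) \<longlongrightarrow> (1 - exp (- (0 * real (Suc k)))) *\<^sub>R Q k) (at_right 0)"
      by (intro tendsto_intros)
    then show "((\<lambda>u. ?g u k) \<longlongrightarrow> 0) (at_right 0)" by (intro tendsto_norm_zero) simp
    show "\<forall>\<^sub>F (k, u) in at_top \<times>\<^sub>F at_right 0. norm (?g u k) \<le> norm (Q k)"
    proof -
      have "norm (?g u k) \<le> norm (Q k)" if "u > 0" for u k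
        using factor_bounds[of u "Suc k"] that by (auto intro!: mult_left_le_one_le simp del: of_nat_Suc)
      moreover have "\<forall>\<^sub>F (k :: nat, u) in at_top \<times>\<^sub>F at_right 0. u > (0::real)"
        unfolding case_prod_beta by (rule eventually_compose_filterlim[OF eventually_at_right_less filterlim_snd])
      ultimately show ?thesis by (auto elim!: eventually_mono)
    qed
    show "summable (\<lambda>k. norm (Q k))" by (rule summable_Q)
  qed auto
  then show "((\<lambda>u. \<Sum>k. ?g u k) \<longlongrightarrow> 0) (at_right 0)" by simp
qed

section \<open>The scalar renewal equation for Laplace transforms\<close>

context
  fixes \<theta> assumes \<theta>: "renewal_sequence \<theta>"
begin

lemma \<theta>_props:
  "\<theta> n (v + w) = \<theta> n v + \<theta> n w" "\<theta> n (c *\<^sub>C v) = c * \<theta> n v" "cmod (\<theta> n v) \<le> norm v"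
  "\<theta> 0 e = 1" "\<theta> (Suc n) v = (\<Sum>k\<le>n. \<theta> (n - k) (Q k v))"
  using \<theta> by (simp_all add: renewal_sequence_def)

lemma laplace_summable: "u > 0 \<Longrightarrow> summable (\<lambda>n. exp (- (u * real n)) *\<^sub>R \<theta> n v)"
  by (rule summable_exp_bounded[OF \<theta>_props(3)])

lemma partial_le:
  assumes "u > 0"
  shows "cmod (\<Sum>n<N. exp (- (u * real n)) *\<^sub>R \<theta> n v) \<le> norm v * (1 / (1 - exp (- u)))"
proof -
  have geo: "(\<lambda>n. exp (- u) ^ n) sums (1 / (1 - exp (- u)))"
    using assms by (intro geometric_sums) simp
  have "cmod (\<Sum>n<N. exp (- (u * real n)) *\<^sub>R \<theta> n v) \<le> (\<Sum>n<N. exp (- u) ^ n * norm v)"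
    by (rule sum_norm_le) (simp add: exp_of_nat_mult[symmetric] mult.commute \<theta>_props(3))
  also have "\<dots> = (\<Sum>n<N. exp (- u) ^ n) * norm v" by (simp add: sum_distrib_right)
  also have "\<dots> \<le> (1 / (1 - exp (- u))) * norm v"
    unfolding sums_unique[OF geo]
    by (intro mult_right_mono sum_le_suminf sums_summable[OF geo]) auto
  finally show ?thesis by (simp add: mult.commute)
qed

lemma laplace_bounded_linear: "u > 0 \<Longrightarrow> bounded_linear (laplace \<theta> u)"
proof (rule bounded_linear_functional)
  fix v w c assume u: "u > 0"
  show "laplace \<theta> u (v + w) = laplace \<theta> u v + laplace \<theta> u w"
    using suminf_add[OF laplace_summable laplace_summable, OF u u]
    by (simp add: laplace_def \<theta>_props scaleR_add_right)
  show "laplace \<theta> u (c *\<^sub>C v) = c * laplace \<theta> u v"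
    using suminf_mult[OF laplace_summable[OF u], of c v] by (simp add: laplace_def \<theta>_props)
  show "cmod (laplace \<theta> u v) \<le> (1 / (1 - exp (- u))) * norm v"
  proof (rule LIMSEQ_le_const2)
    show "(\<lambda>N. cmod (\<Sum>n<N. exp (- (u * real n)) *\<^sub>R \<theta> n v)) \<longlonglongrightarrow> cmod (laplace \<theta> u v)"
      unfolding laplace_def by (intro tendsto_norm summable_LIMSEQ laplace_summable u)
    show "\<exists>M. \<forall>N\<ge>M. cmod (\<Sum>n<N. exp (- (u * real n)) *\<^sub>R \<theta> n v) \<le> (1 / (1 - exp (- u))) * norm v"
      using partial_le[OF u] by (auto simp: mult.commute)
  qed
qed

text \<open>Multiplying the recursion by e^(-u (n+1)) = e^(-u (k+1)) e^(-u (n-k)) turns its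
  convolution into a product of series, so T(u) = \<theta> 0 + T(u) R(u) with R(u) equal to
  \<open>RB - E u\<close>.\<close>

lemma renewal_equation:
  assumes u: "u > 0"
  shows "laplace \<theta> u (v - RB v + E u v) = \<theta> 0 v"
proof -
  interpret T: bounded_linear "laplace \<theta> u" by (rule laplace_bounded_linear[OF u])
  have "(\<lambda>k. Q k v - (1 - exp (- (u * real (Suc k)))) *\<^sub>R Q k v) sums (RB v - E u v)"
    using u by (intro sums_diff Q_sums E_sums) simp
  then have "(\<lambda>k. exp (- (u * real (Suc k))) *\<^sub>R Q k v) sums (RB v - E u v)"
    by (simp add: scaleR_diff_left del: of_nat_Suc)
  from T.sums[OF this]
  have 1: "(\<lambda>k. exp (- (u * real (Suc k))) *\<^sub>R laplace \<theta> u (Q k v)) sums laplace \<theta> u (RB v - E u v)"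
    by (simp only: T.scaleR)
  \<comment> \<open>\<open>g N k\<close> is the \<open>k\<close>-th row of the triangle k + j < N.
    Rows are bounded by \<open>norm (Q k)\<close> times a constant, so Tannery's theorem lets
    \<open>N\<close> tend to infinity inside the sum over \<open>k\<close>.\<close>
  define g where "g N k = (if k < N then exp (- (u * real (Suc k))) *\<^sub>R (\<Sum>j<N-k. exp (- (u * real j)) *\<^sub>R \<theta> j (Q k v)) else 0)" for N k
  have part: "(\<Sum>n<N. exp (- (u * real (Suc n))) *\<^sub>R \<theta> (Suc n) v) = (\<Sum>k. g N k)" for N
  proof -
    have "(\<Sum>n<N. exp (- (u * real (Suc n))) *\<^sub>R \<theta> (Suc n) v) =
       (\<Sum>n<N. \<Sum>k\<le>n. exp (- (u * real (Suc k))) *\<^sub>R exp (- (u * real (n - k))) *\<^sub>R \<theta> (n - k) (Q k v))"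
    proof (rule sum.cong[OF refl])
      fix n
      have "exp (- (u * real (Suc n))) *\<^sub>R \<theta> (Suc n) v = (\<Sum>k\<le>n. exp (- (u * real (Suc n))) *\<^sub>R \<theta> (n - k) (Q k v))"
        by (simp add: \<theta>_props(5) scaleR_sum_right)
      also have "\<dots> = (\<Sum>k\<le>n. exp (- (u * real (Suc k))) *\<^sub>R exp (- (u * real (n - k))) *\<^sub>R \<theta> (n - k) (Q k v))"
      proof (rule sum.cong[OF refl])
        fix k assume "k \<in> {..n}"
        then have "u * real (Suc n) = u * real (Suc k) + u * real (n - k)"
          by (simp add: of_nat_diff algebra_simps)
        then have "exp (- (u * real (Suc n))) = exp (- (u * real (Suc k))) * exp (- (u * real (n - k)))"
          by (simp only: mult_exp_exp minus_add_distrib)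
        then show "exp (- (u * real (Suc n))) *\<^sub>R \<theta> (n - k) (Q k v) =
            exp (- (u * real (Suc k))) *\<^sub>R exp (- (u * real (n - k))) *\<^sub>R \<theta> (n - k) (Q k v)"
          by (simp only: scaleR_scaleR)
      qed
      finally show "exp (- (u * real (Suc n))) *\<^sub>R \<theta> (Suc n) v = \<dots>" .
    qed
    also have "\<dots> = (\<Sum>(k,j)\<in>{(k,j). k + j < N}. exp (- (u * real (Suc k))) *\<^sub>R exp (- (u * real j)) *\<^sub>R \<theta> j (Q k v))"
      by (rule sum.triangle_reindex[symmetric])
    also have "{(k,j). k + j < N} = (SIGMA k:{..<N}. {..<N-k})" by auto
    also have "(\<Sum>(k,j)\<in>(SIGMA k:{..<N}. {..<N-k}). exp (- (u * real (Suc k))) *\<^sub>R exp (- (u * real j)) *\<^sub>R \<theta> j (Q k v))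
       = (\<Sum>k<N. g N k)"
      by (subst sum.Sigma[symmetric]) (auto simp: g_def scaleR_sum_right)
    also have "\<dots> = (\<Sum>k. g N k)"
      by (rule suminf_finite[symmetric]) (auto simp: g_def)
    finally show ?thesis .
  qed
  have "((\<lambda>N. \<Sum>k. g N k) \<longlongrightarrow> (\<Sum>k. exp (- (u * real (Suc k))) *\<^sub>R laplace \<theta> u (Q k v))) at_top"
  proof (rule tannerys_theorem[THEN conjunct2, THEN conjunct2])
    fix k
    show "(\<lambda>N. g N k) \<longlonglongrightarrow> exp (- (u * real (Suc k))) *\<^sub>R laplace \<theta> u (Q k v)"
    proof (rule LIMSEQ_offset[of _ "Suc k"])
      have "(\<lambda>N. \<Sum>j<N. exp (- (u * real j)) *\<^sub>R \<theta> j (Q k v)) \<longlonglongrightarrow> laplace \<theta> u (Q k v)"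
        unfolding laplace_def by (rule summable_LIMSEQ[OF laplace_summable[OF u]])
      then have "(\<lambda>N. exp (- (u * real (Suc k))) *\<^sub>R (\<Sum>j<Suc N. exp (- (u * real j)) *\<^sub>R \<theta> j (Q k v))) \<longlonglongrightarrow> exp (- (u * real (Suc k))) *\<^sub>R laplace \<theta> u (Q k v)"
        by (intro tendsto_scaleR tendsto_const LIMSEQ_Suc)
      then show "(\<lambda>N. g (N + Suc k) k) \<longlonglongrightarrow> exp (- (u * real (Suc k))) *\<^sub>R laplace \<theta> u (Q k v)"
        by (simp add: g_def Suc_diff_le)
    qed
  next
    have "norm (g N k) \<le> norm (Q k) * (norm v * (1 / (1 - exp (- u))))" for N k
    proof (cases "k < N")
      case True
      have "norm (g N k) \<le> 1 * cmod (\<Sum>j<N-k. exp (- (u * real j)) *\<^sub>R \<theta> j (Q k v))"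
        using True u by (auto simp: g_def simp del: of_nat_Suc intro!: mult_left_le_one_le)
      also have "\<dots> \<le> norm (Q k v) * (1 / (1 - exp (- u)))" using partial_le[OF u] by simp
      also have "\<dots> \<le> (norm (Q k) * norm v) * (1 / (1 - exp (- u)))"
        using u by (intro mult_right_mono norm_blinfun) auto
      finally show ?thesis by (simp add: mult.assoc)
    next
      case False
      then show ?thesis using u by (simp add: g_def)
    qed
    then show "\<forall>\<^sub>F (k, N) in at_top \<times>\<^sub>F at_top. norm (g N k) \<le> norm (Q k) * (norm v * (1 / (1 - exp (- u))))"
      by (auto intro: always_eventually)
    show "summable (\<lambda>k. norm (Q k) * (norm v * (1 / (1 - exp (- u)))))"
      by (rule summable_mult2[OF summable_Q])
  qed simp
  moreover have "(\<lambda>N. \<Sum>n<N. exp (- (u * real (Suc n))) *\<^sub>R \<theta> (Suc n) v) \<longlonglongrightarrow> laplace \<theta> u v - \<theta> 0 v"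
  proof -
    have "(\<lambda>n. exp (- (u * real (Suc n))) *\<^sub>R \<theta> (Suc n) v) sums (laplace \<theta> u v - exp (- (u * real 0)) *\<^sub>R \<theta> 0 v)"
      unfolding laplace_def
      by (subst sums_Suc_iff) (simp add: summable_sums[OF laplace_summable[OF u]])
    then show ?thesis by (simp add: sums_def del: of_nat_Suc)
  qed
  ultimately have "laplace \<theta> u v - \<theta> 0 v = laplace \<theta> u (RB v - E u v)"
    unfolding part sums_unique[OF 1] by (rule LIMSEQ_unique[rotated])
  then show ?thesis by (simp add: T.diff T.add algebra_simps)
qed

end

text \<open>For \<open>w + E\<^sub>u S w = v\<close> the renewal equation at \<open>S w\<close> reads \<open>T v = I w * T e + \<theta> 0 (S w)\<close>,
  and \<open>v = E\<^sub>u e\<close>, where \<open>T v = 1\<close>, determines \<open>T e\<close>.\<close>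

lemma solve_perturbation:
  assumes "norm (E u) * norm S \<le> 1 / 2"
  obtains w where "w + E u (S w) = v" "norm w \<le> 2 * norm v" "norm (w - v) \<le> 2 * (norm (E u) * norm S) * norm v"
proof -
  have le: "norm (E u (S x)) \<le> norm (E u) * norm S * norm x" for x
    by (rule order_trans[OF norm_blinfun])
       (simp add: mult.assoc mult_left_mono norm_blinfun)
  have half: "norm (E u (S x)) \<le> 1 / 2 * norm x" for x
    by (rule order_trans[OF le]) (rule mult_right_mono[OF assms norm_ge_zero])
  \<comment> \<open>The fixed point of an affine contraction replaces a Neumann series for the
    inverse of 1 + E S.\<close>
  have "\<exists>!w. v - E u (S w) = w"
  proof (rule banach_fix_type[of "1/2"])
    show "\<forall>x y. dist (v - E u (S x)) (v - E u (S y)) \<le> 1 / 2 * dist x y"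
    proof (intro allI)
      fix x y
      have "dist (v - E u (S x)) (v - E u (S y)) = norm (E u (S (y - x)))"
        by (simp add: dist_norm blinfun.diff_right)
      also have "\<dots> \<le> 1 / 2 * norm (y - x)" by (rule half)
      finally show "dist (v - E u (S x)) (v - E u (S y)) \<le> 1 / 2 * dist x y"
        by (simp add: dist_norm norm_minus_commute)
    qed
  qed auto
  then obtain w where w: "v - E u (S w) = w" by blast
  then have wv: "w + E u (S w) = v" by (metis diff_add_cancel)
  then have "norm w \<le> norm v + norm (E u (S w))" by (metis norm_triangle_ineq4 w)
  then have w2: "norm w \<le> 2 * norm v" using half[of w] by simp
  have "norm (w - v) = norm (E u (S w))" by (simp add: wv[symmetric])
  also have "\<dots> \<le> norm (E u) * norm S * (2 * norm v)"
    by (rule order_trans[OF le]) (intro mult_left_mono w2, simp)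
  finally show thesis using that[OF wv w2] by (simp add: mult_ac)
qed

text \<open>Applied to \<open>S w\<close>, the operator 1 - R(u) gives
  \<open>w - I w *\<^sub>C e + E u (S w)\<close>, which is
  \<open>v - I w *\<^sub>C e\<close>.\<close>

lemma laplace_solution:
  assumes \<theta>: "renewal_sequence \<theta>" and u: "u > 0" and w: "w + E u (S w) = v"
  shows "laplace \<theta> u v = I w * laplace \<theta> u e + \<theta> 0 (S w)"
proof -
  interpret T: bounded_linear "laplace \<theta> u" by (rule laplace_bounded_linear[OF \<theta> u])
  have "S w - RB (S w) + E u (S w) = v - I w *\<^sub>C e"
    using S[of w] w by (metis add.commute add_diff_eq)
  then have "\<theta> 0 (S w) = laplace \<theta> u (v - I w *\<^sub>C e)" using renewal_equation[OF \<theta> u, of "S w"] by simp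
  moreover have "laplace \<theta> u (c *\<^sub>C e) = c * laplace \<theta> u e" for c
    using suminf_mult[OF laplace_summable[OF \<theta> u], of c e] by (simp add: laplace_def \<theta>_props[OF \<theta>])
  ultimately show ?thesis by (simp add: T.diff)
qed

text \<open>The transform of \<open>e\<close> is about \<open>1 / I w1\<close> for the solution
  \<open>w1\<close> belonging to \<open>E u e\<close>, and \<open>I w1\<close> is \<open>a u\<close>
  up to a relative error. For general \<open>v\<close> the solution \<open>w\<close> is close to
  \<open>v\<close>, and the bounded remainder \<open>\<theta> 0 (S w)\<close> is killed by the
  factor \<open>a u\<close>. The quantifier over \<theta> stands inside because no bound depends on
  it.\<close>

lemma renewal_asymptotics:
  assumes "\<epsilon> > 0"
  shows "\<forall>\<^sub>F u in at_right 0. \<forall>\<theta>. renewal_sequence \<theta> \<longrightarrow> cmod (a u *\<^sub>R laplace \<theta> u v - I v) \<le> \<epsilon>"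
proof -
  \<comment> \<open>\<open>d\<close> bounds \<open>norm (S w1)\<close>, \<open>h\<close> is the
    contraction constant, and \<open>bnd\<close> adds the three errors \<open>p1\<close>,
    \<open>p2\<close>, \<open>p3\<close> below.\<close>
  define d where "d u = 2 * norm S * norm (E u) * norm e" for u
  define h where "h u = norm (E u) * norm S" for u
  define bnd where "bnd u = 2 * h u * norm v * (1 + 4 * d u) + norm v * (4 * d u) + norm (E u) * norm e * (2 * norm S * norm v)" for u
  have E0: "((\<lambda>u. norm (E u)) \<longlongrightarrow> 0) (at_right 0)" using E_tendsto_0 by (rule tendsto_norm_zero)
  have d0: "(d \<longlongrightarrow> 2 * norm S * 0 * norm e) (at_right 0)" unfolding d_def[abs_def] by (intro tendsto_intros E0)
  have h0: "(h \<longlongrightarrow> 0 * norm S) (at_right 0)" unfolding h_def[abs_def] by (intro tendsto_intros E0)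
  have "(bnd \<longlongrightarrow> 2 * (0 * norm S) * norm v * (1 + 4 * (2 * norm S * 0 * norm e)) + norm v * (4 * (2 * norm S * 0 * norm e)) + 0 * norm e * (2 * norm S * norm v)) (at_right 0)"
    unfolding bnd_def[abs_def] by (intro tendsto_intros E0 d0 h0)
  then have b: "\<forall>\<^sub>F u in at_right 0. bnd u < \<epsilon>" using assms by (intro order_tendstoD(2)) auto
  have d: "\<forall>\<^sub>F u in at_right 0. d u < 1 / 2" using d0 by (intro order_tendstoD(2)) auto
  have h: "\<forall>\<^sub>F u in at_right 0. h u < 1 / 2" using h0 by (intro order_tendstoD(2)) auto
  show ?thesis
    using b d h eventually_at_right_less[of "0::real"]
  proof eventually_elim
    case (elim u)
    then have u: "u > 0" by simp
    have hu: "norm (E u) * norm S \<le> 1 / 2" using elim by (simp add: h_def)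
    have nn: "0 \<le> d u" "0 \<le> h u" by (auto simp: d_def h_def)
    have a0: "a u \<ge> 0"
      using a_sums[of u] u factor_bounds[of u] p_nonneg by (intro sums_le[OF _ sums_zero a_sums]) auto
    have a_le: "a u \<le> norm (E u) * norm e"
    proof -
      have "a u = cmod (I (E u e))" using I_E_e[of u] u a0 by simp
      also have "\<dots> \<le> norm (E u e)" by (rule I_le)
      also have "\<dots> \<le> norm (E u) * norm e" by (rule norm_blinfun)
      finally show ?thesis .
    qed
    show ?case
    proof (intro allI impI)
      fix \<theta> assume \<theta>: "renewal_sequence \<theta>"
      interpret I: bounded_linear I by (rule bounded_linear_I)
      define t where "t = laplace \<theta> u e"
      obtain w1 where w1: "w1 + E u (S w1) = E u e" "norm w1 \<le> 2 * norm (E u e)"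
        using solve_perturbation[OF hu] by metis
      have "laplace \<theta> u (E u e) = 1"
        using renewal_equation[OF \<theta> u, of e] \<theta>_props(4)[OF \<theta>] by (simp add: RB_e)
      then have t1: "1 - I w1 * t = \<theta> 0 (S w1)"
        using laplace_solution[OF \<theta> u w1(1)] by (simp add: t_def algebra_simps)
      have Sw1: "norm (S w1) \<le> d u"
      proof -
        have "norm (S w1) \<le> norm S * (2 * (norm (E u) * norm e))"
          by (rule order_trans[OF norm_blinfun])
             (intro mult_left_mono order_trans[OF w1(2)] norm_blinfun, auto)
        then show ?thesis by (simp add: d_def mult_ac)
      qed
      have c1: "cmod (1 - I w1 * t) \<le> d u" unfolding t1 by (rule order_trans[OF \<theta>_props(3)[OF \<theta>] Sw1])
      \<comment> \<open>Applying \<open>I\<close> to the equation for \<open>w1\<close> isolates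
        \<open>I (E u (S w1))\<close>; by \<open>I_E_le\<close> it is at most
        \<open>a u * d u\<close>, an error relative to \<open>a u\<close>.\<close>
      have "I w1 - a u = - I (E u (S w1))"
        using arg_cong[OF w1(1), of I] I_E_e[of u] u by (simp add: I.add algebra_simps)
      then have "cmod (I w1 - a u) \<le> a u * norm (S w1)"
        using I_E_le[of u "S w1"] u by simp
      also have "\<dots> \<le> a u * d u" by (intro mult_left_mono Sw1 a0)
      finally have c2: "cmod (I w1 - a u) \<le> a u * d u" .
      define x where "x = a u * cmod t"
      have c3: "cmod (of_real (a u) * t - I w1 * t) \<le> d u * x"
      proof -
        have "cmod (of_real (a u) * t - I w1 * t) = cmod (I w1 - a u) * cmod t"
          by (metis left_diff_distrib norm_mult norm_minus_commute)
        also have "\<dots> \<le> (a u * d u) * cmod t" by (intro mult_right_mono c2) simp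
        finally show ?thesis by (simp add: x_def mult_ac)
      qed
      have c4: "cmod (of_real (a u) * t - 1) \<le> d u * x + d u"
        using norm_triangle_ineq4[of "of_real (a u) * t - I w1 * t" "1 - I w1 * t"] c1 c3 by simp
      have x_eq: "x = cmod (of_real (a u) * t)" using a0 by (simp add: x_def norm_mult)
      have "x \<le> 1 + (d u * x + d u)"
        using c4 norm_triangle_ineq2[of "of_real (a u) * t" 1] x_eq by simp
      \<comment> \<open>A bootstrap: the error in \<open>c4\<close> contains \<open>x\<close>
        itself, and \<open>d u < 1/2\<close> lets it be absorbed. The crude bound
        \<open>x \<le> 3\<close> then turns that error into \<open>4 * d u\<close>.\<close>
      moreover have "d u * x \<le> 1 / 2 * x" using elim a0 by (intro mult_right_mono) (auto simp: x_def)
      ultimately have "x \<le> 2 + 2 * d u" by simp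
      then have x3: "x \<le> 3" using elim by simp
      then have "d u * x \<le> d u * 3" by (intro mult_left_mono nn)
      then have c5: "cmod (of_real (a u) * t - 1) \<le> 4 * d u" using c4 by simp
      have x4: "x \<le> 1 + 4 * d u"
        using c5 norm_triangle_ineq2[of "of_real (a u) * t" 1] x_eq by simp
      obtain w where w: "w + E u (S w) = v" "norm w \<le> 2 * norm v" "norm (w - v) \<le> 2 * h u * norm v"
        using solve_perturbation[OF hu, of v] unfolding h_def by metis
      have eq: "a u *\<^sub>R laplace \<theta> u v - I v = (I (w - v)) * (of_real (a u) * t) + I v * (of_real (a u) * t - 1) + of_real (a u) * \<theta> 0 (S w)"
        unfolding laplace_solution[OF \<theta> u w(1)] t_def[symmetric]
        by (simp add: I.diff scaleR_conv_of_real algebra_simps)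
      have p1: "cmod (I (w - v) * (of_real (a u) * t)) \<le> 2 * h u * norm v * (1 + 4 * d u)"
        unfolding norm_mult[of "I (w - v)"] using order_trans[OF I_le w(3)] x4 x_eq nn
        by (intro mult_mono) auto
      have p2: "cmod (I v * (of_real (a u) * t - 1)) \<le> norm v * (4 * d u)"
        unfolding norm_mult[of "I v"] using I_le c5 by (intro mult_mono) auto
      have "norm (S w) \<le> norm S * (2 * norm v)"
        by (rule order_trans[OF norm_blinfun]) (intro mult_left_mono w(2), simp)
      then have "cmod (\<theta> 0 (S w)) \<le> 2 * norm S * norm v"
        using \<theta>_props(3)[OF \<theta>, of 0 "S w"] by simp
      then have p3: "cmod (of_real (a u) * \<theta> 0 (S w)) \<le> norm (E u) * norm e * (2 * norm S * norm v)"
        unfolding norm_mult using a_le a0 by (intro mult_mono) auto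
      have "cmod (a u *\<^sub>R laplace \<theta> u v - I v) \<le> bnd u"
        unfolding eq bnd_def using p1 p2 p3
        by (intro order_trans[OF norm_triangle_ineq add_mono[OF order_trans[OF norm_triangle_ineq add_mono]]])
      then show "cmod (a u *\<^sub>R laplace \<theta> u v - I v) \<le> \<epsilon>" using elim by simp
    qed
  qed
qed

end

section \<open>First return maps\<close>

lemma less_return_time_iff: "enat n < return_time f Y y \<longleftrightarrow> (\<forall>m\<in>{1..n}. (f ^^ m) y \<notin> Y)"
proof -
  have "enat n < return_time f Y y \<longleftrightarrow> (\<forall>m\<in>{m. m \<ge> 1 \<and> (f ^^ m) y \<in> Y}. Suc n \<le> m)"
    unfolding Suc_ile_eq[symmetric] return_time_def le_INF_iff by simp
  also have "\<dots> \<longleftrightarrow> (\<forall>m\<in>{1..n}. (f ^^ m) y \<notin> Y)"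
    by (auto simp: not_less_eq_eq)
  finally show ?thesis .
qed

lemma return_time_eq_iff:
  "return_time f Y y = enat (Suc n) \<longleftrightarrow> (f ^^ Suc n) y \<in> Y \<and> (\<forall>m\<in>{1..n}. (f ^^ m) y \<notin> Y)"
proof -
  have "return_time f Y y = enat (Suc n) \<longleftrightarrow> enat n < return_time f Y y \<and> \<not> enat (Suc n) < return_time f Y y"
    by (cases "return_time f Y y") auto
  also have "\<dots> \<longleftrightarrow> (f ^^ Suc n) y \<in> Y \<and> (\<forall>m\<in>{1..n}. (f ^^ m) y \<notin> Y)"
    unfolding less_return_time_iff by (auto simp: atLeastAtMostSuc_conv)
  finally show ?thesis .
qed

locale first_return =
  fixes M :: "'a measure" and f :: "'a \<Rightarrow> 'a" and Y :: "'a set"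
  assumes measure_preserving: "measure_preserving_map M f"
    and Y_sets: "Y \<in> sets M" and emeasure_Y: "emeasure M Y = 1"
    and returns: "AE y in restrict_space M Y. return_time f Y y < \<infinity>"
begin

abbreviation MY :: "'a measure" where "MY \<equiv> restrict_space M Y"

definition preimage :: "nat \<Rightarrow> 'a set \<Rightarrow> 'a set" where
  "preimage n A = (f ^^ n) -` A \<inter> space M"

text \<open>The shift by one reflects that return times are at least 1 and matches the indexing of
  \<open>Q\<close> and \<open>p\<close>.\<close>

definition level :: "nat \<Rightarrow> 'a set" where
  "level k = {y \<in> Y. return_time f Y y = enat (Suc k)}"

definition tail :: "nat \<Rightarrow> 'a set" where
  "tail n = {y \<in> Y. enat n < return_time f Y y}"

lemma f_measurable: "f \<in> measurable M M" and distr_f: "distr M M f = M"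
  using measure_preserving by (auto simp: measure_preserving_map_def)

lemma f_space: "x \<in> space M \<Longrightarrow> f x \<in> space M"
  using measurable_space[OF f_measurable] .

lemma funpow_space: "x \<in> space M \<Longrightarrow> (f ^^ n) x \<in> space M"
  by (induction n) (auto simp: f_space)

lemma funpow_measurable: "f ^^ n \<in> measurable M M"
  by (induction n) (auto intro: measurable_compose[OF _ f_measurable])

lemma preimage_sets: "A \<in> sets M \<Longrightarrow> preimage n A \<in> sets M"
  unfolding preimage_def by (rule measurable_sets[OF funpow_measurable])

lemma emeasure_preimage: "A \<in> sets M \<Longrightarrow> emeasure M (preimage n A) = emeasure M A"
proof (induction n arbitrary: A)
  case 0
  then show ?case using sets.sets_into_space[OF 0] by (simp add: preimage_def Int_absorb2)
next
  case (Suc n)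
  have "preimage (Suc n) A = f -` (preimage n A) \<inter> space M"
    using f_space by (auto simp: preimage_def funpow_swap1)
  then have "emeasure M (preimage (Suc n) A) = emeasure (distr M M f) (preimage n A)"
    using preimage_sets[OF Suc.prems] by (simp add: emeasure_distr[OF f_measurable])
  then show ?case using Suc by (simp add: distr_f)
qed

lemma Y_space: "Y \<subseteq> space M" using sets.sets_into_space[OF Y_sets] .

lemma space_MY [simp]: "space MY = Y"
  using Y_space by (simp add: space_restrict_space Int_absorb2)

lemma sets_MY: "A \<in> sets MY \<longleftrightarrow> A \<in> sets M \<and> A \<subseteq> Y"
  using sets_restrict_space_iff[of Y M] Y_sets Y_space by (auto simp: Int_absorb2)

lemma Int_Y_sets: "A \<in> sets M \<Longrightarrow> A \<inter> Y \<in> sets MY"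
  using Y_sets by (auto simp: sets_MY)

lemma measure_MY: "A \<subseteq> Y \<Longrightarrow> measure MY A = measure M A"
  using Y_sets Y_space by (intro measure_restrict_space) (auto simp: Int_absorb2)

lemma emeasure_MY: "A \<subseteq> Y \<Longrightarrow> emeasure MY A = emeasure M A"
  using Y_sets Y_space by (intro emeasure_restrict_space) (auto simp: Int_absorb2)

lemma prob_space_MY: "prob_space MY"
  by (rule prob_spaceI) (simp add: emeasure_MY emeasure_Y)

sublocale MY: prob_space MY by (rule prob_space_MY)

lemma tail_eq: "tail n = {y \<in> Y. \<forall>m\<in>{1..n}. y \<notin> preimage m Y}"
  using Y_space by (auto simp: tail_def less_return_time_iff preimage_def)

lemma tail_sets: "tail n \<in> sets MY"
proof -
  have "tail n = Y - (\<Union>m\<in>{1..n}. preimage m Y)" by (auto simp: tail_eq)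
  then show ?thesis using Y_sets preimage_sets[OF Y_sets] by (auto simp: sets_MY)
qed

lemma tail_subset: "tail n \<subseteq> Y" and level_subset: "level n \<subseteq> Y"
  by (auto simp: tail_def level_def)

lemma tail_0: "tail 0 = Y" by (auto simp: tail_def less_return_time_iff)

lemma tail_decseq: "decseq tail"
  unfolding decseq_def tail_def by (auto intro: order_le_less_trans[of "enat m" "enat n" for m n])

lemma level_eq: "level k = tail k - tail (Suc k)"
proof -
  have "x = enat (Suc k) \<longleftrightarrow> enat k < x \<and> \<not> enat (Suc k) < x" for x by (cases x) auto
  then show ?thesis by (auto simp: level_def tail_def)
qed

lemma level_sets: "level k \<in> sets MY"
  unfolding level_eq using tail_sets by auto

definition c :: "nat \<Rightarrow> real" where "c n = measure MY (tail n)"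
definition p :: "nat \<Rightarrow> real" where "p k = measure MY (level k)"

lemma c_0: "c 0 = 1"
  using MY.prob_space by (simp add: c_def tail_0)

lemma c_decseq: "decseq c"
  using tail_decseq tail_sets by (auto simp: decseq_def c_def intro!: MY.finite_measure_mono)

lemma p_eq: "p k = c k - c (Suc k)"
  unfolding p_def c_def level_eq
  by (rule MY.finite_measure_Diff) (use tail_sets decseq_SucD[OF tail_decseq] in auto)

lemma AE_level: "AE y in MY. \<exists>k. y \<in> level k"
  using returns AE_space
proof eventually_elim
  case (elim y)
  then obtain n where n: "return_time f Y y = enat n" by auto
  moreover have "enat 0 < return_time f Y y" by (simp add: less_return_time_iff)
  ultimately obtain k where "n = Suc k" by (cases n) auto
  then show ?case using n elim by (auto simp: level_def)
qed

lemma c_tendsto_0: "c \<longlonglongrightarrow> 0"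
proof -
  have "c \<longlonglongrightarrow> measure MY (\<Inter>n. tail n)"
    unfolding c_def[abs_def]
    by (rule MY.finite_Lim_measure_decseq) (use tail_sets tail_decseq in auto)
  moreover have "measure MY (\<Inter>n. tail n) = 0"
  proof -
    have "AE y in MY. y \<notin> (\<Inter>n. tail n)"
      using AE_level by eventually_elim (auto simp: level_eq)
    then show ?thesis using tail_sets by (subst MY.prob_eq_0) auto
  qed
  ultimately show ?thesis by simp
qed

lemma p_sums: "p sums 1"
  using telescope_sums'[OF c_tendsto_0] by (simp add: p_eq[abs_def] c_0)

lemma disjoint_level: "j \<noteq> k \<Longrightarrow> level j \<inter> level k = {}"
  by (auto simp: level_def)

section \<open>Kac's decomposition by the first entrance into the base set\<close>

definition first_entry :: "nat \<Rightarrow> 'a set \<Rightarrow> 'a set" where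
  "first_entry n A = {x \<in> space M. (f ^^ n) x \<in> A \<and> (\<forall>i<n. (f ^^ i) x \<notin> Y)}"

lemma first_entry_sets: "A \<in> sets M \<Longrightarrow> first_entry n A \<in> sets M"
proof -
  assume A: "A \<in> sets M"
  have "first_entry n A = preimage n A - (\<Union>i<n. preimage i Y)"
    by (auto simp: first_entry_def preimage_def)
  then show ?thesis using preimage_sets[OF A] preimage_sets[OF Y_sets] by auto
qed

text \<open>Pulling back by \<open>f\<close> preserves the measure and moves the entrance time to
  \<open>n + 1\<close>. Points of the pullback that start in Y make their first return at time
  \<open>n + 1\<close> and land in \<open>A\<close>; those that start outside form the next
  \<open>first_entry\<close> set.\<close>

lemma first_entry_step:
  assumes A: "A \<in> sets M" "A \<subseteq> Y"
  shows "emeasure M (first_entry n A) = emeasure M (level n \<inter> preimage (Suc n) A) + emeasure M (first_entry (Suc n) A)"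
proof -
  have "emeasure M (first_entry n A) = emeasure M (preimage 1 (first_entry n A))"
    by (rule emeasure_preimage[symmetric, OF first_entry_sets[OF A(1)]])
  also have "preimage 1 (first_entry n A) = (level n \<inter> preimage (Suc n) A) \<union> first_entry (Suc n) A"
  proof (intro set_eqI)
    fix x
    have *: "(\<forall>i<n. (f ^^ Suc i) x \<notin> Y) \<longleftrightarrow> (\<forall>m\<in>{1..n}. (f ^^ m) x \<notin> Y)"
      by (metis Suc_le_D Suc_le_eq atLeastAtMost_iff One_nat_def not_less_eq_eq le0)
    have "x \<in> preimage 1 (first_entry n A) \<longleftrightarrow> x \<in> space M \<and> (f ^^ Suc n) x \<in> A \<and> (\<forall>i<n. (f ^^ Suc i) x \<notin> Y)"
      using f_space by (auto simp: preimage_def first_entry_def funpow_swap1)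
    moreover have "x \<in> first_entry (Suc n) A \<longleftrightarrow> x \<in> space M \<and> x \<notin> Y \<and> (f ^^ Suc n) x \<in> A \<and> (\<forall>i<n. (f ^^ Suc i) x \<notin> Y)"
      by (simp only: first_entry_def All_less_Suc2 mem_Collect_eq) auto
    moreover have "x \<in> level n \<inter> preimage (Suc n) A \<longleftrightarrow> x \<in> space M \<and> x \<in> Y \<and> (f ^^ Suc n) x \<in> A \<and> (\<forall>i<n. (f ^^ Suc i) x \<notin> Y)"
      unfolding * using A(2) Y_space by (auto simp: level_def return_time_eq_iff preimage_def simp del: funpow.simps)
    ultimately show "x \<in> preimage 1 (first_entry n A) \<longleftrightarrow> x \<in> (level n \<inter> preimage (Suc n) A) \<union> first_entry (Suc n) A"
      by auto
  qed
  also have "emeasure M \<dots> = emeasure M (level n \<inter> preimage (Suc n) A) + emeasure M (first_entry (Suc n) A)"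
  proof (rule plus_emeasure[symmetric])
    show "level n \<inter> preimage (Suc n) A \<in> sets M"
      using level_sets preimage_sets[OF A(1)] by (auto simp: sets_MY)
    show "(level n \<inter> preimage (Suc n) A) \<inter> first_entry (Suc n) A = {}"
      by (force simp: level_def first_entry_def)
  qed (rule first_entry_sets[OF A(1)])
  finally show ?thesis .
qed

lemma measure_first_entry_step:
  assumes A: "A \<in> sets M" "A \<subseteq> Y"
  shows "measure M (first_entry n A) = measure MY (level n \<inter> preimage (Suc n) A) + measure M (first_entry (Suc n) A)"
proof -
  have fin: "emeasure M (first_entry n A) < \<infinity>" for n
  proof -
    have "emeasure M (first_entry n A) \<le> emeasure M (preimage n A)"
      by (rule emeasure_mono) (auto simp: first_entry_def preimage_def preimage_sets[OF A(1), unfolded preimage_def])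
    also have "\<dots> = emeasure M A" by (rule emeasure_preimage[OF A(1)])
    also have "\<dots> \<le> emeasure M Y" by (rule emeasure_mono[OF A(2) Y_sets])
    finally show ?thesis by (simp add: emeasure_Y le_less_trans)
  qed
  have "emeasure M (level n \<inter> preimage (Suc n) A) < \<infinity>"
    using fin[of n] first_entry_step[OF A, of n] by (simp add: ennreal_add_less_top)
  then have "measure M (first_entry n A) = measure M (level n \<inter> preimage (Suc n) A) + measure M (first_entry (Suc n) A)"
    using fin[of "Suc n"] unfolding measure_def first_entry_step[OF A, of n] by (subst enn2real_plus) auto
  also have "measure M (level n \<inter> preimage (Suc n) A) = measure MY (level n \<inter> preimage (Suc n) A)"
    using level_subset[of n] by (intro measure_MY[symmetric]) auto
  finally show ?thesis .
qed

lemma measure_first_entry: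
  assumes A: "A \<in> sets M" "A \<subseteq> Y"
  shows "measure M A = (\<Sum>k<n. measure MY (level k \<inter> preimage (Suc k) A)) + measure M (first_entry n A)"
proof (induction n)
  case 0
  have "first_entry 0 A = A" using A Y_space by (auto simp: first_entry_def)
  then show ?case by simp
next
  case (Suc n)
  then show ?case using measure_first_entry_step[OF A, of n] by simp
qed

lemma level_preimage_Y: "level k \<inter> preimage (Suc k) Y = level k"
  using Y_space by (auto simp: level_def return_time_eq_iff preimage_def simp del: funpow.simps)

text \<open>Invariance of the restricted measure under the first return map. The remainder is
  dominated by the measure of \<open>first_entry n Y\<close>, which is \<open>c n\<close>.\<close>

lemma measure_return_sums:
  assumes A: "A \<in> sets M" "A \<subseteq> Y"
  shows "(\<lambda>k. measure MY (level k \<inter> preimage (Suc k) A)) sums measure MY A"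
proof -
  \<comment> \<open>For \<open>A = Y\<close> the sum over levels telescopes, which leaves
    \<open>c n\<close> as remainder.\<close>
  have Y: "measure M (first_entry n Y) = c n" for n
  proof -
    have "c 0 = (\<Sum>k<n. p k) + measure M (first_entry n Y)"
      using measure_first_entry[OF Y_sets order_refl, of n]
      by (simp add: level_preimage_Y p_def c_def tail_0 measure_MY)
    moreover have "(\<Sum>k<n. p k) = c 0 - c n"
      unfolding p_eq by (rule sum_lessThan_telescope')
    ultimately show ?thesis by simp
  qed
  have "(\<lambda>n. measure M (first_entry n A)) \<longlonglongrightarrow> 0"
  proof (rule Lim_null_comparison[OF _ c_tendsto_0])
    show "\<forall>\<^sub>F n in sequentially. norm (measure M (first_entry n A)) \<le> c n"
    proof (intro always_eventually allI)
      fix n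
      have "emeasure M (first_entry n Y) < \<infinity>"
      proof -
        have "emeasure M (first_entry n Y) \<le> emeasure M (preimage n Y)"
          by (rule emeasure_mono) (auto simp: first_entry_def preimage_def preimage_sets[OF Y_sets, unfolded preimage_def])
        then show ?thesis by (simp add: emeasure_preimage[OF Y_sets] emeasure_Y le_less_trans)
      qed
      then have "measure M (first_entry n A) \<le> measure M (first_entry n Y)"
        using A(2) first_entry_sets[OF A(1)] first_entry_sets[OF Y_sets]
        by (intro measure_mono_fmeasurable) (auto simp: fmeasurable_def first_entry_def)
      then show "norm (measure M (first_entry n A)) \<le> c n" by (simp add: Y)
    qed
  qed
  then have "(\<lambda>n. measure M A - measure M (first_entry n A)) \<longlonglongrightarrow> measure M A - 0"
    by (intro tendsto_diff tendsto_const)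
  moreover have "(\<Sum>k<n. measure MY (level k \<inter> preimage (Suc k) A)) = measure M A - measure M (first_entry n A)" for n
    using measure_first_entry[OF A, of n] by simp
  ultimately show ?thesis using A by (simp add: sums_def measure_MY)
qed

lemma return_map_level: "y \<in> level k \<Longrightarrow> return_map f Y y = (f ^^ Suc k) y"
  by (auto simp: level_def return_map_def simp del: funpow.simps)

lemma preimage_add: "preimage m (preimage n A) = preimage (n + m) A"
  using funpow_space by (auto simp: preimage_def funpow_add)

end

section \<open>Operators on the function space\<close>

locale renewal_space = first_return M f Y
  for M :: "'a measure" and f Y +
  fixes R :: "('a \<Rightarrow> complex) \<Rightarrow> ('a \<Rightarrow> complex)"
    and \<iota> :: "'b::complex_banach \<Rightarrow> 'a \<Rightarrow> complex"
    and Rn :: "nat \<Rightarrow> ('b \<Rightarrow>\<^sub>L 'b)" and RB :: "'b \<Rightarrow>\<^sub>L 'b"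
  assumes R: "transfer_operator (restrict_space M Y) (return_map f Y) R"
    and function_space: "Linf_function_space (restrict_space M Y) \<iota>"
    and Linf_norm_le: "\<And>v. Linf_norm (restrict_space M Y) (\<iota> v) \<le> ereal (norm v)"
    and Rn: "\<And>n. n \<ge> 1 \<Longrightarrow>
      induces_operator (restrict_space M Y) \<iota> (level_operator (return_time f Y) R n) (Rn n)"
    and Rn_summable: "summable (\<lambda>n. norm (Rn (Suc n)))"
    and RB: "induces_operator (restrict_space M Y) \<iota> R RB"
    and simple: "simple_isolated_eigenvalue RB 1"
begin

lemma \<iota>_measurable [measurable]: "\<iota> v \<in> borel_measurable MY"
  and \<iota>_add: "AE x in MY. \<iota> (v + w) x = \<iota> v x + \<iota> w x"
  and \<iota>_scaleC: "AE x in MY. \<iota> (z *\<^sub>C v) x = z * \<iota> v x"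
  and \<iota>_inj: "AE x in MY. \<iota> v x = 0 \<Longrightarrow> v = 0"
  and \<iota>_const: "\<exists>v. AE x in MY. \<iota> v x = z"
  using function_space by (auto simp: Linf_function_space_def Linf_def)

lemma \<iota>_le: "AE x in MY. cmod (\<iota> v x) \<le> norm v"
  using esssup_AE[of "\<lambda>x. ereal (cmod (\<iota> v x))" MY]
proof eventually_elim
  case (elim x)
  then have "ereal (cmod (\<iota> v x)) \<le> ereal (norm v)"
    using Linf_norm_le[of v] unfolding Linf_norm_def by (rule order_trans)
  then show ?case by simp
qed

lemma indicator_measurable: "B \<in> sets M \<Longrightarrow> (indicator B :: 'a \<Rightarrow> complex) \<in> borel_measurable MY"
  by (intro measurable_restrict_space1) simp

lemma indicator_Linf: "B \<in> sets M \<Longrightarrow> (indicator B :: 'a \<Rightarrow> complex) \<in> Linf MY"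
proof -
  assume B: "B \<in> sets M"
  note [measurable] = indicator_measurable[OF B]
  have "esssup MY (\<lambda>x. ereal (cmod (indicator B x))) \<le> 1"
  proof (rule esssup_I)
    show "(\<lambda>x. ereal (cmod (indicator B x))) \<in> borel_measurable MY" by measurable
  qed (auto simp: indicator_def)
  then have "Linf_norm MY (indicator B) < \<infinity>"
    unfolding Linf_norm_def by (rule le_less_trans) simp
  then show ?thesis using indicator_measurable[OF B] by (simp add: Linf_def)
qed

text \<open>The test set \<open>B\<close> ranges over the whole space since preimages under powers
  of \<open>f\<close> need not lie in Y; only its part in Y contributes.\<close>

definition pair :: "'a set \<Rightarrow> 'b \<Rightarrow> complex" where
  "pair B v = (\<integral>y. \<iota> v y * indicator B y \<partial>MY)"

lemma \<iota>_integrable: "integrable MY (\<iota> v)"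
  by (rule MY.integrable_const_bound[OF \<iota>_le \<iota>_measurable])

lemma pair_integrable: "B \<in> sets M \<Longrightarrow> integrable MY (\<lambda>y. \<iota> v y * indicator B y)"
proof (rule MY.integrable_const_bound)
  show "AE x in MY. cmod (\<iota> v x * indicator B x) \<le> norm v"
    using \<iota>_le[of v] by eventually_elim (auto simp: indicator_def)
qed (use indicator_measurable in measurable)

lemma pair_add: "B \<in> sets M \<Longrightarrow> pair B (v + w) = pair B v + pair B w"
proof -
  assume B: "B \<in> sets M"
  note [measurable] = indicator_measurable[OF B]
  have "pair B (v + w) = (\<integral>y. \<iota> v y * indicator B y + \<iota> w y * indicator B y \<partial>MY)"
    unfolding pair_def
  proof (rule integral_cong_AE)
    show "AE y in MY. \<iota> (v + w) y * indicator B y = \<iota> v y * indicator B y + \<iota> w y * indicator B y"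
      using \<iota>_add[of v w] by eventually_elim (simp add: distrib_right)
  qed measurable
  then show ?thesis using pair_integrable[OF B] by (simp add: pair_def)
qed

lemma pair_scaleC: "B \<in> sets M \<Longrightarrow> pair B (z *\<^sub>C v) = z * pair B v"
proof -
  assume B: "B \<in> sets M"
  note [measurable] = indicator_measurable[OF B]
  have "pair B (z *\<^sub>C v) = (\<integral>y. z * (\<iota> v y * indicator B y) \<partial>MY)"
    unfolding pair_def
  proof (rule integral_cong_AE)
    show "AE y in MY. \<iota> (z *\<^sub>C v) y * indicator B y = z * (\<iota> v y * indicator B y)"
      using \<iota>_scaleC[of z v] by eventually_elim simp
  qed measurable
  then show ?thesis by (simp add: pair_def)
qed

lemma pair_le: "B \<in> sets M \<Longrightarrow> cmod (pair B v) \<le> norm v * measure MY (B \<inter> Y)"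
proof -
  assume B: "B \<in> sets M"
  have ind: "integrable MY (\<lambda>y. norm v * indicator (B \<inter> Y) y)"
    using Int_Y_sets[OF B] by (intro integrable_mult_right) (simp add: MY.emeasure_finite less_top[symmetric])
  have "cmod (pair B v) \<le> (\<integral>y. cmod (\<iota> v y * indicator B y) \<partial>MY)"
    unfolding pair_def by (rule integral_norm_bound)
  also have "\<dots> \<le> (\<integral>y. norm v * indicator (B \<inter> Y) y \<partial>MY)"
  proof (rule integral_mono_AE[OF integrable_norm[OF pair_integrable[OF B]] ind])
    show "AE y in MY. cmod (\<iota> v y * indicator B y) \<le> norm v * indicator (B \<inter> Y) y"
      using \<iota>_le[of v] AE_space by eventually_elim (auto simp: indicator_def)
  qed
  also have "\<dots> = norm v * measure MY (B \<inter> Y)" using Int_Y_sets[OF B] by (simp add: Int_absorb2)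
  finally show ?thesis .
qed

lemma pair_bounded_linear: "B \<in> sets M \<Longrightarrow> bounded_linear (pair B)"
proof (rule bounded_linear_intro[where K = 1])
  fix v and r :: real assume B: "B \<in> sets M"
  show "pair B (r *\<^sub>R v) = r *\<^sub>R pair B v"
    using pair_scaleC[OF B, of "of_real r" v] by (simp add: scaleR_scaleC scaleR_conv_of_real)
  show "cmod (pair B v) \<le> norm v * 1"
    by (rule order_trans[OF pair_le[OF B]]) (intro mult_left_mono MY.prob_le_1 norm_ge_zero)
qed (rule pair_add)

text \<open>A function whose integrals over all measurable sets vanish is null, and \<iota> is
  injective modulo null sets. Identities in the Banach space may therefore be checked on
  integrals.\<close>

lemma pair_eqI:
  assumes "\<And>A. A \<in> sets MY \<Longrightarrow> pair A v = pair A w"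
  shows "v = w"
proof -
  have "AE y in MY. \<iota> (v - w) y = 0"
  proof (rule MY.density_zero)
    fix A assume A: "A \<in> sets MY"
    then have "A \<in> sets M" by (simp add: sets_MY)
    from linear_diff[OF bounded_linear.linear[OF pair_bounded_linear[OF this]], of v w] assms[OF A]
    have "pair A (v - w) = 0" by simp
    then show "set_lebesgue_integral MY A (\<iota> (v - w)) = 0"
      by (simp add: pair_def set_lebesgue_integral_def scaleR_conv_of_real mult.commute of_real_indicator)
  qed (rule \<iota>_integrable)
  then show ?thesis using \<iota>_inj by fastforce
qed

lemma level_preimage_sets: "B \<in> sets M \<Longrightarrow> level k \<inter> preimage n B \<in> sets M"
  using level_sets[of k] preimage_sets[of B n] by (auto simp: sets_MY)

text \<open>Duality moves the operator onto the test set, and on \<open>level k\<close> the return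
  map is the power \<open>Suc k\<close> of \<open>f\<close>.\<close>

lemma pair_Rn:
  assumes B: "B \<in> sets M"
  shows "pair B (Rn (Suc k) v) = pair (level k \<inter> preimage (Suc k) B) v"
proof -
  let ?u = "\<lambda>y. indicator {y. return_time f Y y = enat (Suc k)} y * \<iota> v y"
  have u_eq: "?u y = \<iota> v y * indicator (level k) y" if "y \<in> space MY" for y
    using that by (auto simp: level_def indicator_def)
  have u: "integrable MY ?u"
    using pair_integrable[of "level k" v] level_sets[of k]
    by (subst Bochner_Integration.integrable_cong[OF refl u_eq]) (auto simp: sets_MY)
  have Ru: "integrable MY (R ?u)" "(\<integral>y. R ?u y * w y \<partial>MY) = (\<integral>y. ?u y * w (return_map f Y y) \<partial>MY)"
    if "w \<in> Linf MY" for w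
    using R u that unfolding transfer_operator_def by blast+
  note [measurable] = indicator_measurable[OF B] borel_measurable_integrable[OF Ru(1)[OF indicator_Linf[OF B]]]
  have "pair B (Rn (Suc k) v) = (\<integral>y. R ?u y * indicator B y \<partial>MY)"
    unfolding pair_def
  proof (rule integral_cong_AE)
    have "AE y in MY. \<iota> (Rn (Suc k) v) y = R ?u y"
      using Rn[of "Suc k"] by (auto simp: induces_operator_def level_operator_def)
    then show "AE y in MY. \<iota> (Rn (Suc k) v) y * indicator B y = R ?u y * indicator B y"
      by eventually_elim simp
  qed measurable
  also have "\<dots> = (\<integral>y. ?u y * indicator B (return_map f Y y) \<partial>MY)"
    by (rule Ru(2)[OF indicator_Linf[OF B]])
  also have "\<dots> = pair (level k \<inter> preimage (Suc k) B) v"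
    unfolding pair_def
  proof (rule Bochner_Integration.integral_cong[OF refl])
    fix y assume y: "y \<in> space MY"
    show "?u y * indicator B (return_map f Y y) = \<iota> v y * indicator (level k \<inter> preimage (Suc k) B) y"
    proof (cases "y \<in> level k")
      case True
      then have "return_map f Y y = (f ^^ Suc k) y" by (rule return_map_level)
      then show ?thesis using u_eq[OF y] True y Y_space
        by (auto simp: indicator_def preimage_def simp del: funpow.simps)
    qed (simp add: u_eq[OF y])
  qed
  finally show ?thesis .
qed

text \<open>The duality for \<open>R\<close> against an indicator, split over the levels. The
  \<open>k\<close>-th term is at most \<open>norm v * p k\<close>, so sum and integral
  commute.\<close>

lemma pair_RB:
  assumes B: "B \<in> sets M"
  shows "(\<lambda>k. pair (level k \<inter> preimage (Suc k) B) v) sums pair B (RB v)"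
proof -
  have RB_AE: "AE y in MY. \<iota> (RB v) y = R (\<iota> v) y" using RB by (auto simp: induces_operator_def)
  have Rv: "integrable MY (R (\<iota> v))" "(\<integral>y. R (\<iota> v) y * indicator B y \<partial>MY) = (\<integral>y. \<iota> v y * indicator B (return_map f Y y) \<partial>MY)"
    using R \<iota>_integrable indicator_Linf[OF B] unfolding transfer_operator_def by blast+
  note [measurable] = indicator_measurable[OF B] borel_measurable_integrable[OF Rv(1)]
  \<comment> \<open>The preimage of \<open>B\<close> under the return map, written so as to be
    visibly measurable. The last part consists of the points that never return, where the map is the
    identity by convention.\<close>
  define F where "F = (\<Union>k. level k \<inter> preimage (Suc k) B) \<union> ((Y - (\<Union>k. level k)) \<inter> B)"
  have F_sets: "F \<in> sets M"
  proof -
    have "(\<Union>k. level k) \<in> sets M" using level_sets by (intro sets.countable_UN) (auto simp: sets_MY)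
    moreover have "(\<Union>k. level k \<inter> preimage (Suc k) B) \<in> sets M"
      using level_preimage_sets[OF B] by (intro sets.countable_UN) auto
    ultimately show ?thesis using Y_sets B by (auto simp: F_def)
  qed
  have F: "return_map f Y y \<in> B \<longleftrightarrow> y \<in> F" if "y \<in> Y" for y
  proof (cases "\<exists>k. y \<in> level k")
    case True
    then obtain k where k: "y \<in> level k" ..
    then have "y \<in> level j \<longleftrightarrow> j = k" for j using disjoint_level[of j k] by auto
    then show ?thesis using that Y_space return_map_level[OF k] by (auto simp: F_def preimage_def simp del: funpow.simps)
  next
    case False
    have "return_time f Y y = \<infinity>"
    proof (rule ccontr)
      assume "return_time f Y y \<noteq> \<infinity>"
      then obtain n where n: "return_time f Y y = enat n" by auto
      moreover have "enat 0 < return_time f Y y" by (simp add: less_return_time_iff)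
      ultimately obtain k where "n = Suc k" by (cases n) auto
      then show False using n False that by (auto simp: level_def)
    qed
    then show ?thesis using False that by (auto simp: F_def return_map_def)
  qed
  define g where "g k y = \<iota> v y * indicator (level k \<inter> preimage (Suc k) B) y" for k y
  have AE_g: "AE y in MY. (\<lambda>k. g k y) sums (\<iota> v y * indicator F y) \<and> summable (\<lambda>k. norm (g k y))"
    using AE_level
  proof eventually_elim
    case (elim y)
    then obtain k where k: "y \<in> level k" ..
    then have *: "y \<in> level j \<longleftrightarrow> j = k" for j using disjoint_level[of j k] by auto
    have "indicator F y = (indicator (level k \<inter> preimage (Suc k) B) y :: complex)"
      using k by (auto simp: indicator_def F_def *)
    moreover have g: "g j y = (if j = k then g k y else 0)" for j by (auto simp: g_def *)
    have "(\<lambda>j. g j y) sums g k y"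
      by (rule iffD2[OF sums_cong[OF g] sums_single])
    moreover have ng: "norm (g j y) = (if j = k then norm (g k y) else 0)" for j using g[of j] by simp
    have "summable (\<lambda>j. norm (g j y))"
      by (rule sums_summable[OF iffD2[OF sums_cong[OF ng] sums_single]])
    ultimately show ?case by (simp add: g_def[of k])
  qed
  have g_int: "integrable MY (g k)" for k
    unfolding g_def by (rule pair_integrable[OF level_preimage_sets[OF B]])
  have "(\<lambda>k. \<integral>y. g k y \<partial>MY) sums (\<integral>y. (\<Sum>k. g k y) \<partial>MY)"
  proof (rule sums_integral[OF g_int])
    show "AE y in MY. summable (\<lambda>k. norm (g k y))" using AE_g by eventually_elim simp
    show "summable (\<lambda>k. \<integral>y. norm (g k y) \<partial>MY)"
    proof (rule summable_comparison_test')
      show "summable (\<lambda>k. norm v * p k)" using p_sums by (intro summable_mult) (rule sums_summable)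
      fix k :: nat
      have lv: "integrable MY (\<lambda>y. norm v * indicator (level k) y)"
        using level_sets[of k] by (intro integrable_mult_right) (simp add: MY.emeasure_finite less_top[symmetric])
      have "(\<integral>y. norm (g k y) \<partial>MY) \<le> (\<integral>y. norm v * indicator (level k) y \<partial>MY)"
      proof (rule integral_mono_AE[OF integrable_norm[OF g_int] lv])
        show "AE y in MY. norm (g k y) \<le> norm v * indicator (level k) y"
          using \<iota>_le[of v] by eventually_elim (auto simp: g_def indicator_def)
      qed
      also have "\<dots> = norm v * p k" using level_sets[of k] level_subset[of k] by (simp add: p_def Int_absorb2)
      finally show "norm (\<integral>y. norm (g k y) \<partial>MY) \<le> norm v * p k" by simp
    qed
  qed
  moreover have "(\<integral>y. (\<Sum>k. g k y) \<partial>MY) = (\<integral>y. \<iota> v y * indicator F y \<partial>MY)"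
  proof (rule integral_cong_AE)
    show "AE y in MY. (\<Sum>k. g k y) = \<iota> v y * indicator F y"
      using AE_g by eventually_elim (auto simp: sums_iff)
    show "(\<lambda>y. \<Sum>k. g k y) \<in> borel_measurable MY"
      using g_int by (intro borel_measurable_suminf) auto
    show "(\<lambda>y. \<iota> v y * indicator F y) \<in> borel_measurable MY"
      using indicator_measurable[OF F_sets] by measurable
  qed
  moreover have "(\<integral>y. \<iota> v y * indicator F y \<partial>MY) = pair B (RB v)"
  proof -
    have "(\<integral>y. \<iota> v y * indicator F y \<partial>MY) = (\<integral>y. \<iota> v y * indicator B (return_map f Y y) \<partial>MY)"
      using F by (intro Bochner_Integration.integral_cong) (auto simp: indicator_def)
    also have "\<dots> = (\<integral>y. R (\<iota> v) y * indicator B y \<partial>MY)" by (rule Rv(2)[symmetric])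
    also have "\<dots> = pair B (RB v)"
      unfolding pair_def
    proof (rule integral_cong_AE)
      show "AE y in MY. R (\<iota> v) y * indicator B y = \<iota> (RB v) y * indicator B y"
        using RB_AE by eventually_elim simp
    qed measurable
    finally show ?thesis .
  qed
  ultimately show ?thesis by (simp add: g_def pair_def)
qed

definition e :: 'b where "e = (SOME v. AE x in MY. \<iota> v x = 1)"

lemma \<iota>_e: "AE x in MY. \<iota> e x = 1"
  unfolding e_def by (rule someI_ex[OF \<iota>_const])

lemma pair_e: "B \<in> sets M \<Longrightarrow> pair B e = complex_of_real (measure MY (B \<inter> Y))"
proof -
  assume B: "B \<in> sets M"
  note [measurable] = indicator_measurable[OF B]
  have "pair B e = (\<integral>y. indicator (B \<inter> Y) y \<partial>MY)"
    unfolding pair_def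
  proof (rule integral_cong_AE)
    show "AE y in MY. \<iota> e y * indicator B y = indicator (B \<inter> Y) y"
      using \<iota>_e AE_space by eventually_elim (simp add: indicator_def)
    show "(indicator (B \<inter> Y) :: 'a \<Rightarrow> complex) \<in> borel_measurable MY"
      using B Y_sets by (intro indicator_measurable) auto
  qed measurable
  also have "\<dots> = (\<integral>y. complex_of_real (indicator (B \<inter> Y) y) \<partial>MY)" by (simp add: of_real_indicator)
  also have "\<dots> = complex_of_real (\<integral>y. indicator (B \<inter> Y) y \<partial>MY)" by (rule integral_complex_of_real)
  finally show ?thesis using Int_Y_sets[OF B] by (simp add: Int_absorb2)
qed

text \<open>Summability of the norms makes the series converge in the Banach space; its limit is
  identified with \<open>RB v\<close> by testing on sets, where only convergence of integrals is
  known.\<close>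

lemma Q_sums: "(\<lambda>k. Rn (Suc k) v) sums RB v"
proof -
  have "summable (\<lambda>k. Rn (Suc k))" using Rn_summable by (rule summable_norm_cancel)
  from bounded_linear.summable[OF blinfun.bounded_linear_left this]
  have s: "summable (\<lambda>k. Rn (Suc k) v)" .
  have "(\<Sum>k. Rn (Suc k) v) = RB v"
  proof (rule pair_eqI)
    fix A assume "A \<in> sets MY"
    then have A: "A \<in> sets M" by (simp add: sets_MY)
    show "pair A (\<Sum>k. Rn (Suc k) v) = pair A (RB v)"
      using bounded_linear.sums[OF pair_bounded_linear[OF A] summable_sums[OF s]] pair_RB[OF A, of v]
      by (simp add: pair_Rn[OF A] sums_unique2)
  qed
  then show ?thesis using summable_sums[OF s] by simp
qed

lemma pair_level_e: "B \<in> sets M \<Longrightarrow> pair (level k \<inter> preimage (Suc k) B) e = complex_of_real (measure MY (level k \<inter> preimage (Suc k) B))"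
  using pair_e[OF level_preimage_sets, of B k "Suc k"] level_subset[of k]
  by (simp add: Int_absorb2 le_infI1)

text \<open>Dual to the invariance of the measure on Y under the first return map, as expressed by
  \<open>measure_return_sums\<close>.\<close>

lemma RB_e: "RB e = e"
proof (rule pair_eqI)
  fix A assume "A \<in> sets MY"
  then have A: "A \<in> sets M" "A \<subseteq> Y" by (simp_all add: sets_MY)
  have "(\<lambda>k. pair (level k \<inter> preimage (Suc k) A) e) sums complex_of_real (measure MY A)"
    using sums_of_real[OF measure_return_sums[OF A], where 'a = complex] by (simp add: pair_level_e[OF A(1)])
  then show "pair A (RB e) = pair A e"
    using pair_RB[OF A(1), of e] pair_e[OF A(1)] A(2) by (simp add: sums_unique2 Int_absorb2)
qed

text \<open>The type of bounded operators records real linearity only; complex linearity is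
  recovered from the linearity of the integrals in \<open>pair_RB\<close>.\<close>

lemma RB_scaleC: "RB (z *\<^sub>C v) = z *\<^sub>C RB v"
proof (rule pair_eqI)
  fix A assume "A \<in> sets MY"
  then have A: "A \<in> sets M" by (simp add: sets_MY)
  have "(\<lambda>k. z * pair (level k \<inter> preimage (Suc k) A) v) sums (z * pair A (RB v))"
    by (intro sums_mult pair_RB A)
  then show "pair A (RB (z *\<^sub>C v)) = pair A (z *\<^sub>C RB v)"
    using pair_RB[OF A, of "z *\<^sub>C v"] by (simp add: pair_scaleC A level_preimage_sets sums_unique2)
qed

lemma pair_Y: "pair Y v = (\<integral>y. \<iota> v y \<partial>MY)"
  unfolding pair_def by (rule Bochner_Integration.integral_cong) auto

lemma pair_Y_RB: "pair Y (RB v) = pair Y v"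
proof -
  have "emeasure MY (space MY) \<noteq> 0" using MY.emeasure_space_1 by simp
  then have "Linf_norm MY (\<lambda>_. 1) < \<infinity>" by (simp add: Linf_norm_def esssup_const)
  then have one: "(\<lambda>_. 1) \<in> Linf MY" by (simp add: Linf_def)
  have "integrable MY (R (\<iota> v)) \<and> (\<integral>y. R (\<iota> v) y * w y \<partial>MY) = (\<integral>y. \<iota> v y * w (return_map f Y y) \<partial>MY)"
    if "w \<in> Linf MY" for w
    using R \<iota>_integrable that unfolding transfer_operator_def by blast
  from this[OF one]
  have Rv: "integrable MY (R (\<iota> v))" "(\<integral>y. R (\<iota> v) y * 1 \<partial>MY) = (\<integral>y. \<iota> v y * 1 \<partial>MY)"
    by simp_all
  have "(\<integral>y. \<iota> (RB v) y \<partial>MY) = (\<integral>y. R (\<iota> v) y \<partial>MY)"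
  proof (rule integral_cong_AE)
    show "AE y in MY. \<iota> (RB v) y = R (\<iota> v) y" using RB by (simp add: induces_operator_def)
  qed (use borel_measurable_integrable[OF Rv(1)] in simp_all)
  then show ?thesis using Rv(2) by (simp add: pair_Y)
qed

lemma p_nonneg: "0 \<le> p k" by (simp add: p_def)

text \<open>The integral over Y serves as invariant functional for the reduced resolvent. The latter
  comes from an existence statement, hence the quantifier over \<open>S\<close>.\<close>

lemma operator_renewal_exists: "\<exists>S. operator_renewal (\<lambda>k. Rn (Suc k)) RB S (pair Y) e p"
proof -
  obtain S :: "'b \<Rightarrow>\<^sub>L 'b" where S: "\<And>v. S v - RB (S v) = v - pair Y v *\<^sub>C e"
  proof (rule reduced_resolvent[of RB e "pair Y"])
    show "pair Y e = 1" using pair_e[OF Y_sets] MY.prob_space by simp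
  qed (auto simp: RB_scaleC simple RB_e pair_bounded_linear Y_sets pair_scaleC pair_Y_RB)
  have "operator_renewal (\<lambda>k. Rn (Suc k)) RB S (pair Y) e p"
  proof
    show "cmod (pair Y v) \<le> norm v" for v
      using pair_le[OF Y_sets, of v] MY.prob_space by simp
    show "pair Y e = 1" using pair_e[OF Y_sets] MY.prob_space by simp
    show "cmod (pair Y (Rn (Suc k) v)) \<le> p k * norm v" for k v
      using pair_le[of "level k" v] level_sets[of k] level_subset[of k]
      by (simp add: pair_Rn[OF Y_sets] level_preimage_Y p_def sets_MY Int_absorb2 mult.commute)
    show "pair Y (Rn (Suc k) e) = complex_of_real (p k)" for k
      using pair_level_e[OF Y_sets, of k] by (simp add: pair_Rn[OF Y_sets] level_preimage_Y p_def)
  qed (auto simp: Rn_summable Q_sums RB_e S pair_add pair_scaleC Y_sets p_nonneg p_sums)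
  then show ?thesis by blast
qed

text \<open>By duality this is the average over \<open>A\<close> of L^n applied to the zero
  extension of v, written without reference to \<open>L\<close>.\<close>

definition average :: "'a set \<Rightarrow> nat \<Rightarrow> 'b \<Rightarrow> complex" where
  "average A n v = pair (preimage n A) v / complex_of_real (measure MY A)"

text \<open>A point of Y that lies in \<open>A\<close> at time \<open>n + 1\<close> has returned to
  Y by then, so the levels \<open>k \<le> n\<close> partition the relevant points. On
  \<open>level k\<close>, \<open>pair_Rn\<close> absorbs the first \<open>k + 1\<close> steps and
  leaves \<open>n - k\<close>.\<close>

lemma average_renewal:
  assumes A: "A \<in> sets MY"
  shows "average A (Suc n) v = (\<Sum>k\<le>n. average A (n - k) (Rn (Suc k) v))"
proof -
  have A': "A \<in> sets M" "A \<subseteq> Y" using A by (simp_all add: sets_MY)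
  let ?B = "preimage (Suc n) A"
  have "(\<Sum>k\<le>n. pair (preimage (n - k) A) (Rn (Suc k) v)) = (\<Sum>k\<le>n. pair (level k \<inter> ?B) v)"
  proof (rule sum.cong[OF refl])
    fix k assume "k \<in> {..n}"
    then have "preimage (Suc k) (preimage (n - k) A) = ?B" by (simp add: preimage_add)
    then show "pair (preimage (n - k) A) (Rn (Suc k) v) = pair (level k \<inter> ?B) v"
      by (simp add: pair_Rn preimage_sets A'(1))
  qed
  also have "\<dots> = (\<integral>y. (\<Sum>k\<le>n. \<iota> v y * indicator (level k \<inter> ?B) y) \<partial>MY)"
    unfolding pair_def
    by (rule Bochner_Integration.integral_sum[symmetric]) (rule pair_integrable[OF level_preimage_sets[OF A'(1)]])
  also have "\<dots> = pair ?B v"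
    unfolding pair_def
  proof (rule Bochner_Integration.integral_cong[OF refl])
    fix y assume "y \<in> space MY"
    then have y: "y \<in> Y" by simp
    show "(\<Sum>k\<le>n. \<iota> v y * indicator (level k \<inter> ?B) y) = \<iota> v y * indicator ?B y"
    proof (cases "y \<in> ?B")
      case True
      then have "(f ^^ Suc n) y \<in> Y" using A'(2) by (auto simp: preimage_def simp del: funpow.simps)
      then have "\<not> enat (Suc n) < return_time f Y y" by (auto simp: less_return_time_iff simp del: funpow.simps)
      then obtain m where m: "return_time f Y y = enat m" "m \<le> Suc n"
        by (cases "return_time f Y y") auto
      moreover have "enat 0 < return_time f Y y" by (simp add: less_return_time_iff)
      ultimately obtain k where k: "m = Suc k" "k \<le> n" by (cases m) auto
      then have yk: "y \<in> level k" using m y by (simp add: level_def)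
      then have "y \<in> level j \<longleftrightarrow> j = k" for j using disjoint_level[of j k] by auto
      then have "(\<Sum>j\<le>n. \<iota> v y * indicator (level j \<inter> ?B) y) = (\<Sum>j\<le>n. if j = k then \<iota> v y else 0)"
        using True by (intro sum.cong) (auto simp: indicator_def)
      then show ?thesis using True k by simp
    qed (simp add: indicator_def)
  qed
  finally show ?thesis by (simp add: average_def flip: sum_divide_distrib)
qed

text \<open>All bounds are free of \<open>A\<close>: an integral of v over \<open>B\<close> is at
  most \<open>norm v\<close> times the measure of its part in Y, and invariance of the full measure
  gives the preimage of \<open>A\<close> no more mass in Y than \<open>A\<close> has. The averages
  of \<open>e\<close> are the nonnegative majorant for the Tauberian theorem.\<close>

lemma average_renewal_sequence:
  assumes S: "operator_renewal (\<lambda>k. Rn (Suc k)) RB S (pair Y) e p"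
    and A: "A \<in> sets MY" "measure MY A > 0"
  shows "operator_renewal.renewal_sequence (\<lambda>k. Rn (Suc k)) e (average A)"
    and "\<And>n. average A n e = complex_of_real (Re (average A n e))"
    and "\<And>n. 0 \<le> Re (average A n e)" and "\<And>n. Re (average A n e) \<le> 1"
    and "\<And>n v. cmod (average A n v) \<le> norm v * Re (average A n e)"
proof -
  interpret operator_renewal "\<lambda>k. Rn (Suc k)" RB S "pair Y" e p by (rule S)
  have A': "A \<in> sets M" "A \<subseteq> Y" using A by (simp_all add: sets_MY)
  have pre: "preimage n A \<in> sets M" for n by (rule preimage_sets[OF A'(1)])
  have e: "average A n e = complex_of_real (measure MY (preimage n A \<inter> Y) / measure MY A)" for n
    by (simp add: average_def pair_e[OF pre])
  show e1: "average A n e = complex_of_real (Re (average A n e))" "0 \<le> Re (average A n e)" for n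
    by (simp_all add: e)
  show e2: "Re (average A n e) \<le> 1" for n
  proof -
    have "emeasure M (preimage n A \<inter> Y) \<le> emeasure M (preimage n A)"
      by (rule emeasure_mono) (use pre in auto)
    then have "emeasure MY (preimage n A \<inter> Y) \<le> emeasure MY A"
      using A' by (simp add: emeasure_preimage emeasure_MY)
    then have "measure MY (preimage n A \<inter> Y) \<le> measure MY A"
      by (simp add: MY.emeasure_eq_measure)
    then show ?thesis using A(2) by (simp add: e)
  qed
  show le: "cmod (average A n v) \<le> norm v * Re (average A n e)" for n v
    using divide_right_mono[OF pair_le[OF pre[of n], of v], of "measure MY A"] A(2)
    by (simp add: average_def[of A n v] norm_divide e)
  show "renewal_sequence (average A)"
    unfolding renewal_sequence_def
  proof (intro conjI allI)
    show "cmod (average A n v) \<le> norm v" for n v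
      using order_trans[OF le[of n v] mult_left_mono[OF e2[of n] norm_ge_zero[of v]]] by simp
    show "average A 0 e = 1"
    proof -
      have "preimage 0 A \<inter> Y = A" using A' Y_space by (auto simp: preimage_def)
      then show ?thesis using A(2) by (simp add: e)
    qed
    show "average A (Suc n) v = (\<Sum>k\<le>n. average A (n - k) (Rn (Suc k) v))" for n v
      by (rule average_renewal[OF A(1)])
  qed (simp_all add: average_def pair_add pair_scaleC pre add_divide_distrib)
qed

end

section \<open>Pointwise dual ergodicity\<close>

context first_return
begin

text \<open>Summation by parts with \<open>p k = c k - c (k + 1)\<close>; the boundary term
  \<open>c 0 = 1\<close> cancels the total mass of \<open>p\<close>.\<close>

lemma transform_p_sums:
  assumes u: "u > 0"
  shows "(\<lambda>k. (1 - exp (- (u * real (Suc k)))) * p k) sums ((1 - exp (- u)) * (\<Sum>j. exp (- u * real j) * c j))"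
proof -
  have c_bound: "norm (c j) \<le> 1" for j
    using decseqD[OF c_decseq, of 0 j] by (simp add: c_0) (simp add: c_def)
  define G where "G = (\<Sum>j. exp (- u * real j) * c j)"
  have G: "(\<lambda>j. exp (- u * real j) * c j) sums G"
    using summable_sums[OF summable_exp_bounded[OF c_bound u]] by (simp add: G_def)
  have 1: "(\<lambda>k. exp (- u) * (exp (- u * real k) * c k)) sums (exp (- u) * G)"
    by (rule sums_mult[OF G])
  have "(\<lambda>k. exp (- u * real (Suc k)) * c (Suc k)) sums (G - exp (- u * real 0) * c 0)"
    using G by (subst sums_Suc_iff) simp
  then have 2: "(\<lambda>k. exp (- u * real (Suc k)) * c (Suc k)) sums (G - 1)" by (simp add: c_0)
  have "(\<lambda>k. p k - exp (- u) * (exp (- u * real k) * c k) + exp (- u * real (Suc k)) * c (Suc k)) sums (1 - exp (- u) * G + (G - 1))"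
    by (intro sums_add sums_diff p_sums 1 2)
  moreover have "p k - exp (- u) * (exp (- u * real k) * c k) + exp (- u * real (Suc k)) * c (Suc k) = (1 - exp (- (u * real (Suc k)))) * p k" for k
  proof -
    have "exp (- (u * real (Suc k))) = exp (- u) * exp (- u * real k)"
      by (simp add: mult_exp_exp algebra_simps)
    moreover have "exp (- u * real (Suc k)) = exp (- (u * real (Suc k)))" by simp
    ultimately show ?thesis by (simp only: p_eq) (simp only: algebra_simps)
  qed
  ultimately show ?thesis by (simp only: G_def[symmetric]) (simp add: algebra_simps)
qed

lemma return_time_measurable: "return_time f Y \<in> measurable MY (count_space UNIV)"
proof (subst measurable_count_space_eq2_countable, safe)
  fix a :: enat
  show "return_time f Y -` {a} \<inter> space MY \<in> sets MY"
  proof (cases a)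
    case (enat n)
    show ?thesis
    proof (cases n)
      case 0
      have "enat 0 < return_time f Y y" for y by (simp add: less_return_time_iff)
      then have "return_time f Y -` {a} \<inter> space MY = {}" using enat 0 by (metis (no_types, lifting) disjoint_iff less_irrefl vimage_singleton_eq)
      then show ?thesis by simp
    next
      case (Suc k)
      then have "return_time f Y -` {a} \<inter> space MY = level k" using enat by (auto simp: level_def)
      then show ?thesis using level_sets by simp
    qed
  next
    case infinity
    have *: "(\<forall>n. enat n < x) \<longleftrightarrow> x = \<infinity>" for x :: enat by (cases x) auto
    have "return_time f Y -` {a} \<inter> space MY = (\<Inter>n. tail n)"
      by (auto simp: infinity tail_def simp flip: *)
    then show ?thesis using tail_sets by auto
  qed
qed auto

text \<open>The integral of an integer-valued function is the sum of the measures of its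
  tails.\<close>

lemma c_not_summable:
  assumes "(\<integral>\<^sup>+ y. ennreal_of_enat (return_time f Y y) \<partial>MY) = \<infinity>"
  shows "\<not> summable c"
proof
  assume "summable c"
  then have "(\<Sum>n. ennreal (c n)) \<noteq> top" by (rule ennreal_suminf_neq_top) (simp add: c_def)
  moreover have "(\<integral>\<^sup>+ y. ennreal_of_enat (return_time f Y y) \<partial>MY) = (\<Sum>n. ennreal (c n))"
    unfolding nn_integral_enat_function[OF return_time_measurable]
    by (simp add: c_def tail_def MY.emeasure_eq_measure)
  ultimately show False using assms by simp
qed

lemma regularly_varying_tail_c:
  assumes sv: "slowly_varying l" and b: "0 \<le> \<beta>" "\<beta> \<le> 1"
    and c: "\<And>n. n \<ge> 1 \<Longrightarrow> c n = l (real n) * real n powr (- \<beta>)"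
    and inf: "(\<integral>\<^sup>+ y. ennreal_of_enat (return_time f Y y) \<partial>MY) = \<infinity>"
  shows "regularly_varying_tail c \<beta>"
proof
  obtain a where a: "\<And>x. x \<ge> a \<Longrightarrow> l x > 0" using sv by (auto simp: slowly_varying_def)
  have big: "c n > 0" if "real n \<ge> a" "n \<ge> 1" for n
    using a[OF that(1)] that(2) by (simp add: c)
  show "0 < c n" for n
  proof -
    \<comment> \<open>\<open>l\<close> is known to be positive only from \<open>a\<close> on; an
      index beyond both \<open>n\<close> and \<open>a\<close> gives positivity at \<open>n\<close>
      because \<open>c\<close> decreases.\<close>
    define m where "m = max n (max 1 (nat \<lceil>a\<rceil>))"
    have "real m \<ge> a" "m \<ge> 1" "n \<le> m" by (auto simp: m_def le_max_iff_disj) linarith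
    then show ?thesis using big[of m] decseqD[OF c_decseq, of n m] by simp
  qed
  show "(\<lambda>n. c (k * n) / c n) \<longlonglongrightarrow> real k powr (- \<beta>)" if k: "k \<ge> 1" for k
  proof -
    have "((\<lambda>x. l (real k * x) / l x) \<longlongrightarrow> 1) at_top"
      using sv k by (auto simp: slowly_varying_def)
    from filterlim_compose[OF this filterlim_real_sequentially]
    have "(\<lambda>n. l (real k * real n) / l (real n) * real k powr (- \<beta>)) \<longlonglongrightarrow> 1 * real k powr (- \<beta>)"
      by (intro tendsto_mult tendsto_const)
    then have "(\<lambda>n. l (real k * real n) / l (real n) * real k powr (- \<beta>)) \<longlonglongrightarrow> real k powr (- \<beta>)"
      by (simp only: mult_1)
    then show ?thesis
    proof (rule Lim_transform_eventually)
      show "\<forall>\<^sub>F n in sequentially. l (real k * real n) / l (real n) * real k powr (- \<beta>) = c (k * n) / c n"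
        by (rule eventually_sequentiallyI[of 1]) (use k in \<open>simp add: c powr_mult\<close>)
    qed
  qed
qed (simp_all add: c_decseq c_0 c_not_summable inf b)

text \<open>Each application of \<open>L\<close> is traded for one more preimage of the test set, so
  the induction needs \<open>B\<close> arbitrary.\<close>

lemma transfer_powers:
  assumes L: "transfer_operator M f L" and u: "integrable M u" and B: "B \<in> sets M"
  shows "integrable M ((L ^^ n) u) \<and> (\<integral>x. (L ^^ n) u x * indicator B x \<partial>M) = (\<integral>x. u x * indicator (preimage n B) x \<partial>M)"
  using B
proof (induction n arbitrary: B)
  case 0
  have "(\<integral>x. u x * indicator B x \<partial>M) = (\<integral>x. u x * indicator (preimage 0 B) x \<partial>M)"
    by (rule Bochner_Integration.integral_cong) (auto simp: preimage_def indicator_def)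
  then show ?case using u by simp
next
  case (Suc n)
  define v where "v = (L ^^ n) u"
  have v: "integrable M v" using Suc.IH[OF Suc.prems] by (simp add: v_def)
  have Lv: "integrable M (L v) \<and> (\<integral>x. L v x * w x \<partial>M) = (\<integral>x. v x * w (f x) \<partial>M)" if "w \<in> Linf M" for w
    using L v that unfolding transfer_operator_def by blast
  have "(indicator B :: 'a \<Rightarrow> complex) \<in> Linf M"
  proof -
    have "esssup M (\<lambda>x. ereal (cmod (indicator B x))) \<le> 1"
    proof (rule esssup_I)
      show "(\<lambda>x. ereal (cmod (indicator B x))) \<in> borel_measurable M" using Suc.prems by measurable
    qed (auto simp: indicator_def)
    then have "Linf_norm M (indicator B) < \<infinity>" unfolding Linf_norm_def by (rule le_less_trans) simp
    then show ?thesis using Suc.prems by (simp add: Linf_def)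
  qed
  from Lv[OF this] have LB: "integrable M (L v)" "(\<integral>x. L v x * indicator B x \<partial>M) = (\<integral>x. v x * indicator B (f x) \<partial>M)"
    by simp_all
  note LB(2)
  also have "(\<integral>x. v x * indicator B (f x) \<partial>M) = (\<integral>x. v x * indicator (preimage 1 B) x \<partial>M)"
    by (rule Bochner_Integration.integral_cong) (auto simp: preimage_def indicator_def)
  also have "\<dots> = (\<integral>x. u x * indicator (preimage n (preimage 1 B)) x \<partial>M)"
    unfolding v_def using Suc.IH[OF preimage_sets[OF Suc.prems]] by blast
  finally show ?case using LB(1) by (simp add: preimage_add v_def)
qed

end

lemma uniform_limit_of_tendsto: "(r \<longlongrightarrow> x) F \<Longrightarrow> uniform_limit X (\<lambda>n _. r n) (\<lambda>_. x) F"
  by (auto simp: uniform_limit_iff tendsto_iff elim: eventually_mono)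

lemma uniform_limit_scale:
  fixes r :: "'n \<Rightarrow> real" and g :: "'n \<Rightarrow> 'x \<Rightarrow> 'v::real_normed_vector"
  assumes "(r \<longlongrightarrow> x) F" "uniform_limit X g (\<lambda>_. y) F"
  shows "uniform_limit X (\<lambda>n z. r n *\<^sub>R g n z) (\<lambda>_. x *\<^sub>R y) F"
proof (rule bounded_bilinear.bounded_uniform_limit[OF bounded_bilinear_scaleR uniform_limit_of_tendsto[OF assms(1)] assms(2)])
  show "bounded ((\<lambda>_. y) ` X)" "bounded ((\<lambda>_. x) ` X)" by (auto intro: bounded_subset[of "{_}"])
qed

context renewal_space
begin

definition positive_sets :: "'a set set" where
  "positive_sets = {A \<in> sets MY. measure MY A > 0}"

text \<open>At u = s/n the renewal asymptotics give the transform times a(s/n), and a(s/n) is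
  asymptotic to \<Gamma>(2-\<beta>) s^\<beta> C(n)/n. With s = k+1 the power s^(-\<beta>) is the
  \<open>k\<close>-th exponential moment of the gamma weight.\<close>

lemma laplace_average_limit:
  assumes rv: "regularly_varying_tail c \<beta>"
  shows "uniform_limit positive_sets
      (\<lambda>n A. (regularly_varying_tail.C c n / real n) *\<^sub>R
        (\<Sum>j. exp (- (real (Suc k) / real n * real j)) *\<^sub>R average A j v))
      (\<lambda>A. real (Suc k) powr (- \<beta>) *\<^sub>R (pair Y v /\<^sub>R Gamma (2 - \<beta>))) sequentially"
proof -
  interpret regularly_varying_tail c \<beta> by (rule rv)
  obtain S where ren: "operator_renewal (\<lambda>k. Rn (Suc k)) RB S (pair Y) e p"
    using operator_renewal_exists by blast
  interpret operator_renewal "\<lambda>k. Rn (Suc k)" RB S "pair Y" e p by (rule ren)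
  define s where "s = real (Suc k)"
  have s: "s > 0" by (simp add: s_def)
  have G: "Gamma (2 - \<beta>) > 0" using \<beta>_bounds by (intro Gamma_real_pos) simp
  have u0: "filterlim (\<lambda>n. s / real n) (at_right 0) sequentially"
    using s by real_asymp
  have a_eq: "a u = (1 - exp (- u)) * (\<Sum>j. exp (- u * real j) * c j)" if "u > 0" for u
    using a_sums[of u] transform_p_sums[OF that] that by (simp add: sums_unique2)
  have a_lim: "(\<lambda>n. a (s / real n) / (C n / real n)) \<longlonglongrightarrow> Gamma (2 - \<beta>) * s powr \<beta>"
    using transform_tendsto[OF s]
  proof (rule Lim_transform_eventually)
    show "\<forall>\<^sub>F n in sequentially. (1 - exp (- (s / real n))) * (\<Sum>j. exp (- s / real n * real j) * c j) / (C n / real n) = a (s / real n) / (C n / real n)"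
      by (rule eventually_sequentiallyI[of 1]) (use s in \<open>simp add: a_eq\<close>)
  qed
  have r_lim: "(\<lambda>n. inverse (a (s / real n) / (C n / real n))) \<longlonglongrightarrow> inverse (Gamma (2 - \<beta>) * s powr \<beta>)"
    using G s by (intro tendsto_inverse a_lim) auto
  have "uniform_limit positive_sets (\<lambda>n A. a (s / real n) *\<^sub>R laplace (average A) (s / real n) v) (\<lambda>A. pair Y v) sequentially"
  proof (rule uniform_limitI)
    fix \<epsilon> :: real assume "\<epsilon> > 0"
    then have "\<forall>\<^sub>F u in at_right 0. \<forall>\<theta>. renewal_sequence \<theta> \<longrightarrow> cmod (a u *\<^sub>R laplace \<theta> u v - pair Y v) \<le> \<epsilon> / 2"
      by (intro renewal_asymptotics) simp
    from eventually_compose_filterlim[OF this u0]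
    show "\<forall>\<^sub>F n in sequentially. \<forall>A\<in>positive_sets. dist (a (s / real n) *\<^sub>R laplace (average A) (s / real n) v) (pair Y v) < \<epsilon>"
    proof eventually_elim
      case (elim n)
      show ?case
      proof
        fix A assume "A \<in> positive_sets"
        then have "renewal_sequence (average A)"
          using average_renewal_sequence(1)[OF ren] by (simp add: positive_sets_def)
        then show "dist (a (s / real n) *\<^sub>R laplace (average A) (s / real n) v) (pair Y v) < \<epsilon>"
          using elim \<open>\<epsilon> > 0\<close> by (auto simp: dist_norm intro: le_less_trans)
      qed
    qed
  qed
  from uniform_limit_scale[OF r_lim this]
  have lim: "uniform_limit positive_sets (\<lambda>n A. inverse (a (s / real n) / (C n / real n)) *\<^sub>R a (s / real n) *\<^sub>R laplace (average A) (s / real n) v)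
      (\<lambda>A. inverse (Gamma (2 - \<beta>) * s powr \<beta>) *\<^sub>R pair Y v) sequentially" .
  have ev: "\<forall>\<^sub>F n in sequentially. \<forall>A\<in>positive_sets. inverse (a (s / real n) / (C n / real n)) *\<^sub>R a (s / real n) *\<^sub>R laplace (average A) (s / real n) v
      = (C n / real n) *\<^sub>R (\<Sum>j. exp (- (s / real n * real j)) *\<^sub>R average A j v)"
  proof -
    \<comment> \<open>The ratio has a positive limit, so \<open>a (s / n)\<close> is eventually
      nonzero and cancels.\<close>
    have "\<forall>\<^sub>F n in sequentially. a (s / real n) / (C n / real n) > 0"
      using a_lim G s by (intro order_tendstoD(1)[OF a_lim]) auto
    then show ?thesis
      by eventually_elim (auto simp: laplace_def)
  qed
  have "uniform_limit positive_sets (\<lambda>n A. (C n / real n) *\<^sub>R (\<Sum>j. exp (- (s / real n * real j)) *\<^sub>R average A j v))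
      (\<lambda>A. inverse (Gamma (2 - \<beta>) * s powr \<beta>) *\<^sub>R pair Y v) sequentially"
    by (rule iffD1[OF uniform_limit_cong[OF ev] lim]) simp
  moreover have "inverse (Gamma (2 - \<beta>) * s powr \<beta>) *\<^sub>R pair Y v = s powr (- \<beta>) *\<^sub>R (pair Y v /\<^sub>R Gamma (2 - \<beta>))"
    by (simp add: powr_minus mult.commute)
  ultimately show ?thesis by (simp only: s_def)
qed

text \<open>Karamata's theorem with scale \<open>C n / n\<close>, bound \<open>norm v\<close> and
  the averages of \<open>e\<close> as majorant. These are real but typed as complex, so their limits
  are obtained through \<open>Re\<close>; since \<open>pair Y e = 1\<close>, the limit constant of
  the majorant is 1/\<Gamma>(2-\<beta>).\<close>

lemma average_sum_limit:
  assumes rv: "regularly_varying_tail c \<beta>"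
  shows "uniform_limit positive_sets
      (\<lambda>n A. (regularly_varying_tail.C c n / real n) *\<^sub>R (\<Sum>j=1..n. average A j v))
      (\<lambda>A. pair Y v /\<^sub>R (Gamma (2 - \<beta>) * Gamma (1 + \<beta>))) sequentially"
proof -
  interpret regularly_varying_tail c \<beta> by (rule rv)
  obtain S where ren: "operator_renewal (\<lambda>k. Rn (Suc k)) RB S (pair Y) e p"
    using operator_renewal_exists by blast
  note av = average_renewal_sequence[OF ren]
  have pos: "A \<in> sets MY" "measure MY A > 0" if "A \<in> positive_sets" for A
    using that by (simp_all add: positive_sets_def)
  obtain N :: "real measure" where N: "finite_measure N" "sets N = sets borel"
    "AE x in N. 0 \<le> x" "AE x in N. x \<noteq> 1"
    and N_pow: "\<And>k. (\<integral>x. exp (- x) ^ k \<partial>N) = real (Suc k) powr (- \<beta>)"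
    and N_ind: "(\<integral>x. indicator {..1} x * exp x \<partial>N) = 1 / Gamma (1 + \<beta>)"
    using gamma_weight[OF \<beta>_bounds(1)] by blast
  have G: "Gamma (2 - \<beta>) > 0" using \<beta>_bounds by (intro Gamma_real_pos) simp
  have "uniform_limit positive_sets (\<lambda>n A. (C n / real n) *\<^sub>R (\<Sum>j\<le>n. average A j v))
      (\<lambda>A. (\<integral>x. indicator {..1} x * exp x \<partial>N) *\<^sub>R (pair Y v /\<^sub>R Gamma (2 - \<beta>))) sequentially"
  proof (rule uniform_karamata_tauberian[OF N norm_ge_zero[of v]])
    show "0 \<le> inverse (Gamma (2 - \<beta>))" using G by simp
    show "0 \<le> C n / real n" for n using C_nonneg by simp
    show "0 \<le> Re (average A j e) \<and> Re (average A j e) \<le> 1" if "A \<in> positive_sets" for A j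
      using av(3,4)[OF pos[OF that]] by simp
    show "cmod (average A j v) \<le> norm v * Re (average A j e)" if "A \<in> positive_sets" for A j
      by (rule av(5)[OF pos[OF that]])
    show "uniform_limit positive_sets
       (\<lambda>n A. (C n / real n) *\<^sub>R (\<Sum>j. exp (- (real (Suc k) / real n * real j)) *\<^sub>R average A j v))
       (\<lambda>A. (\<integral>x. exp (- x) ^ k \<partial>N) *\<^sub>R (pair Y v /\<^sub>R Gamma (2 - \<beta>))) sequentially" for k
      unfolding N_pow by (rule laplace_average_limit[OF rv])
    fix k
    have Re_lim: "uniform_limit positive_sets
       (\<lambda>n A. Re ((C n / real n) *\<^sub>R (\<Sum>j. exp (- (real (Suc k) / real n * real j)) *\<^sub>R average A j e)))
       (\<lambda>A. Re (real (Suc k) powr (- \<beta>) *\<^sub>R (pair Y e /\<^sub>R Gamma (2 - \<beta>)))) sequentially"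
      by (rule bounded_linear.uniform_limit[OF bounded_linear_Re laplace_average_limit[OF rv]])
    have Re_eq: "Re ((C n / real n) *\<^sub>R (\<Sum>j. exp (- (real (Suc k) / real n * real j)) *\<^sub>R average A j e))
       = (C n / real n) *\<^sub>R (\<Sum>j. exp (- (real (Suc k) / real n * real j)) *\<^sub>R Re (average A j e))"
      if "A \<in> positive_sets" "n \<ge> 1" for A n
    proof -
      have "cmod (average A j e) \<le> norm e" for j
        using av(5)[OF pos[OF that(1)], of j e] av(4)[OF pos[OF that(1)], of j]
        by (meson mult_left_le norm_ge_zero order_trans)
      then have "summable (\<lambda>j. exp (- (real (Suc k) / real n * real j)) *\<^sub>R average A j e)"
        by (rule summable_exp_bounded) (use that in simp)
      then show ?thesis by (simp add: Re_suminf del: of_nat_Suc)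
    qed
    have "pair Y e = 1" using pair_e[OF Y_sets] MY.prob_space by simp
    then have "Re (real (Suc k) powr (- \<beta>) *\<^sub>R (pair Y e /\<^sub>R Gamma (2 - \<beta>))) = (\<integral>x. exp (- x) ^ k \<partial>N) *\<^sub>R inverse (Gamma (2 - \<beta>))"
      by (simp add: N_pow del: of_nat_Suc)
    moreover have "\<forall>\<^sub>F n in sequentially. \<forall>A\<in>positive_sets.
        Re ((C n / real n) *\<^sub>R (\<Sum>j. exp (- (real (Suc k) / real n * real j)) *\<^sub>R average A j e))
       = (C n / real n) *\<^sub>R (\<Sum>j. exp (- (real (Suc k) / real n * real j)) *\<^sub>R Re (average A j e))"
      using eventually_ge_at_top[of 1] by eventually_elim (blast intro: Re_eq)
    ultimately show "uniform_limit positive_sets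
       (\<lambda>n A. (C n / real n) *\<^sub>R (\<Sum>j. exp (- (real (Suc k) / real n * real j)) *\<^sub>R Re (average A j e)))
       (\<lambda>A. (\<integral>x. exp (- x) ^ k \<partial>N) *\<^sub>R inverse (Gamma (2 - \<beta>))) sequentially"
      using Re_lim by (intro iffD1[OF uniform_limit_cong Re_lim]) auto
  qed
  \<comment> \<open>The Tauberian sum starts at j = 0. That term is bounded by \<open>norm v\<close>
    and disappears under the scale \<open>C n / n\<close>.\<close>
  moreover have "uniform_limit positive_sets (\<lambda>n A. (C n / real n) *\<^sub>R average A 0 v) (\<lambda>A. 0) sequentially"
  proof (rule uniform_limitI)
    fix \<epsilon> :: real assume "\<epsilon> > 0"
    have "(\<lambda>n. C n / real n * norm v) \<longlonglongrightarrow> 0 * norm v"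
      by (intro tendsto_mult C_over_n_tendsto_0 c_tendsto_0 tendsto_const)
    then have "\<forall>\<^sub>F n in sequentially. C n / real n * norm v < \<epsilon>"
      using \<open>\<epsilon> > 0\<close> by (intro order_tendstoD(2)) auto
    then show "\<forall>\<^sub>F n in sequentially. \<forall>A\<in>positive_sets. dist ((C n / real n) *\<^sub>R average A 0 v) 0 < \<epsilon>"
    proof eventually_elim
      case (elim n)
      show ?case
      proof
        fix A assume A: "A \<in> positive_sets"
        have "cmod (average A 0 v) \<le> norm v"
          using av(5)[OF pos[OF A], of 0 v] av(4)[OF pos[OF A], of 0]
          by (meson mult_left_le norm_ge_zero order_trans)
        then have "C n / real n * cmod (average A 0 v) \<le> C n / real n * norm v"
          using C_nonneg by (intro mult_left_mono) auto
        then show "dist ((C n / real n) *\<^sub>R average A 0 v) 0 < \<epsilon>"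
          using elim C_nonneg[of n] by (simp add: dist_norm)
      qed
    qed
  qed
  ultimately have "uniform_limit positive_sets (\<lambda>n A. (C n / real n) *\<^sub>R (\<Sum>j\<le>n. average A j v) - (C n / real n) *\<^sub>R average A 0 v)
      (\<lambda>A. (\<integral>x. indicator {..1} x * exp x \<partial>N) *\<^sub>R (pair Y v /\<^sub>R Gamma (2 - \<beta>)) - 0) sequentially"
    by (rule uniform_limit_minus)
  moreover have "(C n / real n) *\<^sub>R (\<Sum>j\<le>n. average A j v) - (C n / real n) *\<^sub>R average A 0 v
      = (C n / real n) *\<^sub>R (\<Sum>j=1..n. average A j v)" for A n
  proof -
    have "(\<Sum>j\<le>n. average A j v) = average A 0 v + (\<Sum>j=1..n. average A j v)"
      by (simp add: atMost_atLeast0 sum.atLeast_Suc_atMost)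
    then show ?thesis by (simp add: scaleR_add_right)
  qed
  moreover have "(\<integral>x. indicator {..1} x * exp x \<partial>N) *\<^sub>R (pair Y v /\<^sub>R Gamma (2 - \<beta>)) - 0
      = pair Y v /\<^sub>R (Gamma (2 - \<beta>) * Gamma (1 + \<beta>))"
    unfolding N_ind by (simp add: divide_inverse mult.commute)
  ultimately show ?thesis by (simp only:)
qed

text \<open>Links the abstract averages with the iterates of \<open>L\<close> on the zero
  extension.\<close>

lemma set_integral_transfer:
  assumes L: "transfer_operator M f L" and A: "A \<in> sets MY"
  shows "integrable MY ((L ^^ j) (extend_by_zero Y (\<iota> v)))"
    and "(\<integral>y. indicator A y *\<^sub>R (L ^^ j) (extend_by_zero Y (\<iota> v)) y \<partial>MY) = pair (preimage j A) v"
proof -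
  have A': "A \<in> sets M" "A \<subseteq> Y" using A by (simp_all add: sets_MY)
  have Y': "Y \<inter> space M \<in> sets M" using Y_sets by simp
  define u where "u = extend_by_zero Y (\<iota> v)"
  have u_eq: "u = (\<lambda>x. indicator Y x *\<^sub>R \<iota> v x)" by (auto simp: u_def extend_by_zero_def)
  have u: "integrable M u" using \<iota>_integrable[of v] by (simp add: u_eq integrable_restrict_space[OF Y'])
  have Lu: "integrable M ((L ^^ j) u)" "(\<integral>x. (L ^^ j) u x * indicator A x \<partial>M) = (\<integral>x. u x * indicator (preimage j A) x \<partial>M)"
    using transfer_powers[OF L u A'(1)] by simp_all
  have "integrable M (\<lambda>x. indicator Y x *\<^sub>R (L ^^ j) u x)"
    by (rule integrable_mult_indicator[OF Y_sets Lu(1)])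
  then show "integrable MY ((L ^^ j) (extend_by_zero Y (\<iota> v)))"
    by (simp add: integrable_restrict_space[OF Y'] u_def)
  have "(\<integral>y. indicator A y *\<^sub>R (L ^^ j) u y \<partial>MY) = (\<integral>x. (L ^^ j) u x * indicator A x \<partial>M)"
    unfolding integral_restrict_space[OF Y']
    by (rule Bochner_Integration.integral_cong) (use A'(2) in \<open>auto simp: indicator_def\<close>)
  also have "\<dots> = pair (preimage j A) v"
    unfolding Lu(2) unfolding pair_def integral_restrict_space[OF Y'] u_eq
    by (rule Bochner_Integration.integral_cong) auto
  finally show "(\<integral>y. indicator A y *\<^sub>R (L ^^ j) (extend_by_zero Y (\<iota> v)) y \<partial>MY) = pair (preimage j A) v"
    by (simp add: u_def)
qed

text \<open>An integrable function whose averages over all sets of positive measure lie in a closed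
  ball has almost all its values there, so averages that are small uniformly in the set force a
  small norm.\<close>

lemma Linf_norm_tendsto_0:
  assumes int: "\<And>n. integrable MY (g n)"
    and avg: "uniform_limit positive_sets (\<lambda>n A. set_lebesgue_integral MY A (g n) /\<^sub>R measure MY A) (\<lambda>_. 0) sequentially"
  shows "(\<lambda>n. Linf_norm MY (g n)) \<longlonglongrightarrow> 0"
proof (rule order_tendstoI)
  fix y :: ereal assume "y < 0"
  \<comment> \<open>An essential supremum in the extended reals would be -\<infinity> on a null
    space; total mass 1 excludes this.\<close>
  have "0 \<le> Linf_norm MY (g n)" for n
  proof -
    have "esssup MY (\<lambda>_. 0 :: ereal) \<le> Linf_norm MY (g n)"
      unfolding Linf_norm_def by (rule esssup_mono) auto
    then show ?thesis using MY.emeasure_space_1 by (simp add: esssup_const)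
  qed
  then show "\<forall>\<^sub>F n in sequentially. y < Linf_norm MY (g n)"
    using \<open>y < 0\<close> by (auto intro: always_eventually less_le_trans)
next
  fix y :: ereal assume "0 < y"
  then obtain \<epsilon> where \<epsilon>: "0 < \<epsilon>" "ereal \<epsilon> < y" using ereal_dense2[of 0 y] by auto
  from uniform_limitD[OF avg \<epsilon>(1)]
  show "\<forall>\<^sub>F n in sequentially. Linf_norm MY (g n) < y"
  proof eventually_elim
    case (elim n)
    have "AE x in MY. g n x \<in> cball 0 \<epsilon>"
    proof (rule MY.averaging_theorem[OF int closed_cball])
      fix A assume "A \<in> sets MY" "0 < measure MY A"
      then have "A \<in> positive_sets" by (simp add: positive_sets_def)
      from elim[rule_format, OF this]
      show "(1 / measure MY A) *\<^sub>R set_lebesgue_integral MY A (g n) \<in> cball 0 \<epsilon>"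
        by (simp add: dist_commute divide_inverse)
    qed
    then have "AE x in MY. ereal (cmod (g n x)) \<le> ereal \<epsilon>" by eventually_elim simp
    moreover have "(\<lambda>x. ereal (cmod (g n x))) \<in> borel_measurable MY"
      using borel_measurable_integrable[OF int[of n]] by measurable
    ultimately have "Linf_norm MY (g n) \<le> ereal \<epsilon>"
      unfolding Linf_norm_def by (intro esssup_I)
    then show ?case using \<epsilon>(2) by (rule le_less_trans)
  qed
qed

text \<open>The normalisation is its ratio to \<open>C n / n\<close> times \<open>C n / n\<close>.
  The ratio tends to \<Gamma>(2-\<beta>) \<Gamma>(1+\<beta>), the averages scaled by
  \<open>C n / n\<close> tend to the integral divided by that same constant, and the two
  cancel.\<close>

theorem pointwise_dual_ergodicity:
  assumes L: "transfer_operator M f L" and rv: "regularly_varying_tail c \<beta>"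
    and c: "\<And>n. n \<ge> 1 \<Longrightarrow> c n = l (real n) * real n powr (- \<beta>)"
  shows "(\<lambda>n. Linf_norm MY (\<lambda>y.
        complex_of_real (D_const \<beta> * m_seq \<beta> l n * real n powr (- \<beta>)) *
          (\<Sum>j = 1..n. (L ^^ j) (extend_by_zero Y (\<iota> v)) y)
        - (\<integral>x. \<iota> v x \<partial>MY))) \<longlonglongrightarrow> 0"
proof (rule Linf_norm_tendsto_0)
  interpret regularly_varying_tail c \<beta> by (rule rv)
  define \<kappa> where "\<kappa> n = D_const \<beta> * m_seq \<beta> l n * real n powr (- \<beta>)" for n
  let ?u = "extend_by_zero Y (\<iota> v)"
  define g where "g n y = complex_of_real (\<kappa> n) * (\<Sum>j = 1..n. (L ^^ j) ?u y) - pair Y v" for n y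
  have Lint: "integrable MY ((L ^^ j) ?u)" for j
    using set_integral_transfer(1)[OF L sets.empty_sets] .
  have gint: "integrable MY (g n)" for n
    unfolding g_def using Lint by simp
  show "integrable MY (\<lambda>y. complex_of_real (D_const \<beta> * m_seq \<beta> l n * real n powr (- \<beta>)) *
          (\<Sum>j = 1..n. (L ^^ j) ?u y) - (\<integral>x. \<iota> v x \<partial>MY))" for n
    using gint[of n] by (simp only: g_def[abs_def] \<kappa>_def pair_Y)
  have G: "Gamma (2 - \<beta>) * Gamma (1 + \<beta>) \<noteq> 0"
  proof -
    have "Gamma (2 - \<beta>) > 0" "Gamma (1 + \<beta>) > 0"
      using \<beta>_bounds by (auto intro!: Gamma_real_pos)
    then show ?thesis by simp
  qed
  have "uniform_limit positive_sets (\<lambda>n A. (\<kappa> n / (C n / real n)) *\<^sub>R (C n / real n) *\<^sub>R (\<Sum>j=1..n. average A j v))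
      (\<lambda>A. (Gamma (2 - \<beta>) * Gamma (1 + \<beta>)) *\<^sub>R (pair Y v /\<^sub>R (Gamma (2 - \<beta>) * Gamma (1 + \<beta>)))) sequentially"
    unfolding \<kappa>_def
    by (rule uniform_limit_scale[OF normalisation_tendsto[OF c] average_sum_limit[OF rv]])
  then have "uniform_limit positive_sets (\<lambda>n A. (\<kappa> n / (C n / real n)) *\<^sub>R (C n / real n) *\<^sub>R (\<Sum>j=1..n. average A j v) - pair Y v)
      (\<lambda>A. (Gamma (2 - \<beta>) * Gamma (1 + \<beta>)) *\<^sub>R (pair Y v /\<^sub>R (Gamma (2 - \<beta>) * Gamma (1 + \<beta>))) - pair Y v) sequentially"
    by (intro uniform_limit_minus uniform_limit_const)
  then have lim: "uniform_limit positive_sets (\<lambda>n A. (\<kappa> n / (C n / real n)) *\<^sub>R (C n / real n) *\<^sub>R (\<Sum>j=1..n. average A j v) - pair Y v)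
      (\<lambda>A. 0) sequentially"
    by (simp only: scaleR_scaleR right_inverse[OF G] scaleR_one diff_self)
  have "uniform_limit positive_sets (\<lambda>n A. set_lebesgue_integral MY A (g n) /\<^sub>R measure MY A) (\<lambda>_. 0) sequentially"
  proof (rule iffD1[OF uniform_limit_cong lim])
    show "\<forall>\<^sub>F n in sequentially. \<forall>A\<in>positive_sets. (\<kappa> n / (C n / real n)) *\<^sub>R (C n / real n) *\<^sub>R (\<Sum>j=1..n. average A j v) - pair Y v
       = set_lebesgue_integral MY A (g n) /\<^sub>R measure MY A"
      using eventually_ge_at_top[of 1]
    proof eventually_elim
      case (elim n)
      have Cn: "C n / real n \<noteq> 0" using C_ge_1[OF elim] elim by simp
      show ?case
      proof
        fix A assume "A \<in> positive_sets"
        then have A: "A \<in> sets MY" "measure MY A > 0" by (simp_all add: positive_sets_def)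
        define h where "h j y = indicator A y *\<^sub>R (L ^^ j) ?u y" for j y
        have h: "integrable MY (h j)" "(\<integral>y. h j y \<partial>MY) = pair (preimage j A) v" for j
          unfolding h_def by (rule integrable_mult_indicator[OF A(1) Lint], rule set_integral_transfer(2)[OF L A(1)])
        have iA: "integrable MY (\<lambda>y. indicator A y *\<^sub>R pair Y v)"
          by (rule integrable_mult_indicator[OF A(1)]) simp
        have "set_lebesgue_integral MY A (g n) = (\<integral>y. complex_of_real (\<kappa> n) * (\<Sum>j = 1..n. h j y) - indicator A y *\<^sub>R pair Y v \<partial>MY)"
          unfolding set_lebesgue_integral_def g_def h_def
          by (rule Bochner_Integration.integral_cong) (auto simp: scaleR_diff_right scaleR_sum_right[symmetric])
        also have "\<dots> = complex_of_real (\<kappa> n) * (\<Sum>j = 1..n. pair (preimage j A) v) - measure MY A *\<^sub>R pair Y v"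
        proof -
          have "(\<integral>y. indicator A y *\<^sub>R pair Y v \<partial>MY) = measure MY A *\<^sub>R pair Y v"
          proof -
            have "integrable MY (indicator A :: 'a \<Rightarrow> real)"
              using A(1) by (simp add: MY.emeasure_finite less_top[symmetric])
            then show ?thesis
              using sets.sets_into_space[OF A(1)] by (subst integral_scaleR_left) (simp_all add: Int_absorb2)
          qed
          then show ?thesis
            using h iA by (subst Bochner_Integration.integral_diff) auto
        qed
        finally have "set_lebesgue_integral MY A (g n) /\<^sub>R measure MY A = \<kappa> n *\<^sub>R (\<Sum>j = 1..n. average A j v) - pair Y v"
          using A(2) by (simp add: average_def scaleR_conv_of_real sum_divide_distrib[symmetric] field_simps)
        then show "(\<kappa> n / (C n / real n)) *\<^sub>R (C n / real n) *\<^sub>R (\<Sum>j=1..n. average A j v) - pair Y v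
            = set_lebesgue_integral MY A (g n) /\<^sub>R measure MY A"
          using Cn by (simp only: scaleR_scaleR) simp
      qed
    qed
  qed simp
  then show "uniform_limit positive_sets (\<lambda>n A. set_lebesgue_integral MY A (\<lambda>y. complex_of_real (D_const \<beta> * m_seq \<beta> l n * real n powr (- \<beta>)) *
          (\<Sum>j = 1..n. (L ^^ j) ?u y) - (\<integral>x. \<iota> v x \<partial>MY)) /\<^sub>R measure MY A) (\<lambda>_. 0) sequentially"
    by (simp only: g_def[abs_def] \<kappa>_def pair_Y)
qed

end

theorem theorem3p1:
  fixes M :: "'a measure" and f :: "'a \<Rightarrow> 'a" and Y :: "'a set"
    and L R :: "('a \<Rightarrow> complex) \<Rightarrow> ('a \<Rightarrow> complex)"
    and \<iota> :: "'b::complex_banach \<Rightarrow> 'a \<Rightarrow> complex"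
    and Rn :: "nat \<Rightarrow> ('b \<Rightarrow>\<^sub>L 'b)" and RB :: "'b \<Rightarrow>\<^sub>L 'b"
    and \<beta> :: real and l :: "real \<Rightarrow> real"
  defines "\<phi> \<equiv> return_time f Y"
  defines "MY \<equiv> restrict_space M Y"
  assumes "sigma_finite_measure M" and "emeasure M (space M) = \<infinity>"
    and "measure_preserving_map M f" and "conservative M f"
    and "transfer_operator M f L"
    and "Y \<in> sets M" and "emeasure M Y = 1"
    and "AE y in MY. \<phi> y < \<infinity>"
    and "(\<integral>\<^sup>+ y. ennreal_of_enat (\<phi> y) \<partial>MY) = \<infinity>"
    and "transfer_operator MY (return_map f Y) R"
    and "Linf_function_space MY \<iota>"
    and "\<And>v. Linf_norm MY (\<iota> v) \<le> ereal (norm v)"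
    and "\<And>n. n \<ge> 1 \<Longrightarrow> induces_operator MY \<iota> (level_operator \<phi> R n) (Rn n)"
    and "summable (\<lambda>n. norm (Rn (Suc n)))"
    and "induces_operator MY \<iota> R RB"
    and "simple_isolated_eigenvalue RB 1"
    and "0 \<le> \<beta>" and "\<beta> \<le> 1"
    and "slowly_varying l"
    and "\<And>n::nat. n \<ge> 1 \<Longrightarrow>
           measure M {y \<in> Y. \<phi> y > enat n} = l (real n) * real n powr (- \<beta>)"
  shows "\<forall>v :: 'b.
    (\<lambda>n. Linf_norm MY (\<lambda>y.
        complex_of_real (D_const \<beta> * m_seq \<beta> l n * real n powr (- \<beta>)) *
          (\<Sum>j = 1..n. (L ^^ j) (extend_by_zero Y (\<iota> v)) y)
        - (\<integral>x. \<iota> v x \<partial>MY)))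
    \<longlonglongrightarrow> 0"
proof
  fix v :: 'b
  note a = assms(3-)[unfolded MY_def \<phi>_def]
  interpret renewal_space M f Y R \<iota> Rn RB
    by unfold_locales (fact a)+
  have c: "c n = l (real n) * real n powr (- \<beta>)" if "n \<ge> 1" for n
    using a(20)[OF that] tail_subset[of n] by (simp add: c_def measure_MY) (simp add: tail_def)
  have rv: "regularly_varying_tail c \<beta>"
    by (rule regularly_varying_tail_c[OF a(19) a(17,18) c a(9)])
  show "(\<lambda>n. Linf_norm MY (\<lambda>y.
        complex_of_real (D_const \<beta> * m_seq \<beta> l n * real n powr (- \<beta>)) *
          (\<Sum>j = 1..n. (L ^^ j) (extend_by_zero Y (\<iota> v)) y)
        - (\<integral>x. \<iota> v x \<partial>MY))) \<longlonglongrightarrow> 0"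
    unfolding MY_def by (rule pointwise_dual_ergodicity[OF a(5) rv c])
qed

end
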